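(* Let $(b_N)_{N\ge1}$ be integers with $0\le b_N<N$, $b_N\to\infty$ and $b_N/N\to0$ as $N\to\infty$. Let $(a_j)_{j\in\mathbb Z}$ be a sequence of independent real random variables with $\mathbb E[a_j]=0$ and $\mathbb E[|a_j|^2]=1$ for all $j\in\mathbb Z$, and $\sup_{j\in\mathbb Z}\mathbb E[|a_j|^k]=C_k<\infty$ for every $k\in\mathbb N$. Let $H_N=P_NT_N$ be the associated real symmetric Hankel band matrix with bandwidth $b_N$, where $T_N=(\eta_{ij}a_{i-j})_{i,j=1}^N$ with $\eta_{ij}=1$ if $|i-j|\le b_N$ and $\eta_{ij}=0$ otherwise, and $P_N=(\delta_{i-1,N-j})_{i,j=1}^N$. For $N$ with $b_N\ge1$ put $Y_N=H_N/\sqrt{2b_N}$. Then: (1) $\mu_{Y_N}$ converges weakly, as $N\to\infty$, to the distribution on $\mathbb R$ with density $f(x)=|x|\exp(-x^2)$, in the sense that for every bounded continuous $g:\mathbb R\to\mathbb R$, $$\mathbb E\Big[\int g\,\mathrm d\mu_{Y_N}\Big]\to\int_{\mathbb R} g(x)\,|x|\,e^{-x^2}\,\mathrm dx.$$ (2) If in addition there exist constants $\epsilon_0>0$ and $C>0$ such that $b_N\ge C\,N^{\frac12+\epsilon_0}$ for all sufficiently large $N$, then, almost surely, $\mu_{Y_N}$ converges weakly to the distribution with density $f(x)=|x|\exp(-x^2)$ as $N\to\infty$.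
   Context: For a real symmetric $N\times N$ matrix $A$ with eigenvalues $\lambda_1,\dots,\lambda_N$, its eigenvalue distribution is the probability measure $\mu_A=\frac1N\sum_{j=1}^N\delta_{\lambda_j}$; if $A$ is random, $\mu_A$ is a random measure. $\delta_{i,j}$ (with two indices) is the Kronecker delta. All random variables $a_j$ are defined on one probability space, and the same sequence $(a_j)$ is used for all $N$. *)

theory Defs
  imports "HOL-Probability.Probability" "Jordan_Normal_Form.Char_Poly"
begin

(* The eigenvalues lambda_1, ..., lambda_N, repeated according to multiplicity.  For real
   symmetric A the characteristic polynomial splits over the reals, so there are
   exactly N of them. *)
definition eigenvalue_mset :: "real mat \<Rightarrow> real multiset" where
  "eigenvalue_mset A = proots (char_poly A)"

definition eigenvalue_distribution :: "real mat \<Rightarrow> real measure" where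
  "eigenvalue_distribution A = measure_of UNIV (sets borel)
     (\<lambda>S. (\<Sum>x\<in>#eigenvalue_mset A. emeasure (return borel x) S) / of_nat (dim_row A))"

(* JNF matrices are indexed from 0: entry (i, j) below is entry (i + 1, j + 1) of the
   usual notation.  This leaves i - j unchanged and turns i - 1 = N - j into i = N - (j + 1). *)
definition toeplitz_band :: "nat \<Rightarrow> nat \<Rightarrow> (int \<Rightarrow> real) \<Rightarrow> real mat" where
  "toeplitz_band N b a =
     mat N N (\<lambda>(i, j). if \<bar>int i - int j\<bar> \<le> int b then a (int i - int j) else 0)"

definition flip_mat :: "nat \<Rightarrow> real mat" where
  "flip_mat N = mat N N (\<lambda>(i, j). if i = N - (j + 1) then 1 else 0)"

definition hankel_band :: "nat \<Rightarrow> nat \<Rightarrow> (int \<Rightarrow> real) \<Rightarrow> real mat" where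
  "hankel_band N b a = flip_mat N * toeplitz_band N b a"

(* For b = 0 the factor is 1 / 0 = 0; this concerns only finitely many N when b tends to infinity. *)
definition scaled_hankel_band :: "nat \<Rightarrow> nat \<Rightarrow> (int \<Rightarrow> real) \<Rightarrow> real mat" where
  "scaled_hankel_band N b a = (1 / sqrt (2 * real b)) \<cdot>\<^sub>m hankel_band N b a"

lemma sets_eigenvalue_distribution [simp, measurable_cong]:
  "sets (eigenvalue_distribution A) = sets borel"
  by (simp add: eigenvalue_distribution_def sets.sigma_sets_eq[of borel, simplified])

lemma space_eigenvalue_distribution [simp]: "space (eigenvalue_distribution A) = UNIV"
  by (simp add: eigenvalue_distribution_def)

lemma emeasure_eigenvalue_distribution:
  assumes "S \<in> sets borel"
  shows "emeasure (eigenvalue_distribution A) S =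
    (\<Sum>x\<in>#eigenvalue_mset A. emeasure (return borel x) S) / of_nat (dim_row A)"
proof -
  define F where "F M S = (\<Sum>x\<in>#M. emeasure (return borel x) S)"
    for M :: "real multiset" and S
  have sums: "(\<Sum>i. F M (B i)) = F M (\<Union>i. B i)"
    if "range B \<subseteq> sets borel" "disjoint_family B" for M B
  proof (induction M)
    case empty
    then show ?case by (simp add: F_def)
  next
    case (add x M)
    have "(\<Sum>i. emeasure (return borel x) (B i)) = emeasure (return borel x) (\<Union>i. B i)"
      using that by (intro suminf_emeasure) auto
    with add show ?case
      by (simp add: F_def suminf_add[symmetric] summableI)
  qed
  have pos: "positive (sets borel) (\<lambda>S. F (eigenvalue_mset A) S / of_nat (dim_row A))"
    by (simp add: positive_def F_def)
  have cadd: "countably_additive (sets borel)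
      (\<lambda>S. F (eigenvalue_mset A) S / of_nat (dim_row A))"
    unfolding countably_additive_def
    by (auto simp: divide_ennreal_def ennreal_suminf_multc sums)
  show ?thesis
    using emeasure_measure_of[OF eigenvalue_distribution_def, of A S] assms pos cadd
    by (simp add: F_def)
qed

end

theory Submission
  imports Defs "Jordan_Normal_Form.Schur_Decomposition" "HOL-Real_Asymp.Real_Asymp"
begin

text \<open>
The proof is by the method of moments. The \<open>k\<close>-th moment of the spectral law of a symmetric matrix
is the normalised trace of its \<open>k\<close>-th power, which is a sum over closed walks on the row indices
\<open>0, ..., N - 1\<close>. In the Hankel band matrix a step with label \<open>y\<close>, which picks up the factor
\<open>a y\<close>, leads from \<open>x\<close> to \<open>N - 1 - x - y\<close>, so two steps with labels \<open>y\<close> and \<open>z\<close> lead from \<open>x\<close> to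
\<open>x + y - z\<close>. A walk is thus given by its start and its labels in \<open>{- b..b}\<close>. For even \<open>k\<close> it can
only be closed if the alternating sum of the labels is zero, and then it is closed for every start
at distance at least \<open>k b\<close> from both ends, which is a proportion \<open>1 - O(b / N)\<close> of all starts.
For odd \<open>k\<close> at most one start closes it. Hence a moment is a weighted sum of monomials
in the noise over label tuples, which for even \<open>k\<close> are subject to one linear constraint
(\<open>hankel_moment\<close>).

Since the noise is independent and centred, the expectation of a monomial is zero unless every
label occurs at least twice. What remains is a count: the number of label tuples with a given
pattern of coincidences is at most \<open>(2 b + 1) ^ (d - r)\<close>, where \<open>d\<close> is the number of distinct
labels and \<open>r\<close> the number of independent conditions that the constraints impose on them
(\<open>card_constrained_le\<close>). For \<open>k = 2 p\<close> and one walk, \<open>d \<le> p\<close>, and the full order \<open>b ^ p\<close> is reached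
only if there are \<open>p\<close> distinct labels on which the constraint is empty, that is, if every label
occurs once at an even and once at an odd position. Such a tuple is an injective choice of \<open>p\<close>
labels together with a permutation of them, so there are about \<open>p! (2 b) ^ p\<close> of them
(\<open>card_matched\<close>). After normalisation the mean of the moment of order \<open>2 p\<close> tends to \<open>p!\<close>, which is the
moment of order \<open>2 p\<close> of the density \<open>\<bar>x\<bar> exp (- x ^ 2)\<close>.

For the fluctuations four walks are considered jointly. Their contribution to the fourth central
moment vanishes unless every label is repeated and every walk shares a label with another one, and
this costs at least two degrees of freedom (\<open>card_clustered_le\<close>). Therefore the fourth central
moment of an even moment is \<open>O(1 / b ^ 2)\<close>, and so is the fourth moment of an odd moment. If
\<open>b\<close> grows faster than \<open>N powr (1 / 2)\<close> by a power, these bounds are summable and all moments converge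
almost surely. Convergence of all moments implies weak convergence because the moments of the limit
grow so slowly that the Taylor series of its characteristic function converges (\<open>moment_method\<close>).

Convergence of the expected spectral law without the growth condition follows by subsequences:
along any sequence of sizes on which \<open>b\<close> exceeds the index the convergence is almost sure, hence
by dominated convergence the expectations converge as well, and this for enough subsequences
implies convergence of the whole sequence.
\<close>

(* The dollar sign is kept for vectors whose dimension is a term. *)
unbundle no vec_syntax

section \<open>Spectral laws of real symmetric matrices\<close>

unbundle no vec_syntax

text \<open>
The characteristic polynomial splits over the complex numbers. A complex root has an eigenvector
\<open>v\<close>, and the value of the quadratic form of the matrix at \<open>v\<close> is both real and the product of the
root with the positive number \<open>\<parallel>v\<parallel> ^ 2\<close>. So all roots are real.
\<close>
lemma char_poly_splits_if_symmetric:
  fixes A :: "real mat"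
  assumes A: "A \<in> carrier_mat n n"
    and sym: "\<And>i j. i < n \<Longrightarrow> j < n \<Longrightarrow> A $$ (i, j) = A $$ (j, i)"
  obtains es where "char_poly A = (\<Prod>e\<leftarrow>es. [:- e, 1:])" "length es = n"
proof -
  let ?C = "map_mat complex_of_real A"
  have C: "?C \<in> carrier_mat n n" using A by simp
  from char_poly_factorized[OF C] obtain zs
    where zs: "char_poly ?C = (\<Prod>z\<leftarrow>zs. [:- z, 1:])" and len: "length zs = n" by blast
  have real: "Im z = 0" if "z \<in> set zs" for z
  proof -
    have "poly (char_poly ?C) z = 0"
      unfolding zs using that by (auto simp: poly_prod_list prod_list_zero_iff)
    hence "eigenvalue ?C z" by (simp add: eigenvalue_root_char_poly[OF C])
    then obtain v where v: "v \<in> carrier_vec n" "v \<noteq> 0\<^sub>v n" "?C *\<^sub>v v = z \<cdot>\<^sub>v v"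
      using C by (auto simp: eigenvalue_def eigenvector_def)
    have row: "(\<Sum>j<n. complex_of_real (A $$ (i, j)) * v $ j) = z * v $ i" if "i < n" for i
    proof -
      have "(?C *\<^sub>v v) $ i = (\<Sum>j<n. complex_of_real (A $$ (i, j)) * v $ j)"
        using that A v(1) by (auto simp: scalar_prod_def lessThan_atLeast0 intro!: sum.cong)
      thus ?thesis using v(1,3) that by simp
    qed
    define q where "q = (\<Sum>i<n. \<Sum>j<n. cnj (v $ i) * (complex_of_real (A $$ (i, j)) * v $ j))"
    define s where "s = (\<Sum>i<n. (cmod (v $ i))\<^sup>2)"
    have "q = (\<Sum>i<n. cnj (v $ i) * (z * v $ i))"
      unfolding q_def by (intro sum.cong refl) (simp add: sum_distrib_left[symmetric] row)
    also have "\<dots> = z * complex_of_real s"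
      unfolding s_def of_real_sum sum_distrib_left
      by (intro sum.cong refl) (simp only: complex_norm_square mult_ac)
    finally have q: "q = z * complex_of_real s" .
    (* q is its own conjugate because A is real and symmetric. *)
    have "cnj q = (\<Sum>i<n. \<Sum>j<n. v $ i * (complex_of_real (A $$ (i, j)) * cnj (v $ j)))"
      by (simp add: q_def)
    also have "\<dots> = (\<Sum>j<n. \<Sum>i<n. v $ i * (complex_of_real (A $$ (i, j)) * cnj (v $ j)))"
      by (rule sum.swap)
    also have "\<dots> = q"
      unfolding q_def by (intro sum.cong refl) (use sym in \<open>simp add: mult_ac\<close>)
    finally have "Im q = 0" by (simp add: complex_eq_iff)
    moreover have "s > 0"
    proof -
      obtain i where i: "i < n" "v $ i \<noteq> 0"
        using v(1,2) by (metis carrier_vecD eq_vecI index_zero_vec(1) index_zero_vec(2))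
      hence "0 < (cmod (v $ i))\<^sup>2" by simp
      also have "\<dots> \<le> s" unfolding s_def using i by (intro member_le_sum) auto
      finally show ?thesis .
    qed
    ultimately show ?thesis using q by simp
  qed
  interpret h: map_poly_inj_idom_hom complex_of_real ..
  have "map_poly complex_of_real (char_poly A) = char_poly ?C"
    by (simp add: of_real_hom.char_poly_hom[OF A])
  also have "\<dots> = (\<Prod>z\<leftarrow>zs. map_poly complex_of_real [:- Re z, 1:])"
    unfolding zs using real
    by (intro arg_cong[where f = prod_list] map_cong refl)
       (auto simp: map_poly_pCons complex_eq_iff)
  also have "\<dots> = map_poly complex_of_real (\<Prod>e\<leftarrow>map Re zs. [:- e, 1:])"
    by (induction zs) (simp_all add: h.hom_mult del: mult_pCons_left)
  finally have "char_poly A = (\<Prod>e\<leftarrow>map Re zs. [:- e, 1:])"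
    by simp
  thus thesis using that[of "map Re zs"] len by simp
qed

lemma upper_triangular_pow:
  fixes B :: "'a :: comm_ring_1 mat"
  assumes B: "B \<in> carrier_mat n n" and ut: "upper_triangular B" and i: "i < n"
  shows "j \<le> i \<Longrightarrow> (B ^\<^sub>m k) $$ (i, j) = (if j = i then (B $$ (i, i)) ^ k else 0)"
proof (induction k arbitrary: j)
  case 0
  then show ?case using B i by auto
next
  case (Suc k)
  have Bk: "B ^\<^sub>m k \<in> carrier_mat n n" using B by simp
  have "(B ^\<^sub>m Suc k) $$ (i, j) = (\<Sum>m<n. (B ^\<^sub>m k) $$ (i, m) * B $$ (m, j))"
    using B Bk i Suc.prems by (simp add: scalar_prod_def lessThan_atLeast0)
  also have "\<dots> = (\<Sum>m\<in>{i}. (B ^\<^sub>m k) $$ (i, m) * B $$ (m, j))"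
  proof (intro sum.mono_neutral_right ballI)
    fix m assume m: "m \<in> {..<n} - {i}"
    show "(B ^\<^sub>m k) $$ (i, m) * B $$ (m, j) = 0"
    proof (cases "m < i")
      case True
      thus ?thesis using Suc.IH[of m] by simp
    next
      case False
      hence "B $$ (m, j) = 0" using m Suc.prems B ut by (intro upper_triangularD) auto
      thus ?thesis by simp
    qed
  qed (use i in auto)
  also have "\<dots> = (if j = i then (B $$ (i, i)) ^ Suc k else 0)"
    using Suc.IH[of i] Suc.prems upper_triangularD[OF ut, of j i] B i
    by (auto simp: mult.commute)
  finally show ?case .
qed

lemma sum_diag_mult_commute:
  fixes A B :: "'a :: comm_semiring_0 mat"
  assumes "A \<in> carrier_mat n n" "B \<in> carrier_mat n n"
  shows "(\<Sum>i<n. (A * B) $$ (i, i)) = (\<Sum>i<n. (B * A) $$ (i, i))"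
proof -
  have "(\<Sum>i<n. (A * B) $$ (i, i)) = (\<Sum>i<n. \<Sum>j<n. A $$ (i, j) * B $$ (j, i))"
    using assms by (auto simp: scalar_prod_def lessThan_atLeast0 intro!: sum.cong)
  also have "\<dots> = (\<Sum>j<n. \<Sum>i<n. A $$ (i, j) * B $$ (j, i))"
    by (rule sum.swap)
  also have "\<dots> = (\<Sum>j<n. (B * A) $$ (j, j))"
    using assms by (auto simp: scalar_prod_def lessThan_atLeast0 mult.commute intro!: sum.cong)
  finally show ?thesis .
qed

text \<open>
By Schur decomposition the matrix is similar to an upper triangular one with the eigenvalues on its
diagonal. Powers respect both similarity and triangularity, and the trace is invariant under
similarity.
\<close>
lemma eigenvalue_mset_symmetric:
  fixes A :: "real mat"
  assumes A: "A \<in> carrier_mat n n"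
    and sym: "\<And>i j. i < n \<Longrightarrow> j < n \<Longrightarrow> A $$ (i, j) = A $$ (j, i)"
  shows size_eigenvalue_mset: "size (eigenvalue_mset A) = n"
    and sum_eigenvalue_power: "(\<Sum>x\<in>#eigenvalue_mset A. x ^ k) = (\<Sum>i<n. (A ^\<^sub>m k) $$ (i, i))"
proof -
  obtain es where es: "char_poly A = (\<Prod>e\<leftarrow>es. [:- e, 1:])" "length es = n"
    using char_poly_splits_if_symmetric[OF assms] by blast
  have "proots (\<Prod>e\<leftarrow>es. [:- e, 1:]) = mset es"
  proof (induction es)
    case (Cons e es)
    have "(\<Prod>e\<leftarrow>es. [:- e, 1:]) \<noteq> 0" by (auto simp: prod_list_zero_iff)
    thus ?case using Cons by (simp add: proots_mult del: mult_pCons_left)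
  qed simp
  hence mset: "eigenvalue_mset A = mset es"
    by (simp add: eigenvalue_mset_def es(1))
  show "size (eigenvalue_mset A) = n" by (simp add: mset es)
  obtain B P Q where BPQ: "schur_decomposition A es = (B, P, Q)"
    by (cases "schur_decomposition A es") auto
  from schur_decomposition[OF A es(1) BPQ]
  have sim: "similar_mat_wit A B P Q" and ut: "upper_triangular B" and diag: "diag_mat B = es"
    by auto
  note D = similar_mat_witD2[OF A sim]
  have Bk: "B ^\<^sub>m k \<in> carrier_mat n n" using D by simp
  have "(\<Sum>i<n. (A ^\<^sub>m k) $$ (i, i)) = (\<Sum>i<n. (P * (B ^\<^sub>m k * Q)) $$ (i, i))"
    using similar_mat_wit_pow_id[OF sim, of k] D Bk by (simp add: assoc_mult_mat[of _ n n _ n _ n])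
  also have "\<dots> = (\<Sum>i<n. (B ^\<^sub>m k * Q * P) $$ (i, i))"
    using D Bk by (intro sum_diag_mult_commute) auto
  also have "B ^\<^sub>m k * Q * P = B ^\<^sub>m k"
    using D Bk by (simp add: assoc_mult_mat[of _ n n _ n _ n])
  also have "(\<Sum>i<n. (B ^\<^sub>m k) $$ (i, i)) = (\<Sum>i<n. (B $$ (i, i)) ^ k)"
    using upper_triangular_pow[of B n] D(5) ut by (auto intro!: sum.cong)
  also have "\<dots> = (\<Sum>e\<leftarrow>es. e ^ k)"
    using D(5) unfolding diag[symmetric] diag_mat_def
    by (simp add: o_def interv_sum_list_conv_sum_set_nat lessThan_atLeast0)
  also have "\<dots> = (\<Sum>x\<in>#eigenvalue_mset A. x ^ k)"
    by (simp add: mset sum_mset_sum_list flip: mset_map)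
  finally show "(\<Sum>x\<in>#eigenvalue_mset A. x ^ k) = (\<Sum>i<n. (A ^\<^sub>m k) $$ (i, i))" ..
qed

lemma sum_mset_eq_sum_count:
  fixes f :: "'a \<Rightarrow> 'b :: comm_semiring_1"
  shows "(\<Sum>x\<in>#M. f x) = (\<Sum>x\<in>set_mset M. of_nat (count M x) * f x)"
proof -
  have "(\<Sum>x\<in>#M. f x) = (\<Sum>x\<in>F. of_nat (count M x) * f x)" if "finite F" "set_mset M \<subseteq> F" for F
    using that(2)
  proof (induction M)
    case (add y M)
    have "(\<Sum>x\<in>F. of_nat (count (add_mset y M) x) * f x)
        = (\<Sum>x\<in>F. (if x = y then f x else 0) + of_nat (count M x) * f x)"
      by (intro sum.cong) (auto simp: algebra_simps)
    thus ?case using add that(1) by (simp add: sum.distrib)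
  qed simp
  thus ?thesis by simp
qed

text \<open>
The spectral law is the distribution of a uniformly chosen element of the multiset of eigenvalues,
which reduces integrals to finite sums.
\<close>
lemma eigenvalue_distribution_symmetric:
  fixes A :: "real mat" and g :: "real \<Rightarrow> real"
  assumes A: "A \<in> carrier_mat n n" and "n > 0"
    and sym: "\<And>i j. i < n \<Longrightarrow> j < n \<Longrightarrow> A $$ (i, j) = A $$ (j, i)"
  shows real_distribution_eigenvalue_distribution: "real_distribution (eigenvalue_distribution A)"
    and integrable_eigenvalue_distribution:
      "g \<in> borel_measurable borel \<Longrightarrow> integrable (eigenvalue_distribution A) g"
    and integral_eigenvalue_distribution:
      "g \<in> borel_measurable borel \<Longrightarrow>
        (\<integral>x. g x \<partial>eigenvalue_distribution A) = (\<Sum>x\<in>#eigenvalue_mset A. g x) / n"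
proof -
  let ?E = "eigenvalue_mset A"
  have size: "size ?E = n" by (rule eigenvalue_mset_symmetric[OF A sym])
  hence ne: "?E \<noteq> {#}" using \<open>n > 0\<close> by auto
  define p where "p = pmf_of_multiset ?E"
  have pmf: "pmf p x = count ?E x / n" for x using ne by (simp add: p_def size)
  have supp: "set_pmf p = set_mset ?E" using ne by (simp add: p_def)
  have eq: "eigenvalue_distribution A = distr (measure_pmf p) borel (\<lambda>x. x)"
  proof (rule measure_eqI)
    fix S :: "real set" assume "S \<in> sets (eigenvalue_distribution A)"
    hence S: "S \<in> sets borel" by simp
    have "emeasure (eigenvalue_distribution A) S = (\<Sum>x\<in>#?E. indicator S x) / ennreal (real n)"
      using A S by (simp add: emeasure_eigenvalue_distribution ennreal_of_nat_eq_real_of_nat)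
    also have "(\<Sum>x\<in>#?E. indicator S x :: ennreal) = (\<Sum>x\<in>set_mset ?E. ennreal (count ?E x * (indicator S x :: real)))"
      by (subst sum_mset_eq_sum_count)
         (intro sum.cong refl, simp add: ennreal_of_nat_eq_real_of_nat split: split_indicator)
    also have "\<dots> = ennreal (\<Sum>x\<in>set_mset ?E. count ?E x * (indicator S x :: real))"
      by (rule sum_ennreal) auto
    also have "\<dots> / ennreal (real n)
        = ennreal ((\<Sum>x\<in>set_mset ?E. count ?E x * (indicator S x :: real)) / n)"
      using \<open>n > 0\<close> by (subst divide_ennreal) (auto intro!: sum_nonneg)
    also have "\<dots> = emeasure (measure_pmf p) S"
    proof -
      have "measure_pmf.prob p S = (\<integral>x. indicator S x \<partial>measure_pmf p)" by simp
      also have "\<dots> = (\<Sum>x\<in>set_mset ?E. indicator S x * pmf p x)"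
        by (rule integral_measure_pmf_real) (auto simp: supp)
      finally show ?thesis
        by (simp only: measure_pmf.emeasure_eq_measure pmf sum_divide_distrib
            times_divide_eq_right mult.commute[of "indicator S _"])
    qed
    finally show "emeasure (eigenvalue_distribution A) S = emeasure (distr (measure_pmf p) borel (\<lambda>x. x)) S"
      using S by (simp add: emeasure_distr)
  qed simp
  show "real_distribution (eigenvalue_distribution A)"
    unfolding eq by (intro prob_space.real_distribution_distr[OF measure_pmf.prob_space_axioms]) simp
  assume g: "g \<in> borel_measurable borel"
  show "integrable (eigenvalue_distribution A) g"
    unfolding eq using g by (auto simp: integrable_distr_eq supp intro!: integrable_measure_pmf_finite)
  have "(\<integral>x. g x \<partial>eigenvalue_distribution A) = (\<integral>x. g x \<partial>measure_pmf p)"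
    unfolding eq using g by (simp add: integral_distr)
  also have "\<dots> = (\<Sum>x\<in>set_mset ?E. g x * pmf p x)"
    by (rule integral_measure_pmf_real) (auto simp: supp)
  also have "\<dots> = (\<Sum>x\<in>#?E. g x) / n"
    by (simp add: sum_mset_eq_sum_count pmf sum_divide_distrib mult_ac)
  finally show "(\<integral>x. g x \<partial>eigenvalue_distribution A) = (\<Sum>x\<in>#?E. g x) / n" .
qed

section \<open>The method of moments and the limit law\<close>

text \<open>
The characteristic function differs from its Taylor polynomial of degree \<open>2 p\<close> by at most
\<open>2 t ^ (2 p) / (2 p)!\<close> times the moment of order \<open>2 p\<close>. For the limit this bound tends to
zero by the growth condition, and for fixed \<open>p\<close> the polynomials and the bounds converge with the
moments. So the characteristic functions converge pointwise, and Levy's theorem applies.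
\<close>
theorem moment_method:
  fixes \<mu> :: "nat \<Rightarrow> real measure" and \<nu> :: "real measure" and g :: "real \<Rightarrow> real"
  assumes \<mu>: "\<And>n. real_distribution (\<mu> n)" and \<nu>: "real_distribution \<nu>"
    and int_\<mu>: "\<And>n k. integrable (\<mu> n) (\<lambda>x. x ^ k)"
    and int_\<nu>: "\<And>k. integrable \<nu> (\<lambda>x. x ^ k)"
    and conv: "\<And>k. (\<lambda>n. \<integral>x. x ^ k \<partial>\<mu> n) \<longlonglongrightarrow> (\<integral>x. x ^ k \<partial>\<nu>)"
    and growth: "\<And>t. (\<lambda>p. t ^ (2 * p) / fact (2 * p) * (\<integral>x. x ^ (2 * p) \<partial>\<nu>)) \<longlonglongrightarrow> 0"
    and g: "continuous_on UNIV g" "bounded (range g)"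
  shows "(\<lambda>n. \<integral>x. g x \<partial>\<mu> n) \<longlonglongrightarrow> (\<integral>x. g x \<partial>\<nu>)"
proof -
  have "(\<lambda>n. char (\<mu> n) t) \<longlonglongrightarrow> char \<nu> t" for t
  proof (rule LIMSEQ_I)
    fix e :: real assume "e > 0"
    (* T is a Taylor polynomial of a characteristic function with moments f, and r p times the
       moment of order 2 p bounds the remainder; the degree is even so that the moment of its
       absolute value is the moment itself. *)
    define m where "m k = (\<integral>x. x ^ k \<partial>\<nu>)" for k
    define m' where "m' n k = (\<integral>x. x ^ k \<partial>\<mu> n)" for n k
    define T :: "nat \<Rightarrow> (nat \<Rightarrow> real) \<Rightarrow> complex"
      where "T K f = (\<Sum>k\<le>K. ((\<i> * t) ^ k / fact k) * f k)" for K f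
    define r where "r p = 2 * t ^ (2 * p) / fact (2 * p)" for p
    have "(\<lambda>p. 2 * (t ^ (2 * p) / fact (2 * p) * m (2 * p))) \<longlonglongrightarrow> 2 * 0"
      unfolding m_def by (intro tendsto_mult tendsto_const growth)
    hence "(\<lambda>p. r p * m (2 * p)) \<longlonglongrightarrow> 0" by (simp add: r_def mult_ac)
    hence "\<forall>\<^sub>F p in sequentially. r p * m (2 * p) < e / 4"
      using \<open>e > 0\<close> by (intro order_tendstoD) auto
    then obtain p where p: "r p * m (2 * p) < e / 4" by (auto simp: eventually_sequentially)
    have \<mu>_approx: "cmod (char (\<mu> n) t - T (2 * p) (m' n)) \<le> r p * m' n (2 * p)" for n
      using real_distribution.char_approx1[OF \<mu>[of n] int_\<mu>[of n], where n = "2 * p" and t = t]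
      by (simp add: T_def m'_def r_def power_even_abs)
    have \<nu>_approx: "cmod (char \<nu> t - T (2 * p) m) \<le> r p * m (2 * p)"
      using real_distribution.char_approx1[OF \<nu> int_\<nu>, where n = "2 * p" and t = t]
      by (simp add: T_def m_def r_def power_even_abs)
    have lim: "(\<lambda>n. m' n k) \<longlonglongrightarrow> m k" for k
      unfolding m'_def m_def by (rule conv)
    have "(\<lambda>n. r p * m' n (2 * p)) \<longlonglongrightarrow> r p * m (2 * p)"
      by (intro tendsto_intros lim)
    hence ev1: "\<forall>\<^sub>F n in sequentially. r p * m' n (2 * p) < e / 4"
      using p by (rule order_tendstoD)
    have "(\<lambda>n. T (2 * p) (m' n)) \<longlonglongrightarrow> T (2 * p) m"
      unfolding T_def by (intro tendsto_intros lim)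
    hence ev2: "\<forall>\<^sub>F n in sequentially. dist (T (2 * p) (m' n)) (T (2 * p) m) < e / 4"
      using \<open>e > 0\<close> by (intro tendstoD) auto
    have "\<forall>\<^sub>F n in sequentially. norm (char (\<mu> n) t - char \<nu> t) < e"
      using ev1 ev2
    proof eventually_elim
      case (elim n)
      have "char (\<mu> n) t - char \<nu> t = (char (\<mu> n) t - T (2 * p) (m' n))
          + (T (2 * p) (m' n) - T (2 * p) m) - (char \<nu> t - T (2 * p) m)" by simp
      also have "norm \<dots> \<le> cmod (char (\<mu> n) t - T (2 * p) (m' n))
          + cmod (T (2 * p) (m' n) - T (2 * p) m) + cmod (char \<nu> t - T (2 * p) m)"
        by (rule order.trans[OF norm_triangle_ineq4 add_right_mono[OF norm_triangle_ineq]])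
      also have "\<dots> < e"
        using elim p \<mu>_approx[of n] \<nu>_approx \<open>e > 0\<close> by (simp add: dist_norm)
      finally show ?case .
    qed
    thus "\<exists>no. \<forall>n\<ge>no. norm (char (\<mu> n) t - char \<nu> t) < e"
      by (simp add: eventually_sequentially)
  qed
  hence weak: "weak_conv_m \<mu> \<nu>"
    by (rule levy_continuity[OF \<mu> \<nu>])
  obtain B where B: "\<And>x. norm (g x) \<le> B"
    using g(2) by (auto simp: bounded_iff)
  show ?thesis
    by (rule weak_conv_imp_integral_bdd_continuous_conv[OF \<mu> \<nu> weak, of g B])
       (use g(1) B in \<open>auto simp: continuous_on_eq_continuous_at\<close>)
qed

definition limit_law :: "real measure" where
  "limit_law = density lborel (\<lambda>x. ennreal (\<bar>x\<bar> * exp (- (x ^ 2))))"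

text \<open>
By symmetry the integral is twice the one over the positive half line, which is an odd Gaussian
moment because of the factor \<open>\<bar>x\<bar>\<close> of the density.
\<close>
lemma limit_law_moment_even:
  "has_bochner_integral lborel (\<lambda>x. x ^ (2 * p) * (\<bar>x\<bar> * exp (- (x\<^sup>2)))) (fact p :: real)"
proof -
  have "has_bochner_integral lborel
      (\<lambda>x. indicator {0..} x *\<^sub>R (x ^ (2 * p) * (\<bar>x\<bar> * exp (- (x\<^sup>2))))) (fact p / 2 :: real)"
    by (rule has_bochner_integral_cong[THEN iffD1, OF refl _ refl gaussian_moment_odd_pos[of p]])
       (simp add: indicator_def)
  from has_bochner_integral_even_function[OF this] show ?thesis by simp
qed

lemma limit_law_moment_odd:
  assumes "odd k"
  shows "has_bochner_integral lborel (\<lambda>x. x ^ k * (\<bar>x\<bar> * exp (- (x\<^sup>2)))) (0 :: real)"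
proof -
  from assms obtain p where k: "k = 2 * p + 1" by (auto elim: oddE)
  have "has_bochner_integral lborel
      (\<lambda>x. indicator {0..} x *\<^sub>R (x ^ k * (\<bar>x\<bar> * exp (- (x\<^sup>2)))))
      ((sqrt pi / 2) * (fact (2 * (p + 1)) / (2 ^ (2 * (p + 1)) * fact (p + 1))))"
    by (rule has_bochner_integral_cong[THEN iffD1, OF refl _ refl gaussian_moment_even_pos[of "p + 1"]])
       (simp add: indicator_def k power_add power2_eq_square)
  from has_bochner_integral_odd_function[OF this] assms show ?thesis by simp
qed

definition limit_moment :: "nat \<Rightarrow> real" where
  "limit_moment k = (if even k then fact (k div 2) else 0)"

lemma limit_law_moment:
  "has_bochner_integral lborel (\<lambda>x. x ^ k * (\<bar>x\<bar> * exp (- (x\<^sup>2)))) (limit_moment k)"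
  using limit_law_moment_even[of "k div 2"] limit_law_moment_odd[of k]
  by (cases "even k") (auto simp: limit_moment_def)

lemma integral_limit_law:
  fixes g :: "real \<Rightarrow> real"
  assumes "g \<in> borel_measurable borel"
  shows "(\<integral>x. g x \<partial>limit_law) = (\<integral>x. g x * (\<bar>x\<bar> * exp (- (x ^ 2))) \<partial>lborel)"
  using assms unfolding limit_law_def by (subst integral_density) (auto simp: mult_ac)

lemma limit_law_moments:
  shows integrable_limit_law: "integrable limit_law (\<lambda>x. x ^ k)"
    and integral_limit_law_power: "(\<integral>x. x ^ k \<partial>limit_law) = limit_moment k"
proof -
  show "integrable limit_law (\<lambda>x. x ^ k)"
    using limit_law_moment[of k] unfolding limit_law_def
    by (subst integrable_density) (auto simp: has_bochner_integral_iff mult_ac)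
  show "(\<integral>x. x ^ k \<partial>limit_law) = limit_moment k"
    using limit_law_moment[of k] by (subst integral_limit_law) (auto simp: has_bochner_integral_iff)
qed

lemma real_distribution_limit_law: "real_distribution limit_law"
proof -
  have "(\<integral>\<^sup>+x. ennreal (\<bar>x\<bar> * exp (- (x ^ 2))) \<partial>lborel) = ennreal 1"
    using limit_law_moment[of 0]
    by (subst nn_integral_eq_integral) (auto simp: has_bochner_integral_iff limit_moment_def)
  hence "prob_space limit_law"
    by (intro prob_spaceI) (simp add: limit_law_def emeasure_density)
  thus ?thesis
    by (intro real_distribution.intro real_distribution_axioms.intro) (auto simp: limit_law_def)
qed

text \<open>
The coefficient \<open>p! / (2 p)!\<close> is at most \<open>1 / p!\<close>.
\<close>
lemma limit_moment_growth:
  "(\<lambda>p. t ^ (2 * p) / fact (2 * p) * limit_moment (2 * p)) \<longlonglongrightarrow> 0"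
proof (rule Lim_null_comparison)
  have "fact p * fact p \<le> (fact (2 * p) :: real)" for p
  proof -
    have "(fact p * fact p :: nat) dvd fact (p + p)" by (rule fact_fact_dvd_fact)
    hence "(fact p * fact p :: nat) \<le> fact (2 * p)" by (intro dvd_imp_le) (auto simp: mult_2)
    hence "real (fact p * fact p) \<le> real (fact (2 * p))" by (rule of_nat_mono)
    thus ?thesis by simp
  qed
  hence "(t\<^sup>2) ^ p * (fact p / fact (2 * p)) \<le> (t\<^sup>2) ^ p * inverse (fact p)" for p
    by (intro mult_left_mono) (auto simp: field_simps)
  moreover have "norm (t ^ (2 * p) / fact (2 * p) * limit_moment (2 * p))
      = (t\<^sup>2) ^ p * (fact p / fact (2 * p))" for p
    unfolding limit_moment_def power_mult[of t 2 p] by (simp add: abs_mult)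
  ultimately show "\<forall>\<^sub>F p in sequentially. norm (t ^ (2 * p) / fact (2 * p) * limit_moment (2 * p))
      \<le> inverse (fact p) * (t\<^sup>2) ^ p"
    by (intro always_eventually allI) (simp only: mult.commute[of "inverse _"])
  show "(\<lambda>p. inverse (fact p) * (t\<^sup>2) ^ p) \<longlonglongrightarrow> 0"
    by (rule summable_LIMSEQ_zero[OF summable_exp])
qed

section \<open>Moments of Hankel band matrices as sums over closed walks\<close>

definition alt_sum :: "(nat \<Rightarrow> int) \<Rightarrow> nat \<Rightarrow> int" where
  "alt_sum c l = (\<Sum>m<l. (-1) ^ m * c m)"

text \<open>
The vertex reached from \<open>i\<close> after \<open>l\<close> steps with the labels \<open>c\<close>, in closed form; the step itself is
the recursion \<open>vertex_Suc\<close>. The closed form shows how the last vertex depends on the start: with the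
same sign after an even, with the opposite sign after an odd number of steps.
\<close>
definition vertex :: "nat \<Rightarrow> nat \<Rightarrow> (nat \<Rightarrow> int) \<Rightarrow> nat \<Rightarrow> int" where
  "vertex N i c l = (if even l then int i + alt_sum c l else int N - 1 - int i - alt_sum c l)"

definition closed_starts :: "nat \<Rightarrow> nat \<Rightarrow> (nat \<Rightarrow> int) \<Rightarrow> nat set" where
  "closed_starts N k c =
     {i. i < N \<and> (\<forall>l\<le>k. vertex N i c l \<in> {0..<int N}) \<and> vertex N i c k = int i}"

definition labels :: "nat \<Rightarrow> nat \<Rightarrow> (nat \<Rightarrow> int) set" where
  "labels k b = {..<k} \<rightarrow>\<^sub>E {- int b..int b}"

text \<open>
The proportion of starts from which the labels \<open>c\<close> describe a closed walk that stays in \<open>{0..<N}\<close>.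
\<close>
definition walk_weight :: "nat \<Rightarrow> nat \<Rightarrow> (nat \<Rightarrow> int) \<Rightarrow> real" where
  "walk_weight N k c = card (closed_starts N k c) / N"

lemma finite_labels [simp]: "finite (labels k b)"
  by (simp add: labels_def finite_PiE)

lemma card_band: "card {- int b..int b} = 2 * b + 1"
  by (simp add: nat_add_distrib nat_mult_distrib)

lemma sum_labels_Suc:
  fixes f :: "(nat \<Rightarrow> int) \<Rightarrow> 'a :: comm_monoid_add"
  shows "(\<Sum>c\<in>labels (Suc k) b. f c) = (\<Sum>c\<in>labels k b. \<Sum>x\<in>{- int b..int b}. f (c(k := x)))"
proof -
  let ?V = "{- int b..int b}"
  have "labels (Suc k) b = (\<lambda>(x, c). c(k := x)) ` (?V \<times> labels k b)"
    unfolding labels_def lessThan_Suc by (rule PiE_insert_eq)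
  hence "(\<Sum>c\<in>labels (Suc k) b. f c) = (\<Sum>(x, c)\<in>?V \<times> labels k b. f (c(k := x)))"
    using inj_combinator[of k "{..<k}" "\<lambda>_. ?V"]
    by (simp add: labels_def sum.reindex case_prod_unfold)
  also have "\<dots> = (\<Sum>x\<in>?V. \<Sum>c\<in>labels k b. f (c(k := x)))"
    by (simp add: sum.cartesian_product)
  also have "\<dots> = (\<Sum>c\<in>labels k b. \<Sum>x\<in>?V. f (c(k := x)))"
    by (rule sum.swap)
  finally show ?thesis .
qed

lemma hankel_band_carrier [simp]: "hankel_band N b a \<in> carrier_mat N N"
  by (auto simp: hankel_band_def flip_mat_def toeplitz_band_def intro!: mult_carrier_mat[of _ N N])

lemma hankel_band_dim [simp]:
  "dim_row (hankel_band N b a) = N" "dim_col (hankel_band N b a) = N"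
  using hankel_band_carrier[of N b a] by (auto simp del: hankel_band_carrier)

lemma hankel_band_entry:
  assumes "i < N" "j < N"
  shows "hankel_band N b a $$ (i, j) =
    (if \<bar>int N - 1 - int i - int j\<bar> \<le> int b then a (int N - 1 - int i - int j) else 0)"
proof -
  let ?T = "toeplitz_band N b a"
  have "hankel_band N b a $$ (i, j) = (\<Sum>m<N. (if i = N - (m + 1) then 1 else 0) * ?T $$ (m, j))"
    using assms by (simp add: hankel_band_def flip_mat_def toeplitz_band_def scalar_prod_def
        lessThan_atLeast0)
  also have "\<dots> = (\<Sum>m\<in>{N - 1 - i}. (if i = N - (m + 1) then 1 else 0) * ?T $$ (m, j))"
    by (intro sum.mono_neutral_right) (use assms in auto)
  also have "\<dots> = ?T $$ (N - 1 - i, j)" using assms by auto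
  also have "\<dots> = (if \<bar>int (N - 1 - i) - int j\<bar> \<le> int b then a (int (N - 1 - i) - int j) else 0)"
    using assms by (simp add: toeplitz_band_def)
  also have "int (N - 1 - i) = int N - 1 - int i" using assms by simp
  finally show ?thesis .
qed

lemma hankel_band_symmetric:
  assumes "i < N" "j < N"
  shows "hankel_band N b a $$ (i, j) = hankel_band N b a $$ (j, i)"
  using assms by (simp add: hankel_band_entry algebra_simps)

lemma alt_sum_cong: "(\<And>m. m < l \<Longrightarrow> c m = d m) \<Longrightarrow> alt_sum c l = alt_sum d l"
  by (simp add: alt_sum_def)

lemma vertex_fun_upd: "l \<le> k \<Longrightarrow> vertex N i (c(k := x)) l = vertex N i c l"
  using alt_sum_cong[of l "c(k := x)" c] by (simp add: vertex_def)

lemma vertex_Suc: "vertex N i c (Suc l) = int N - 1 - vertex N i c l - c l"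
  by (auto simp: vertex_def alt_sum_def)

text \<open>
An entry of a power is a sum over walks. Once the start is fixed, walks correspond to label tuples,
and the band condition says exactly that the labels lie in \<open>{- b..b}\<close>.
\<close>
lemma hankel_band_pow_entry:
  assumes "i < N" "j < N"
  shows "(hankel_band N b a ^\<^sub>m k) $$ (i, j) = (\<Sum>c\<in>labels k b.
    if (\<forall>l\<le>k. vertex N i c l \<in> {0..<int N}) \<and> vertex N i c k = int j then \<Prod>l<k. a (c l) else 0)"
  using assms(2)
proof (induction k arbitrary: j)
  case 0
  then show ?case using assms(1) by (simp add: labels_def vertex_def alt_sum_def)
next
  case (Suc k)
  let ?H = "hankel_band N b a" and ?V = "{- int b..int b}"
  let ?in = "\<lambda>c k. \<forall>l\<le>k. vertex N i c l \<in> {0..<int N}"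
  have Hk: "?H ^\<^sub>m k \<in> carrier_mat N N" by simp
  have entry: "?H $$ (m, j) = (\<Sum>x\<in>?V. if int N - 1 - int m - x = int j then a x else 0)"
    if "m < N" for m
  proof -
    have "(\<Sum>x\<in>?V. if int N - 1 - int m - x = int j then a x else 0)
        = (\<Sum>x\<in>?V. if x = int N - 1 - int m - int j then a x else 0)"
      by (intro sum.cong) auto
    thus ?thesis using that Suc.prems by (auto simp: hankel_band_entry)
  qed
  have "(?H ^\<^sub>m Suc k) $$ (i, j) = (\<Sum>m<N. (?H ^\<^sub>m k) $$ (i, m) * ?H $$ (m, j))"
    using Hk assms(1) Suc.prems hankel_band_carrier[of N b a]
    by (simp add: scalar_prod_def lessThan_atLeast0 del: hankel_band_carrier)
  also have "\<dots> = (\<Sum>m<N. \<Sum>c\<in>labels k b.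
      (if ?in c k \<and> vertex N i c k = int m then \<Prod>l<k. a (c l) else 0) * ?H $$ (m, j))"
    by (intro sum.cong refl) (simp add: Suc.IH sum_distrib_right)
  also have "\<dots> = (\<Sum>c\<in>labels k b. \<Sum>m<N.
      (if ?in c k \<and> vertex N i c k = int m then \<Prod>l<k. a (c l) else 0) * ?H $$ (m, j))"
    by (rule sum.swap)
  also have "\<dots> = (\<Sum>c\<in>labels k b. \<Sum>x\<in>?V.
      if ?in (c(k := x)) (Suc k) \<and> vertex N i (c(k := x)) (Suc k) = int j
      then \<Prod>l<Suc k. a ((c(k := x)) l) else 0)"
  proof (intro sum.cong refl)
    fix c assume "c \<in> labels k b"
    let ?p = "\<Prod>l<k. a (c l)"
    have upd: "(?in (c(k := x)) (Suc k) \<and> vertex N i (c(k := x)) (Suc k) = int j)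
        \<longleftrightarrow> (?in c k \<and> int N - 1 - vertex N i c k - x = int j)" for x
      using Suc.prems by (auto simp: le_Suc_eq vertex_fun_upd vertex_Suc)
    show "(\<Sum>m<N. (if ?in c k \<and> vertex N i c k = int m then ?p else 0) * ?H $$ (m, j)) =
      (\<Sum>x\<in>?V. if ?in (c(k := x)) (Suc k) \<and> vertex N i (c(k := x)) (Suc k) = int j
         then \<Prod>l<Suc k. a ((c(k := x)) l) else 0)" (is "?L = ?R")
    proof (cases "?in c k")
      case False
      hence no: "?in c k \<longleftrightarrow> False" by blast
      show ?thesis unfolding upd no by simp
    next
      case True
      define m0 where "m0 = nat (vertex N i c k)"
      have m0: "m0 < N" "vertex N i c k = int m0" using True by (auto simp: m0_def)
      (* Only the vertex that the walk with labels c has reached contributes. *)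
      have "?L = (\<Sum>m\<in>{m0}. (if ?in c k \<and> vertex N i c k = int m then ?p else 0) * ?H $$ (m, j))"
        by (intro sum.mono_neutral_right) (use m0 in auto)
      also have "\<dots> = ?p * ?H $$ (m0, j)" using True m0 by simp
      also have "\<dots> = (\<Sum>x\<in>?V. if int N - 1 - vertex N i c k - x = int j then ?p * a x else 0)"
        unfolding entry[OF m0(1)] sum_distrib_left m0(2) by (intro sum.cong) auto
      also have "\<dots> = ?R"
        unfolding upd using True by (intro sum.cong) auto
      finally show ?thesis .
    qed
  qed
  also have "\<dots> = (\<Sum>c\<in>labels (Suc k) b.
      if ?in c (Suc k) \<and> vertex N i c (Suc k) = int j then \<Prod>l<Suc k. a (c l) else 0)"
    by (rule sum_labels_Suc[symmetric])
  finally show ?case .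
qed

lemma scaled_hankel_band_carrier [simp]: "scaled_hankel_band N b a \<in> carrier_mat N N"
  by (simp add: scaled_hankel_band_def)

lemma scaled_hankel_band_symmetric:
  assumes "i < N" "j < N"
  shows "scaled_hankel_band N b a $$ (i, j) = scaled_hankel_band N b a $$ (j, i)"
  using assms hankel_band_carrier[of N b a] hankel_band_symmetric[OF assms, of b a]
  by (simp add: scaled_hankel_band_def del: hankel_band_carrier)

lemma smult_mat_pow:
  fixes A :: "'a :: comm_semiring_1 mat"
  assumes A: "A \<in> carrier_mat n n"
  shows "(s \<cdot>\<^sub>m A) ^\<^sub>m k = s ^ k \<cdot>\<^sub>m (A ^\<^sub>m k)"
proof (induction k)
  case 0
  then show ?case using A by (intro eq_matI) auto
next
  case (Suc k)
  have Ak: "A ^\<^sub>m k \<in> carrier_mat n n" using A by simp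
  have "(s ^ k \<cdot>\<^sub>m (A ^\<^sub>m k)) * (s \<cdot>\<^sub>m A) = s ^ k \<cdot>\<^sub>m (A ^\<^sub>m k * (s \<cdot>\<^sub>m A))"
    using A Ak by (intro mult_smult_assoc_mat) auto
  also have "A ^\<^sub>m k * (s \<cdot>\<^sub>m A) = s \<cdot>\<^sub>m (A ^\<^sub>m k * A)"
    using A Ak by (intro mult_smult_distrib) auto
  finally show ?case using Suc Ak A by (auto intro!: eq_matI simp: mult_ac)
qed

theorem hankel_moment:
  assumes "N > 0"
  shows "(\<integral>x. x ^ k \<partial>eigenvalue_distribution (scaled_hankel_band N b a)) =
    (1 / sqrt (2 * real b)) ^ k * (\<Sum>c\<in>labels k b. walk_weight N k c * (\<Prod>l<k. a (c l)))"
proof -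
  let ?Y = "scaled_hankel_band N b a" and ?H = "hankel_band N b a"
  let ?s = "1 / sqrt (2 * real b)"
  let ?ok = "\<lambda>i c. (\<forall>l\<le>k. vertex N i c l \<in> {0..<int N}) \<and> vertex N i c k = int i"
  have Y: "?Y \<in> carrier_mat N N" and H: "?H \<in> carrier_mat N N" by auto
  note sym = scaled_hankel_band_symmetric[of _ N _ b a]
  have "(\<integral>x. x ^ k \<partial>eigenvalue_distribution ?Y) = (\<Sum>x\<in>#eigenvalue_mset ?Y. x ^ k) / N"
    by (rule integral_eigenvalue_distribution[OF Y \<open>N > 0\<close> sym]) auto
  also have "(\<Sum>x\<in>#eigenvalue_mset ?Y. x ^ k) = (\<Sum>i<N. (?Y ^\<^sub>m k) $$ (i, i))"
    by (rule sum_eigenvalue_power[OF Y sym])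
  also have "\<dots> = (\<Sum>i<N. ?s ^ k * (?H ^\<^sub>m k) $$ (i, i))"
  proof -
    have "?Y ^\<^sub>m k = ?s ^ k \<cdot>\<^sub>m (?H ^\<^sub>m k)"
      unfolding scaled_hankel_band_def by (rule smult_mat_pow[OF H])
    thus ?thesis using pow_carrier_mat[OF H, of k] by simp
  qed
  also have "\<dots> = ?s ^ k * (\<Sum>i<N. \<Sum>c\<in>labels k b. if ?ok i c then \<Prod>l<k. a (c l) else 0)"
    unfolding sum_distrib_left[symmetric] by (simp add: hankel_band_pow_entry)
  also have "(\<Sum>i<N. \<Sum>c\<in>labels k b. if ?ok i c then \<Prod>l<k. a (c l) else 0)
      = (\<Sum>c\<in>labels k b. \<Sum>i<N. if ?ok i c then \<Prod>l<k. a (c l) else 0)"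
    by (rule sum.swap)
  also have "\<dots> = (\<Sum>c\<in>labels k b. card (closed_starts N k c) * (\<Prod>l<k. a (c l)))"
  proof (intro sum.cong refl)
    fix c
    have "{..<N} \<inter> {i. ?ok i c} = closed_starts N k c" by (auto simp: closed_starts_def)
    thus "(\<Sum>i<N. if ?ok i c then \<Prod>l<k. a (c l) else 0)
        = card (closed_starts N k c) * (\<Prod>l<k. a (c l))"
      by (simp add: sum.If_cases)
  qed
  also have "?s ^ k * (\<Sum>c\<in>labels k b. card (closed_starts N k c) * (\<Prod>l<k. a (c l))) / N
      = ?s ^ k * (\<Sum>c\<in>labels k b. walk_weight N k c * (\<Prod>l<k. a (c l)))"
    unfolding times_divide_eq_right[symmetric] sum_divide_distrib
    by (simp add: walk_weight_def)
  finally show ?thesis .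
qed

lemma finite_closed_starts [simp]: "finite (closed_starts N k c)"
  by (rule finite_subset[of _ "{..<N}"]) (auto simp: closed_starts_def)

lemma walk_weight_nonneg: "walk_weight N k c \<ge> 0"
  by (simp add: walk_weight_def)

lemma walk_weight_le_1: "walk_weight N k c \<le> 1"
proof -
  have "card (closed_starts N k c) \<le> card {..<N}"
    by (intro card_mono) (auto simp: closed_starts_def)
  thus ?thesis by (simp add: walk_weight_def divide_le_eq)
qed

lemma alt_sum_eq_0_if_walk_weight:
  assumes "even k" "walk_weight N k c \<noteq> 0"
  shows "alt_sum c k = 0"
proof -
  have "closed_starts N k c \<noteq> {}" using assms by (auto simp: walk_weight_def)
  thus ?thesis using assms(1) by (auto simp: closed_starts_def vertex_def)
qed

text \<open>
After an odd number of steps the closing condition has the form \<open>2 i = const\<close>.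
\<close>
lemma walk_weight_odd:
  assumes "odd k"
  shows "walk_weight N k c \<le> 1 / N"
proof -
  have "card (closed_starts N k c) \<le> Suc 0"
    using assms by (intro card_le_Suc0_iff_eq[THEN iffD2]) (auto simp: closed_starts_def vertex_def)
  thus ?thesis by (simp add: walk_weight_def divide_right_mono)
qed

lemma abs_alt_sum_le:
  assumes "c \<in> labels k b" "l \<le> k"
  shows "\<bar>alt_sum c l\<bar> \<le> int k * int b"
proof -
  have "\<bar>alt_sum c l\<bar> \<le> (\<Sum>m<l. \<bar>(-1) ^ m * c m\<bar>)"
    unfolding alt_sum_def by (rule sum_abs)
  also have "\<dots> \<le> (\<Sum>m<l. int b)"
  proof (intro sum_mono)
    fix m assume "m \<in> {..<l}"
    hence "c m \<in> {- int b..int b}"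
      using assms PiE_mem[of c "{..<k}" "\<lambda>_. {- int b..int b}" m] by (simp add: labels_def)
    thus "\<bar>(-1) ^ m * c m\<bar> \<le> int b" by (simp add: abs_mult power_abs abs_le_iff)
  qed
  also have "\<dots> \<le> int k * int b" using assms(2) by (simp add: mult_right_mono)
  finally show ?thesis .
qed

text \<open>
All partial alternating sums are at most \<open>k b\<close>, so a walk that starts at distance at least \<open>k b\<close>
from both ends of \<open>{0..<N}\<close> never leaves this set.
\<close>
lemma walk_weight_ge:
  assumes "even k" "c \<in> labels k b" "alt_sum c k = 0" "N > 0"
  shows "walk_weight N k c \<ge> 1 - 2 * k * (real b / real N)"
proof -
  have "{k * b..<N - k * b} \<subseteq> closed_starts N k c"
  proof
    fix i assume i: "i \<in> {k * b..<N - k * b}"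
    hence "int k * int b \<le> int i" "int i < int N - int k * int b"
      by (auto simp: of_nat_mult[symmetric] simp del: of_nat_mult)
    moreover have "\<bar>alt_sum c l\<bar> \<le> int k * int b" if "l \<le> k" for l
      using abs_alt_sum_le[OF assms(2) that] .
    ultimately have "vertex N i c l \<in> {0..<int N}" if "l \<le> k" for l
      using that by (fastforce simp: vertex_def abs_le_iff)
    thus "i \<in> closed_starts N k c"
      using i assms(1,3) by (auto simp: closed_starts_def vertex_def)
  qed
  hence "N - k * b - k * b \<le> card (closed_starts N k c)"
    using card_mono[OF finite_closed_starts, of "{k * b..<N - k * b}"] by simp
  hence "N \<le> card (closed_starts N k c) + 2 * (k * b)" by linarith
  hence "real N \<le> real (card (closed_starts N k c) + 2 * (k * b))" by (rule of_nat_mono)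
  hence "(real N - 2 * (k * b)) / N \<le> card (closed_starts N k c) / N"
    by (intro divide_right_mono) auto
  thus ?thesis using \<open>N > 0\<close> by (simp add: walk_weight_def diff_divide_distrib)
qed

section \<open>Counting functions with repeated values under linear constraints\<close>

text \<open>
The pattern of coincidences between the values of a function.
\<close>
definition label_kernel :: "'p set \<Rightarrow> ('p \<Rightarrow> 'v) \<Rightarrow> ('p \<times> 'p) set" where
  "label_kernel P c = {(x, y). x \<in> P \<and> y \<in> P \<and> c x = c y}"

definition fibre :: "'p set \<Rightarrow> ('p \<Rightarrow> 'v) \<Rightarrow> 'v \<Rightarrow> 'p set" where
  "fibre P c v = {p \<in> P. c p = v}"

text \<open>
There are at most \<open>2 ^ (card P * card P)\<close> kernels, and a function with a given kernel is known from its
values on \<open>q\<close> points. For fixed \<open>P\<close> only the power of \<open>card V\<close> matters.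
\<close>
lemma card_le_if_determined:
  fixes A :: "('p \<Rightarrow> 'v) set"
  assumes P: "finite P" and V: "finite V" "V \<noteq> {}" and A: "A \<subseteq> P \<rightarrow>\<^sub>E V"
    and det: "\<And>c. c \<in> A \<Longrightarrow> \<exists>Q\<subseteq>P. card Q \<le> q \<and> (\<forall>c'\<in>A. \<forall>c''\<in>A.
       label_kernel P c' = label_kernel P c \<and> label_kernel P c'' = label_kernel P c \<and>
       (\<forall>p\<in>Q. c' p = c'' p) \<longrightarrow> c' = c'')"
  shows "card A \<le> 2 ^ (card P * card P) * card V ^ q"
proof -
  define F where "F K = {c \<in> A. label_kernel P c = K}" for K
  have finA: "finite A" using A P V(1) by (meson finite_PiE finite_subset)
  have "card (F K) \<le> card V ^ q" for K
  proof (cases "F K = {}")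
    case False
    then obtain c where c: "c \<in> A" "label_kernel P c = K" by (auto simp: F_def)
    from det[OF c(1)] obtain Q where Q: "Q \<subseteq> P" "card Q \<le> q"
      and inj: "\<And>c' c''. c' \<in> F K \<Longrightarrow> c'' \<in> F K \<Longrightarrow> (\<forall>p\<in>Q. c' p = c'' p) \<Longrightarrow> c' = c''"
      unfolding F_def c(2) by blast
    have "inj_on (\<lambda>c'. restrict c' Q) (F K)"
      by (rule inj_onI, rule inj) (auto simp: restrict_def fun_eq_iff split: if_splits)
    moreover have "(\<lambda>c'. restrict c' Q) ` F K \<subseteq> Q \<rightarrow>\<^sub>E V"
      using A Q(1) by (fastforce simp: F_def PiE_iff)
    moreover have "finite (Q \<rightarrow>\<^sub>E V)"
      using P Q(1) V(1) by (meson finite_PiE finite_subset)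
    ultimately have "card (F K) \<le> card (Q \<rightarrow>\<^sub>E V)" by (rule card_inj_on_le)
    also have "\<dots> = card V ^ card Q"
      using P Q(1) finite_subset by (intro card_funcsetE) blast
    also have "\<dots> \<le> card V ^ q"
      using V Q(2) by (intro power_increasing) (auto simp: Suc_le_eq card_gt_0_iff)
    finally show ?thesis .
  qed simp
  hence "card (\<Union>K\<in>Pow (P \<times> P). F K) \<le> card (Pow (P \<times> P)) * card V ^ q"
    using P by (intro order.trans[OF card_UN_le] order.trans[OF sum_bounded_above]) auto
  moreover have "A = (\<Union>K\<in>Pow (P \<times> P). F K)"
  proof -
    have "label_kernel P c \<in> Pow (P \<times> P)" for c :: "'p \<Rightarrow> 'v" by (auto simp: label_kernel_def)
    thus ?thesis by (auto simp: F_def)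
  qed
  ultimately show ?thesis using P by (simp add: card_Pow card_cartesian_product)
qed

text \<open>
Subtracting the two constraints leaves \<open>(\<Sum>p\<in>D. s p) * (v' - v'') = 0\<close>.
\<close>
lemma linear_constraint_determines:
  fixes s c' c'' :: "'p \<Rightarrow> int"
  assumes P: "finite P" "D \<subseteq> P"
    and const: "\<And>p. p \<in> D \<Longrightarrow> c' p = v'" "\<And>p. p \<in> D \<Longrightarrow> c'' p = v''"
    and agree: "\<And>p. p \<in> P - D \<Longrightarrow> s p = 0 \<or> c' p = c'' p"
    and eq: "(\<Sum>p\<in>P. s p * c' p) = (\<Sum>p\<in>P. s p * c'' p)"
    and coeff: "(\<Sum>p\<in>D. s p) \<noteq> 0"
  shows "v' = v''"
proof -
  have "0 = (\<Sum>p\<in>P. s p * c' p) - (\<Sum>p\<in>P. s p * c'' p)" using eq by simp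
  also have "\<dots> = (\<Sum>p\<in>P. s p * (c' p - c'' p))"
    by (simp add: sum_subtractf right_diff_distrib)
  also have "\<dots> = (\<Sum>p\<in>D. s p * (c' p - c'' p))"
    by (rule sum.mono_neutral_right) (use P agree in auto)
  also have "\<dots> = (\<Sum>p\<in>D. s p) * (v' - v'')"
    by (simp add: const sum_distrib_right)
  finally show ?thesis using coeff by simp
qed

text \<open>
A function with a given kernel is described by its distinct values, and each independent linear
condition on them saves one. The three cases are those of no, one and two savings. In the last one
the conditions are in triangular form: \<open>s'\<close> does not involve the value \<open>v\<close>, so it determines \<open>v'\<close>
from the remaining values, and then \<open>s\<close> determines \<open>v\<close>.
\<close>
lemma card_constrained_le:
  fixes A :: "('p \<Rightarrow> int) set"
  assumes P: "finite P" and V: "finite V" "V \<noteq> {}" and A: "A \<subseteq> P \<rightarrow>\<^sub>E V"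
    and lin: "\<And>c s. c \<in> A \<Longrightarrow> s \<in> F \<Longrightarrow> (\<Sum>p\<in>P. s p * c p) = 0"
    and cases: "\<And>c. c \<in> A \<Longrightarrow>
       card (c ` P) \<le> q \<or>
       card (c ` P) \<le> q + 1 \<and> (\<exists>s\<in>F. \<exists>v\<in>c ` P. sum s (fibre P c v) \<noteq> 0) \<or>
       card (c ` P) \<le> q + 2 \<and> (\<exists>s\<in>F. \<exists>s'\<in>F. \<exists>v\<in>c ` P. \<exists>v'\<in>c ` P. v \<noteq> v' \<and>
         sum s (fibre P c v) \<noteq> 0 \<and> sum s' (fibre P c v') \<noteq> 0 \<and> (\<forall>p\<in>fibre P c v. s' p = 0))"
  shows "card A \<le> 2 ^ (card P * card P) * card V ^ q"
proof (rule card_le_if_determined[OF P V A])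
  fix c assume c: "c \<in> A"
  have rep: "\<exists>Q\<subseteq>P. c ` Q = W \<and> card Q = card W" if "W \<subseteq> c ` P" for W
    using that by (metis card_image subset_image_inj)
  have agree: "c' p = c'' p"
    if h: "label_kernel P c' = label_kernel P c" "label_kernel P c'' = label_kernel P c"
      "Q \<subseteq> P" "\<forall>p\<in>Q. c' p = c'' p"
      "p \<in> P" "c p \<in> c ` Q" for c' c'' Q p
  proof -
    obtain r where r: "r \<in> Q" "c p = c r" using h(6) by auto
    hence "(p, r) \<in> label_kernel P c" using h(3,5) by (auto simp: label_kernel_def)
    hence "(p, r) \<in> label_kernel P c'" "(p, r) \<in> label_kernel P c''" using h(1,2) by simp_all
    thus ?thesis using r(1) h(4) by (auto simp: label_kernel_def)
  qed
  have fib: "c' p = c' r"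
    if "label_kernel P c' = label_kernel P c" "p \<in> fibre P c v" "r \<in> fibre P c v" for c' p r v
  proof -
    have "(p, r) \<in> label_kernel P c" using that(2,3) by (auto simp: label_kernel_def fibre_def)
    thus ?thesis unfolding that(1)[symmetric] by (simp add: label_kernel_def)
  qed
  have solve: "c' p = c'' p"
    if k: "label_kernel P c' = label_kernel P c" "label_kernel P c'' = label_kernel P c"
      and A': "c' \<in> A" "c'' \<in> A" and s: "s \<in> F" "sum s (fibre P c v) \<noteq> 0"
      and off: "\<And>r. r \<in> P \<Longrightarrow> c r \<noteq> v \<Longrightarrow> s r = 0 \<or> c' r = c'' r"
      and p: "p \<in> P" "c p = v" for c' c'' s v p
  proof (rule linear_constraint_determines[OF P, of "fibre P c v"])
    have pv: "p \<in> fibre P c v" using p by (simp add: fibre_def)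
    show "c' r = c' p" if "r \<in> fibre P c v" for r using fib[OF k(1) that pv] .
    show "c'' r = c'' p" if "r \<in> fibre P c v" for r using fib[OF k(2) that pv] .
    show "s r = 0 \<or> c' r = c'' r" if "r \<in> P - fibre P c v" for r
      using that off by (auto simp: fibre_def)
    show "(\<Sum>p\<in>P. s p * c' p) = (\<Sum>p\<in>P. s p * c'' p)"
      using lin[OF A'(1) s(1)] lin[OF A'(2) s(1)] by simp
  qed (use s in \<open>auto simp: fibre_def\<close>)
  have ext: "c' = c''" if "c' \<in> A" "c'' \<in> A" "\<And>p. p \<in> P \<Longrightarrow> c' p = c'' p" for c' c''
  proof (rule PiE_ext)
    show "c' \<in> P \<rightarrow>\<^sub>E V" "c'' \<in> P \<rightarrow>\<^sub>E V" using that(1,2) A by auto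
  qed (rule that(3))
  from cases[OF c]
  show "\<exists>Q\<subseteq>P. card Q \<le> q \<and> (\<forall>c'\<in>A. \<forall>c''\<in>A.
     label_kernel P c' = label_kernel P c \<and> label_kernel P c'' = label_kernel P c \<and> (\<forall>p\<in>Q. c' p = c'' p) \<longrightarrow> c' = c'')"
  proof (elim disjE conjE bexE)
    assume q: "card (c ` P) \<le> q"
    obtain Q where Q: "Q \<subseteq> P" "c ` Q = c ` P" "card Q = card (c ` P)"
      using rep[of "c ` P"] by blast
    show ?thesis
    proof (intro exI[of _ Q] conjI ballI impI; (elim conjE)?)
      fix c' c''
      assume *: "c' \<in> A" "c'' \<in> A" "label_kernel P c' = label_kernel P c" "label_kernel P c'' = label_kernel P c"
        "\<forall>p\<in>Q. c' p = c'' p"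
      show "c' = c''"
        by (rule ext[OF *(1,2)], rule agree[OF *(3,4) Q(1) *(5)], assumption) (simp only: Q(2) imageI)
    qed (use Q(1,3) q in simp_all)
  next
    fix s v
    assume q: "card (c ` P) \<le> q + 1" and s: "s \<in> F" "v \<in> c ` P" "sum s (fibre P c v) \<noteq> 0"
    obtain Q where Q: "Q \<subseteq> P" "c ` Q = c ` P - {v}" "card Q = card (c ` P - {v})"
      using rep[of "c ` P - {v}"] by blast
    show ?thesis
    proof (intro exI[of _ Q] conjI ballI impI; (elim conjE)?)
      fix c' c''
      assume *: "c' \<in> A" "c'' \<in> A" "label_kernel P c' = label_kernel P c" "label_kernel P c'' = label_kernel P c"
        "\<forall>p\<in>Q. c' p = c'' p"
      have off: "c' p = c'' p" if "p \<in> P" "c p \<noteq> v" for p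
        using agree[OF *(3,4) Q(1) *(5)] that by (auto simp: Q(2))
      show "c' = c''"
      proof (rule ext[OF *(1,2)])
        fix p assume p: "p \<in> P"
        show "c' p = c'' p"
        proof (cases "c p = v")
          case True
          show ?thesis by (rule solve[OF *(3,4,1,2) s(1,3) _ p True]) (simp add: off)
        qed (rule off[OF p])
      qed
    qed (use Q(1,3) q s(2) P in \<open>simp_all add: card_Diff_singleton\<close>)
  next
    fix s s' v v'
    assume q: "card (c ` P) \<le> q + 2" and s: "s \<in> F" "s' \<in> F" "v \<in> c ` P" "v' \<in> c ` P" "v \<noteq> v'"
      "sum s (fibre P c v) \<noteq> 0" "sum s' (fibre P c v') \<noteq> 0" "\<forall>p\<in>fibre P c v. s' p = 0"
    obtain Q where Q: "Q \<subseteq> P" "c ` Q = c ` P - {v, v'}" "card Q = card (c ` P - {v, v'})"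
      using rep[of "c ` P - {v, v'}"] by blast
    have "card (c ` P - {v, v'}) = card (c ` P) - 2"
      using s(3-5) P by (subst card_Diff_subset) auto
    show ?thesis
    proof (intro exI[of _ Q] conjI ballI impI; (elim conjE)?)
      fix c' c''
      assume *: "c' \<in> A" "c'' \<in> A" "label_kernel P c' = label_kernel P c" "label_kernel P c'' = label_kernel P c"
        "\<forall>p\<in>Q. c' p = c'' p"
      have off: "c' p = c'' p" if "p \<in> P" "c p \<noteq> v" "c p \<noteq> v'" for p
        using agree[OF *(3,4) Q(1) *(5)] that by (auto simp: Q(2))
      have off': "c' p = c'' p" if "p \<in> P" "c p \<noteq> v" for p
      proof (cases "c p = v'")
        case True
        show ?thesis
        proof (rule solve[OF *(3,4,1,2) s(2,7) _ that(1) True])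
          fix r assume "r \<in> P" "c r \<noteq> v'"
          thus "s' r = 0 \<or> c' r = c'' r" using off s(8) by (auto simp: fibre_def)
        qed
      qed (rule off[OF that])
      show "c' = c''"
      proof (rule ext[OF *(1,2)])
        fix p assume p: "p \<in> P"
        show "c' p = c'' p"
        proof (cases "c p = v")
          case True
          show ?thesis by (rule solve[OF *(3,4,1,2) s(1,6) _ p True]) (simp add: off')
        qed (rule off'[OF p])
      qed
    qed (use Q(1,3) q \<open>card (c ` P - {v, v'}) = card (c ` P) - 2\<close> in simp_all)
  qed
qed

lemma card_eq_sum_fibres:
  assumes "finite P"
  shows "card P = (\<Sum>v\<in>c ` P. card (fibre P c v))"
  using sum_fun_comp[OF assms, of "c ` P" c "\<lambda>_. 1 :: nat"] assms
  by (simp add: fibre_def)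

lemma finite_fibre [simp]: "finite P \<Longrightarrow> finite (fibre P c v)"
  by (simp add: fibre_def)

definition all_repeated :: "'p set \<Rightarrow> ('p \<Rightarrow> 'v) \<Rightarrow> bool" where
  "all_repeated P c \<longleftrightarrow> (\<forall>v\<in>c ` P. card (fibre P c v) \<ge> 2)"

text \<open>
The sizes of the fibres add up to the number of positions, so distinct values are at most half as
many as positions, and every fibre with more than two elements reduces their number further.
\<close>
lemma card_image_all_repeated:
  assumes P: "finite P" and "all_repeated P c"
  shows card_image_le_half: "2 * card (c ` P) \<le> card P"
    and excess: "W \<subseteq> c ` P \<Longrightarrow>
      2 * card (c ` P) + (\<Sum>v\<in>W. card (fibre P c v) - 2) \<le> card P"
proof -
  have ge: "card (fibre P c v) \<ge> 2" if "v \<in> c ` P" for v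
    using bspec[OF assms(2)[unfolded all_repeated_def] that] .
  have "card P = (\<Sum>v\<in>c ` P. 2 + (card (fibre P c v) - 2))"
    unfolding card_eq_sum_fibres[OF P, of c]
  proof (rule sum.cong[OF refl])
    fix v assume "v \<in> c ` P"
    from ge[OF this] show "card (fibre P c v) = 2 + (card (fibre P c v) - 2)" by linarith
  qed
  also have "\<dots> = 2 * card (c ` P) + (\<Sum>v\<in>c ` P. card (fibre P c v) - 2)"
    unfolding sum.distrib by simp
  finally have eq: "card P = 2 * card (c ` P) + (\<Sum>v\<in>c ` P. card (fibre P c v) - 2)" .
  show "2 * card (c ` P) \<le> card P" unfolding eq by simp
  show "2 * card (c ` P) + (\<Sum>v\<in>W. card (fibre P c v) - 2) \<le> card P" if "W \<subseteq> c ` P"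
    unfolding eq using that P by (intro add_left_mono sum_mono2) auto
qed

section \<open>Label tuples of a single closed walk\<close>

lemma sum_two:
  fixes f :: "'a \<Rightarrow> int"
  assumes "finite D" "card D = 2" "p \<in> D" "r \<in> D" "p \<noteq> r"
  shows "D = {p, r}" "sum f D = f p + f r"
proof -
  show D: "D = {p, r}" using assms by (intro card_seteq[symmetric]) auto
  show "sum f D = f p + f r" unfolding D using \<open>p \<noteq> r\<close> by simp
qed

text \<open>
Every value that is taken occurs exactly once at an even and once at an odd position below \<open>2 p\<close>.
\<close>
definition matched :: "nat \<Rightarrow> (nat \<Rightarrow> 'v) \<Rightarrow> bool" where
  "matched p c \<longleftrightarrow> inj_on (\<lambda>j. c (2 * j)) {..<p} \<and> inj_on (\<lambda>j. c (2 * j + 1)) {..<p} \<and>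
     (\<lambda>j. c (2 * j)) ` {..<p} = (\<lambda>j. c (2 * j + 1)) ` {..<p}"

text \<open>
If every label occurs twice and the alternating sum gives it total coefficient zero, then its two
occurrences have opposite signs.
\<close>
lemma matched_if_balanced_pairs:
  fixes c :: "nat \<Rightarrow> int"
  assumes two: "\<And>v. v \<in> c ` {..<2 * p} \<Longrightarrow> card (fibre {..<2 * p} c v) = 2"
    and bal: "\<And>v. v \<in> c ` {..<2 * p} \<Longrightarrow> (\<Sum>l\<in>fibre {..<2 * p} c v. (-1 :: int) ^ l) = 0"
  shows "matched p c"
proof -
  let ?P = "{..<2 * p}"
  have opp: "even l \<longleftrightarrow> odd m" if "l < 2 * p" "m < 2 * p" "c l = c m" "l \<noteq> m" for l m
  proof -
    let ?D = "fibre ?P c (c l)"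
    have "card ?D = 2" using two that(1) by simp
    from sum_two(2)[OF _ this, of l m "\<lambda>l. (-1) ^ l"]
    have "(\<Sum>l\<in>?D. (-1 :: int) ^ l) = (-1) ^ l + (-1) ^ m"
      using that by (simp add: fibre_def)
    with bal[of "c l"] that(1) have "(-1 :: int) ^ l + (-1) ^ m = 0" by simp
    thus ?thesis by (cases "even l"; cases "even m") auto
  qed
  have partner: "\<exists>m<2 * p. m \<noteq> l \<and> c m = c l" if l: "l < 2 * p" for l
  proof (rule ccontr)
    assume "\<not> ?thesis"
    hence "fibre ?P c (c l) = {l}" using l by (auto simp: fibre_def)
    thus False using two[of "c l"] l by simp
  qed
  have "inj_on (\<lambda>j. c (2 * j)) {..<p}"
    using opp[of "2 * i" "2 * j" for i j] by (auto intro!: inj_onI)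
  moreover have "inj_on (\<lambda>j. c (2 * j + 1)) {..<p}"
    using opp[of "2 * i + 1" "2 * j + 1" for i j] by (fastforce intro!: inj_onI)
  moreover have "c (2 * j) \<in> (\<lambda>j. c (2 * j + 1)) ` {..<p}" if j: "j < p" for j
  proof -
    obtain m where m: "m < 2 * p" "m \<noteq> 2 * j" "c m = c (2 * j)"
      using partner[of "2 * j"] j by auto
    with opp[of m "2 * j"] j have "odd m" by auto
    then obtain i where "m = 2 * i + 1" by (rule oddE)
    thus ?thesis using m by (intro image_eqI[of _ _ i]) auto
  qed
  moreover have "c (2 * j + 1) \<in> (\<lambda>j. c (2 * j)) ` {..<p}" if j: "j < p" for j
  proof -
    obtain m where m: "m < 2 * p" "m \<noteq> 2 * j + 1" "c m = c (2 * j + 1)"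
      using partner[of "2 * j + 1"] j by auto
    with opp[of m "2 * j + 1"] j have "even m" by auto
    then obtain i where "m = 2 * i" by (rule evenE)
    thus ?thesis using m by (intro image_eqI[of _ _ i]) auto
  qed
  ultimately show ?thesis unfolding matched_def by blast
qed

text \<open>
At most \<open>p\<close> distinct labels occur. If there are fewer, nothing is left to show. If there are exactly
\<open>p\<close>, each of them occurs twice, and since the tuple is not matched, the alternating sum is a
non-trivial condition on them, which saves one degree of freedom.
\<close>
lemma card_unmatched_le:
  "card {c \<in> labels (2 * p) b. alt_sum c (2 * p) = 0 \<and> all_repeated {..<2 * p} c \<and> \<not> matched p c}
    \<le> 2 ^ (2 * p * (2 * p)) * (2 * b + 1) ^ (p - 1)" (is "card ?A \<le> _")
proof -
  let ?P = "{..<2 * p}" and ?s = "\<lambda>l :: nat. (-1 :: int) ^ l"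
  have "card ?A \<le> 2 ^ (card ?P * card ?P) * card {- int b..int b} ^ (p - 1)"
  proof (rule card_constrained_le[where F = "{?s}"])
    fix c assume c: "c \<in> ?A"
    have "p > 0" using c by (cases p) (auto simp: matched_def)
    have half: "card (c ` ?P) \<le> p"
      using c card_image_le_half[of ?P c] by simp
    show "card (c ` ?P) \<le> p - 1 \<or>
       card (c ` ?P) \<le> p - 1 + 1 \<and> (\<exists>s\<in>{?s}. \<exists>v\<in>c ` ?P. sum s (fibre ?P c v) \<noteq> 0) \<or>
       card (c ` ?P) \<le> p - 1 + 2 \<and> (\<exists>s\<in>{?s}. \<exists>s'\<in>{?s}. \<exists>v\<in>c ` ?P. \<exists>v'\<in>c ` ?P. v \<noteq> v' \<and>
         sum s (fibre ?P c v) \<noteq> 0 \<and> sum s' (fibre ?P c v') \<noteq> 0 \<and> (\<forall>p\<in>fibre ?P c v. s' p = 0))"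
    proof (cases "card (c ` ?P) = p")
      case False
      thus ?thesis using half by auto
    next
      case True
      have two: "card (fibre ?P c v) = 2" if v: "v \<in> c ` ?P" for v
      proof -
        have "2 * card (c ` ?P) + (\<Sum>v\<in>{v}. card (fibre ?P c v) - 2) \<le> card ?P"
          using c v by (intro excess) auto
        moreover have "card (fibre ?P c v) \<ge> 2" using c v unfolding all_repeated_def by blast
        ultimately show ?thesis using True by simp
      qed
      have "\<exists>v\<in>c ` ?P. sum ?s (fibre ?P c v) \<noteq> 0"
        using matched_if_balanced_pairs[of c p] two c by blast
      thus ?thesis using half \<open>p > 0\<close> by auto
    qed
  qed (auto simp: labels_def alt_sum_def)
  thus ?thesis unfolding card_band by simp
qed

lemma card_fibre_matched:
  assumes m: "matched p c" and v: "v \<in> c ` {..<2 * p}"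
  shows "card (fibre {..<2 * p} c v) = 2"
proof -
  have "\<exists>i<p. v = c (2 * i)"
  proof -
    from v obtain l where l: "l < 2 * p" "v = c l" by auto
    show ?thesis
    proof (cases "even l")
      case True
      thus ?thesis using l by (auto elim!: evenE)
    next
      case False
      then obtain j where j: "l = 2 * j + 1" by (rule oddE)
      hence "v \<in> (\<lambda>j. c (2 * j + 1)) ` {..<p}" using l by auto
      thus ?thesis using m unfolding matched_def by auto
    qed
  qed
  then obtain i where i: "i < p" "v = c (2 * i)" by auto
  have "v \<in> (\<lambda>j. c (2 * j + 1)) ` {..<p}"
    using i m unfolding matched_def by blast
  then obtain j where j: "j < p" "v = c (2 * j + 1)" by auto
  have "l = 2 * i \<or> l = 2 * j + 1" if l: "l < 2 * p" "c l = v" for l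
  proof (cases "even l")
    case True
    then obtain i' where "l = 2 * i'" by (rule evenE)
    thus ?thesis using l i m unfolding matched_def by (auto dest: inj_onD)
  next
    case False
    then obtain j' where "l = 2 * j' + 1" by (rule oddE)
    thus ?thesis using l j m unfolding matched_def by (auto dest: inj_onD)
  qed
  hence "fibre {..<2 * p} c v = {2 * i, 2 * j + 1}"
    using i j by (auto simp: fibre_def)
  moreover have "2 * i \<noteq> 2 * j + 1" by presburger
  ultimately show ?thesis by simp
qed

lemma alt_sum_double: "alt_sum c (2 * p) = (\<Sum>j<p. c (2 * j)) - (\<Sum>j<p. c (2 * j + 1))"
  by (induction p) (auto simp: alt_sum_def)

lemma matched_alt_sum:
  assumes m: "matched p c"
  shows "alt_sum c (2 * p) = 0"
proof -
  have "(\<Sum>j<p. c (2 * j)) = (\<Sum>v\<in>(\<lambda>j. c (2 * j)) ` {..<p}. v)"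
    using m by (subst sum.reindex) (auto simp: matched_def)
  also have "\<dots> = (\<Sum>j<p. c (2 * j + 1))"
    using m unfolding matched_def by (simp add: sum.reindex)
  finally show ?thesis by (simp add: alt_sum_double)
qed

text \<open>
A matched tuple consists of an injective tuple \<open>f\<close> at the even positions and an injective tuple with
the same range at the odd positions; for the latter there are \<open>p!\<close> choices.
\<close>
lemma card_matched:
  "card {c \<in> labels (2 * p) b. matched p c} = fact p * (\<Prod>i<p. (2 * b + 1) - i)"
proof -
  let ?V = "{- int b..int b}"
  define I where "I W = {f \<in> {..<p} \<rightarrow>\<^sub>E W. inj_on f {..<p}}" for W :: "int set"
  define h where "h = (\<lambda>(f, g). \<lambda>l\<in>{..<2 * p}. if even l then f (l div 2) else g (l div 2) :: int)"
  have even: "h (f, g) (2 * j) = f j" and odd: "h (f, g) (2 * j + 1) = g j" if "j < p" for f g j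
    using that by (auto simp: h_def)
  have cardI: "card (I W) = (\<Prod>i<p. card W - i)" if "finite W" for W
    using card_inj_on_subset_funcset[of "{..<p}" W "{..<p}"] that
    by (simp add: I_def lessThan_atLeast0)
  have finI: "finite (I W)" if "finite W" for W
    unfolding I_def using that by (intro finite_subset[OF _ finite_PiE[of "{..<p}" "\<lambda>_. W"]]) auto
  have "bij_betw h (SIGMA f:I ?V. I (f ` {..<p})) {c \<in> labels (2 * p) b. matched p c}"
  proof (rule bij_betwI[where g = "\<lambda>c. (\<lambda>j\<in>{..<p}. c (2 * j), \<lambda>j\<in>{..<p}. c (2 * j + 1))"])
    show "h \<in> (SIGMA f:I ?V. I (f ` {..<p})) \<rightarrow> {c \<in> labels (2 * p) b. matched p c}"
    proof (rule funcsetI, clarsimp, intro conjI)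
      fix f g assume f: "f \<in> I ?V" and g: "g \<in> I (f ` {..<p})"
      have gV: "g j \<in> ?V" if "j < p" for j
        using g f that by (force simp: I_def PiE_iff)
      show "h (f, g) \<in> labels (2 * p) b"
        using f gV by (auto simp: h_def labels_def I_def PiE_iff)
      have "g ` {..<p} = f ` {..<p}"
        using f g by (intro card_subset_eq) (auto simp: I_def PiE_iff card_image)
      moreover have "(\<lambda>j. h (f, g) (2 * j)) ` {..<p} = f ` {..<p}"
        "(\<lambda>j. h (f, g) (2 * j + 1)) ` {..<p} = g ` {..<p}"
        using even odd by (auto simp del: One_nat_def add_Suc_right intro!: image_cong)
      moreover have "inj_on (\<lambda>j. h (f, g) (2 * j)) {..<p}"
        using f even by (subst inj_on_cong[of _ _ f]) (auto simp: I_def)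
      moreover have "inj_on (\<lambda>j. h (f, g) (2 * j + 1)) {..<p}"
        using g odd by (subst inj_on_cong[of _ _ g]) (auto simp: I_def)
      ultimately show "matched p (h (f, g))" by (simp add: matched_def)
    qed
    show "(\<lambda>c. (\<lambda>j\<in>{..<p}. c (2 * j), \<lambda>j\<in>{..<p}. c (2 * j + 1)))
        \<in> {c \<in> labels (2 * p) b. matched p c} \<rightarrow> (SIGMA f:I ?V. I (f ` {..<p}))"
    proof (rule funcsetI)
      fix c assume "c \<in> {c \<in> labels (2 * p) b. matched p c}"
      hence c: "c \<in> labels (2 * p) b" "matched p c" by auto
      have "(\<lambda>j\<in>{..<p}. c (2 * j)) \<in> I ?V"
        using c by (auto simp: I_def labels_def PiE_iff matched_def inj_on_def)
      moreover have "(\<lambda>j\<in>{..<p}. c (2 * j + 1)) \<in> I ((\<lambda>j\<in>{..<p}. c (2 * j)) ` {..<p})"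
        using c(2) by (auto simp: I_def matched_def inj_on_def image_restrict_eq)
      ultimately show "(\<lambda>j\<in>{..<p}. c (2 * j), \<lambda>j\<in>{..<p}. c (2 * j + 1))
          \<in> (SIGMA f:I ?V. I (f ` {..<p}))" by blast
    qed
    show "(\<lambda>j\<in>{..<p}. h x (2 * j), \<lambda>j\<in>{..<p}. h x (2 * j + 1)) = x"
      if "x \<in> (SIGMA f:I ?V. I (f ` {..<p}))" for x
    proof -
      obtain f g where x: "x = (f, g)" by (cases x)
      have "f \<in> extensional {..<p}" "g \<in> extensional {..<p}"
        using that by (auto simp: x I_def PiE_iff)
      thus ?thesis
        unfolding x using even[of _ f g] odd[of _ f g]
        by (auto simp: fun_eq_iff extensional_def restrict_def)
    qed
    show "h (\<lambda>j\<in>{..<p}. c (2 * j), \<lambda>j\<in>{..<p}. c (2 * j + 1)) = c"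
      if "c \<in> {c \<in> labels (2 * p) b. matched p c}" for c
    proof
      fix l
      show "h (\<lambda>j\<in>{..<p}. c (2 * j), \<lambda>j\<in>{..<p}. c (2 * j + 1)) l = c l"
        using that by (auto simp: h_def labels_def PiE_iff extensional_def elim!: evenE oddE)
    qed
  qed
  hence "card {c \<in> labels (2 * p) b. matched p c} = card (SIGMA f:I ?V. I (f ` {..<p}))"
    by (simp add: bij_betw_same_card)
  also have "\<dots> = (\<Sum>f\<in>I ?V. card (I (f ` {..<p})))"
    by (intro card_SigmaI ballI finI) auto
  also have "\<dots> = (\<Sum>f\<in>I ?V. fact p)"
  proof (intro sum.cong refl)
    fix f assume "f \<in> I ?V"
    hence "card (f ` {..<p}) = p" by (simp add: I_def card_image)
    hence "card (I (f ` {..<p})) = (\<Prod>i<p. p - i)" by (simp add: cardI)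
    also have "\<dots> = fact p" by (simp add: fact_prod_rev lessThan_atLeast0)
    finally show "card (I (f ` {..<p})) = fact p" .
  qed
  also have "\<dots> = fact p * (\<Prod>i<p. (2 * b + 1) - i)"
    by (simp only: cardI[OF finite_atLeastAtMost_int] card_band sum_constant) simp
  finally show ?thesis .
qed

section \<open>Label tuples of four closed walks\<close>

text \<open>
The coefficients of the alternating sum over the labels of the \<open>j\<close>-th of several walks, where
position \<open>(i, l)\<close> stands for step \<open>l\<close> of walk \<open>i\<close>.
\<close>
definition block_form :: "nat \<Rightarrow> nat \<times> nat \<Rightarrow> int" where
  "block_form j = (\<lambda>(i, l). if i = j then (-1) ^ l else 0)"

definition block_shared :: "nat \<Rightarrow> (nat \<times> nat \<Rightarrow> 'v) \<Rightarrow> nat \<Rightarrow> bool" where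
  "block_shared k c j \<longleftrightarrow> (\<exists>l<k. \<exists>i<4. \<exists>m<k. i \<noteq> j \<and> c (j, l) = c (i, m))"

text \<open>
The label patterns of four closed walks that can contribute to a fourth central moment.
\<close>
definition clustered :: "nat \<Rightarrow> nat \<Rightarrow> (nat \<times> nat \<Rightarrow> int) set" where
  "clustered k b = {c \<in> {..<4} \<times> {..<k} \<rightarrow>\<^sub>E {- int b..int b}.
     (\<forall>j<4. (\<Sum>l<k. (-1) ^ l * c (j, l)) = 0) \<and> all_repeated ({..<4} \<times> {..<k}) c \<and>
     (\<forall>j<4. block_shared k c j)}"

definition block_count :: "nat \<Rightarrow> (nat \<times> nat \<Rightarrow> 'v) \<Rightarrow> nat \<Rightarrow> 'v \<Rightarrow> nat" where
  "block_count k c j v = card {l. l < k \<and> c (j, l) = v}"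

lemma card_fibre_blocks:
  "card (fibre ({..<J} \<times> {..<k}) c v) = (\<Sum>j<J. block_count k c j v)"
proof -
  have "fibre ({..<J} \<times> {..<k}) c v = (SIGMA j:{..<J}. {l. l < k \<and> c (j, l) = v})"
    by (auto simp: fibre_def)
  thus ?thesis by (simp add: block_count_def)
qed

lemma sum_block_form:
  assumes "j < J"
  shows "sum (block_form j) (fibre ({..<J} \<times> {..<k}) c v) = (\<Sum>l | l < k \<and> c (j, l) = v. (-1) ^ l)"
proof -
  let ?B = "Pair j ` {l. l < k \<and> c (j, l) = v}"
  have "sum (block_form j) (fibre ({..<J} \<times> {..<k}) c v) = sum (block_form j) ?B"
    using assms by (intro sum.mono_neutral_right) (auto simp: fibre_def block_form_def)
  also have "\<dots> = (\<Sum>l | l < k \<and> c (j, l) = v. (-1) ^ l)"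
    by (subst sum.reindex) (auto simp: inj_on_def block_form_def)
  finally show ?thesis .
qed

lemma sum_block_form_all:
  assumes "j < J"
  shows "(\<Sum>p\<in>{..<J} \<times> {..<k}. block_form j p * c p) = (\<Sum>l<k. (-1) ^ l * c (j, l))"
proof -
  have "(\<Sum>p\<in>{..<J} \<times> {..<k}. block_form j p * c p) = (\<Sum>p\<in>Pair j ` {..<k}. block_form j p * c p)"
    using assms by (intro sum.mono_neutral_right) (auto simp: block_form_def)
  also have "\<dots> = (\<Sum>l<k. (-1) ^ l * c (j, l))"
    by (subst sum.reindex) (auto simp: inj_on_def block_form_def)
  finally show ?thesis .
qed

lemma even_card_if_sum_signs_zero:
  assumes "finite L" "(\<Sum>l\<in>L. (-1 :: int) ^ l) = 0"
  shows "even (card L)"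
proof -
  have "even (\<Sum>l\<in>L. (-1 :: int) ^ l) \<longleftrightarrow> even (card L)"
    using assms(1) by (induction L rule: finite_induct) auto
  thus ?thesis using assms(2) by simp
qed

text \<open>
If all total coefficients vanish, every label occurs an even number of times in each walk, so a
label that is shared by two walks occurs at least four times. Walk \<open>0\<close> shares a label with some walk \<open>i\<close>,
and a walk \<open>h\<close> other than \<open>0\<close> and \<open>i\<close> shares a label as well. Either these are two labels with at least
four occurrences each, or it is one label with at least six. In both cases the surplus over two
occurrences per label is at least four, which means two distinct labels less than the maximal
\<open>2 k\<close>.
\<close>
lemma clustered_excess_if_balanced:
  fixes c :: "nat \<times> nat \<Rightarrow> int"
  assumes c: "c \<in> clustered k b"
    and bal: "\<And>j v. j < 4 \<Longrightarrow> v \<in> c ` ({..<4} \<times> {..<k}) \<Longrightarrow>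
      sum (block_form j) (fibre ({..<4} \<times> {..<k}) c v) = 0"
  shows "card (c ` ({..<4} \<times> {..<k})) \<le> 2 * k - 2"
proof -
  let ?P = "{..<4::nat} \<times> {..<k}"
  have rep: "all_repeated ?P c" using c by (simp add: clustered_def)
  have two: "block_count k c j v \<ge> 2" if "j < 4" "l < k" "c (j, l) = v" for j l v
  proof -
    have "(\<Sum>l | l < k \<and> c (j, l) = v. (-1 :: int) ^ l) = 0"
      using bal[of j v] sum_block_form[of j 4 k c v] that by force
    hence "even (block_count k c j v)"
      unfolding block_count_def by (intro even_card_if_sum_signs_zero) auto
    moreover have "block_count k c j v \<noteq> 0"
      using that by (auto simp: block_count_def)
    ultimately show ?thesis by (cases "block_count k c j v = 1") auto
  qed
  have ge: "card (fibre ?P c v) \<ge> 2 * card J"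
    if J: "J \<subseteq> {..<4}" "\<And>j. j \<in> J \<Longrightarrow> \<exists>l<k. c (j, l) = v" for J v
  proof -
    have "2 * card J = (\<Sum>j\<in>J. 2)" by simp
    also have "\<dots> \<le> (\<Sum>j\<in>J. block_count k c j v)"
    proof (rule sum_mono)
      fix j assume j: "j \<in> J"
      then obtain l where "l < k" "c (j, l) = v" using J(2) by blast
      thus "2 \<le> block_count k c j v" using two[of j l v] j J(1) by auto
    qed
    also have "\<dots> \<le> (\<Sum>j<4. block_count k c j v)"
      using J(1) by (intro sum_mono2) auto
    finally show ?thesis by (simp add: card_fibre_blocks)
  qed
  have shared: "\<exists>l<k. \<exists>i<4. \<exists>m<k. i \<noteq> j \<and> c (j, l) = c (i, m)" if "j < 4" for j
    using c that by (auto simp: clustered_def block_shared_def)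
  obtain l i m where 0: "l < k" "i < 4" "m < k" "i \<noteq> 0" "c (0, l) = c (i, m)"
    using shared[of 0] by auto
  define v where "v = c (0, l)"
  obtain h where h: "h < 4" "h \<noteq> 0" "h \<noteq> i"
    by (cases "i = 1") (use that[of 1] that[of 2] in auto)
  obtain l' i' m' where 1: "l' < k" "i' < 4" "m' < k" "i' \<noteq> h" "c (h, l') = c (i', m')"
    using shared[of h] h by auto
  define w where "w = c (h, l')"
  have vw: "v \<in> c ` ?P" "w \<in> c ` ?P" using 0 1 h by (auto simp: v_def w_def)
  have "\<exists>W\<subseteq>c ` ?P. (\<Sum>v\<in>W. card (fibre ?P c v) - 2) \<ge> 4"
  proof (cases "w = v")
    case True
    have "card (fibre ?P c v) \<ge> 2 * card {0, i, h}"
    proof (rule ge)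
      show "\<exists>l<k. c (j, l) = v" if "j \<in> {0, i, h}" for j
        using that 0 1 True by (auto simp: v_def w_def)
    qed (use h 0 in auto)
    hence "card (fibre ?P c v) \<ge> 6" using 0 h by simp
    thus ?thesis using vw by (intro exI[of _ "{v}"]) auto
  next
    case False
    have "card (fibre ?P c v) \<ge> 2 * card {0, i}"
    proof (rule ge)
      show "\<exists>l<k. c (j, l) = v" if "j \<in> {0, i}" for j
        using that 0 by (auto simp: v_def)
    qed (use 0 in auto)
    moreover have "card (fibre ?P c w) \<ge> 2 * card {h, i'}"
    proof (rule ge)
      show "\<exists>l<k. c (j, l) = w" if "j \<in> {h, i'}" for j
        using that 1 by (auto simp: w_def)
    qed (use h 1 in auto)
    ultimately have "card (fibre ?P c v) \<ge> 4" "card (fibre ?P c w) \<ge> 4" using 0 1 by auto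
    thus ?thesis using vw False by (intro exI[of _ "{v, w}"]) auto
  qed
  then obtain W where W: "W \<subseteq> c ` ?P" "(\<Sum>v\<in>W. card (fibre ?P c v) - 2) \<ge> 4" by blast
  have "2 * card (c ` ?P) + (\<Sum>v\<in>W. card (fibre ?P c v) - 2) \<le> card ?P"
    using rep W(1) by (intro excess) auto
  thus ?thesis using W(2) by (simp add: card_cartesian_product)
qed

text \<open>
If every label occurs exactly twice, a label shared by two walks occurs once in each of them, hence
with coefficient \<open>1\<close> or \<open>- 1\<close>, and in no other walk. Walk \<open>0\<close> shares such a label with some walk \<open>i\<close>.
The constraint of a walk \<open>h\<close> other than \<open>0\<close> and \<open>i\<close> does not involve that label, but it has a
shared label of its own.
\<close>
lemma clustered_two_forms_if_pairs:
  fixes c :: "nat \<times> nat \<Rightarrow> int"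
  assumes c: "c \<in> clustered k b"
    and pairs: "\<And>v. v \<in> c ` ({..<4} \<times> {..<k}) \<Longrightarrow> card (fibre ({..<4} \<times> {..<k}) c v) = 2"
  defines "P \<equiv> {..<4::nat} \<times> {..<k}"
  shows "\<exists>s\<in>block_form ` {..<4}. \<exists>s'\<in>block_form ` {..<4}. \<exists>v\<in>c ` P. \<exists>v'\<in>c ` P. v \<noteq> v' \<and>
     sum s (fibre P c v) \<noteq> 0 \<and> sum s' (fibre P c v') \<noteq> 0 \<and> (\<forall>p\<in>fibre P c v. s' p = 0)"
proof -
  have shared: "\<exists>l<k. \<exists>i<4. \<exists>m<k. i \<noteq> j \<and> c (j, l) = c (i, m)" if "j < 4" for j
    using c that by (auto simp: clustered_def block_shared_def)
  have fib: "fibre P c (c (j, l)) = {(j, l), (i, m)}"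
    "sum (block_form j) (fibre P c (c (j, l))) = (-1) ^ l"
    if "j < 4" "l < k" "i < 4" "m < k" "i \<noteq> j" "c (j, l) = c (i, m)" for j l i m
  proof -
    have "card (fibre P c (c (j, l))) = 2" unfolding P_def using that by (intro pairs) auto
    from sum_two[OF _ this, of "(j, l)" "(i, m)"]
    show "fibre P c (c (j, l)) = {(j, l), (i, m)}"
      using that by (simp add: P_def fibre_def)
    from sum_two(2)[OF _ \<open>card _ = 2\<close>, of "(j, l)" "(i, m)" "block_form j"]
    show "sum (block_form j) (fibre P c (c (j, l))) = (-1) ^ l"
      using that by (simp add: P_def fibre_def block_form_def)
  qed
  obtain l i m where 0: "l < k" "i < 4" "m < k" "i \<noteq> 0" "c (0, l) = c (i, m)"
    using shared[of 0] by auto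
  obtain h where h: "h < 4" "h \<noteq> 0" "h \<noteq> i"
    by (cases "i = 1") (use that[of 1] that[of 2] in auto)
  obtain l' i' m' where 1: "l' < k" "i' < 4" "m' < k" "i' \<noteq> h" "c (h, l') = c (i', m')"
    using shared[of h] h by auto
  have fib0: "fibre P c (c (0, l)) = {(0, l), (i, m)}" using fib(1)[of 0 l i m] 0 by simp
  have "(h, l') \<notin> fibre P c (c (0, l))" unfolding fib0 using h by simp
  moreover have "(h, l') \<in> P" using h 1 by (simp add: P_def)
  ultimately have ne: "c (0, l) \<noteq> c (h, l')" by (simp add: fibre_def)
  have "sum (block_form 0) (fibre P c (c (0, l))) \<noteq> 0"
    using fib(2)[of 0 l i m] 0 by simp
  moreover have "sum (block_form h) (fibre P c (c (h, l'))) \<noteq> 0"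
    using fib(2)[of h l' i' m'] 1 h by simp
  moreover have "\<forall>p\<in>fibre P c (c (0, l)). block_form h p = 0"
    unfolding fib0 using h by (simp add: block_form_def)
  moreover have "c (0, l) \<in> c ` P" "c (h, l') \<in> c ` P"
    using 0 1 h by (auto simp: P_def)
  ultimately show ?thesis using ne h(1) by (meson imageI lessThan_iff zero_less_numeral)
qed

text \<open>
Two degrees of freedom are lost in any case: two by constraints if all labels occur exactly twice;
one by an additional repetition and one by a constraint if some label occurs more often and some
constraint is non-trivial; two by repetitions if all constraints are trivial.
\<close>
lemma card_clustered_le:
  "card (clustered k b) \<le> 2 ^ (4 * k * (4 * k)) * (2 * b + 1) ^ (2 * k - 2)"
proof -
  let ?P = "{..<4::nat} \<times> {..<k}" and ?F = "block_form ` {..<4}"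
  have "card (clustered k b) \<le> 2 ^ (card ?P * card ?P) * card {- int b..int b} ^ (2 * k - 2)"
  proof (rule card_constrained_le[where F = ?F])
    show "(\<Sum>p\<in>?P. s p * c p) = 0" if "c \<in> clustered k b" "s \<in> ?F" for c s
      using that by (auto simp: clustered_def sum_block_form_all)
  next
    fix c assume c: "c \<in> clustered k b"
    have rep: "all_repeated ?P c" using c by (simp add: clustered_def)
    have "block_shared k c 0" using c by (simp add: clustered_def)
    hence "k > 0" by (auto simp: block_shared_def)
    have half: "card (c ` ?P) \<le> 2 * k"
      using card_image_le_half[OF _ rep] by (simp add: card_cartesian_product)
    consider (pairs) "\<forall>v\<in>c ` ?P. card (fibre ?P c v) = 2"
      | (form) v where "v \<in> c ` ?P" "card (fibre ?P c v) \<noteq> 2"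
          "\<exists>s\<in>?F. \<exists>v\<in>c ` ?P. sum s (fibre ?P c v) \<noteq> 0"
      | (bal) "\<forall>s\<in>?F. \<forall>v\<in>c ` ?P. sum s (fibre ?P c v) = 0"
      by blast
    thus "card (c ` ?P) \<le> 2 * k - 2 \<or>
       card (c ` ?P) \<le> 2 * k - 2 + 1 \<and> (\<exists>s\<in>?F. \<exists>v\<in>c ` ?P. sum s (fibre ?P c v) \<noteq> 0) \<or>
       card (c ` ?P) \<le> 2 * k - 2 + 2 \<and> (\<exists>s\<in>?F. \<exists>s'\<in>?F. \<exists>v\<in>c ` ?P. \<exists>v'\<in>c ` ?P. v \<noteq> v' \<and>
         sum s (fibre ?P c v) \<noteq> 0 \<and> sum s' (fibre ?P c v') \<noteq> 0 \<and> (\<forall>p\<in>fibre ?P c v. s' p = 0))"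
    proof cases
      case pairs
      have "card (c ` ?P) \<le> 2 * k - 2 + 2" using half by linarith
      thus ?thesis
        by (intro disjI2 conjI clustered_two_forms_if_pairs[OF c] bspec[OF pairs])
    next
      case form
      have "2 * card (c ` ?P) + (\<Sum>v\<in>{v}. card (fibre ?P c v) - 2) \<le> card ?P"
        using rep form(1) by (intro excess) auto
      moreover have "card (fibre ?P c v) \<ge> 2"
        using bspec[OF rep[unfolded all_repeated_def] form(1)] .
      ultimately have "card (c ` ?P) \<le> 2 * k - 2 + 1"
        using form(2) by (simp add: card_cartesian_product)
      thus ?thesis using form(3) by (intro disjI2 disjI1 conjI)
    next
      case bal
      have "card (c ` ?P) \<le> 2 * k - 2"
        by (rule clustered_excess_if_balanced[OF c], rule bal[rule_format]) auto
      thus ?thesis by (rule disjI1)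
    qed
  qed (auto simp: clustered_def)
  thus ?thesis by (simp only: card_band card_cartesian_product card_lessThan)
qed

section \<open>Monomials in independent noise\<close>

text \<open>
The product is at most a power of the largest factor, unless that is below \<open>1\<close>. Taking expectations
bounds mixed moments by moments of single variables.
\<close>
lemma prod_le_1_plus_sum_power:
  fixes x :: "'p \<Rightarrow> real"
  assumes P: "finite P" and nonneg: "\<And>p. p \<in> P \<Longrightarrow> x p \<ge> 0"
  shows "(\<Prod>p\<in>P. x p) \<le> 1 + (\<Sum>p\<in>P. x p ^ card P)"
proof -
  define m where "m = Max (insert 1 (x ` P))"
  have m: "1 \<le> m" "\<And>p. p \<in> P \<Longrightarrow> x p \<le> m" using P by (auto simp: m_def)
  have "(\<Prod>p\<in>P. x p) \<le> (\<Prod>p\<in>P. m)"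
    using nonneg m by (intro prod_mono) auto
  also have "\<dots> = m ^ card P" by simp
  also have "\<dots> \<le> 1 + (\<Sum>p\<in>P. x p ^ card P)"
  proof -
    have "m \<in> insert 1 (x ` P)" unfolding m_def using P by (intro Max_in) auto
    thus ?thesis
    proof
      assume "m = 1"
      thus ?thesis using nonneg by (auto intro!: sum_nonneg)
    next
      assume "m \<in> x ` P"
      then obtain p where p: "p \<in> P" "m = x p" by auto
      have "x p ^ card P \<le> (\<Sum>p\<in>P. x p ^ card P)"
        using p P nonneg by (intro member_le_sum) auto
      thus ?thesis using p by simp
    qed
  qed
  finally show ?thesis .
qed

locale independent_noise = prob_space M for M :: "'w measure" +
  fixes a :: "int \<Rightarrow> 'w \<Rightarrow> real"
  assumes indep: "indep_vars (\<lambda>_. borel) a UNIV"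
    and mean: "\<And>j. expectation (a j) = 0"
    and variance: "\<And>j. expectation (\<lambda>\<omega>. \<bar>a j \<omega>\<bar> ^ 2) = 1"
    and moments: "\<And>k :: nat. (SUP j. \<integral>\<^sup>+ \<omega>. ennreal (\<bar>a j \<omega>\<bar> ^ k) \<partial>M) < \<infinity>"
begin

lemma measurable_noise [measurable]: "a j \<in> borel_measurable M"
  using indep by (auto simp: indep_vars_def)

definition abs_moment_bound :: "nat \<Rightarrow> real" where
  "abs_moment_bound k = enn2real (SUP j. \<integral>\<^sup>+ \<omega>. ennreal (\<bar>a j \<omega>\<bar> ^ k) \<partial>M)"

lemma integrable_abs_power: "integrable M (\<lambda>\<omega>. \<bar>a j \<omega>\<bar> ^ k)"
  and expectation_abs_power_le: "expectation (\<lambda>\<omega>. \<bar>a j \<omega>\<bar> ^ k) \<le> abs_moment_bound k"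
proof -
  have le: "(\<integral>\<^sup>+ \<omega>. ennreal (\<bar>a j \<omega>\<bar> ^ k) \<partial>M) \<le> (SUP j. \<integral>\<^sup>+ \<omega>. ennreal (\<bar>a j \<omega>\<bar> ^ k) \<partial>M)"
    by (rule SUP_upper) simp
  show "integrable M (\<lambda>\<omega>. \<bar>a j \<omega>\<bar> ^ k)"
    by (rule integrableI_nonneg) (use le moments[of k] in auto)
  have "expectation (\<lambda>\<omega>. \<bar>a j \<omega>\<bar> ^ k) = enn2real (\<integral>\<^sup>+ \<omega>. ennreal (\<bar>a j \<omega>\<bar> ^ k) \<partial>M)"
    by (rule integral_eq_nn_integral) auto
  also have "\<dots> \<le> abs_moment_bound k"
    unfolding abs_moment_bound_def using le moments[of k] by (intro enn2real_mono) auto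
  finally show "expectation (\<lambda>\<omega>. \<bar>a j \<omega>\<bar> ^ k) \<le> abs_moment_bound k" .
qed

lemma abs_moment_bound_nonneg: "abs_moment_bound k \<ge> 0"
  by (simp add: abs_moment_bound_def)

text \<open>
A bound for the expectations of all monomials of degree at most \<open>n\<close>. Summing over the degrees makes it
monotone in \<open>n\<close> and at least \<open>1\<close>.
\<close>
definition monomial_bound :: "nat \<Rightarrow> real" where
  "monomial_bound n = (\<Sum>m\<le>n. 1 + real m * abs_moment_bound m)"

lemma monomial_bound_ge_1: "monomial_bound n \<ge> 1"
proof -
  have "1 \<le> (\<Sum>m\<in>{0}. 1 + real m * abs_moment_bound m)" by simp
  also have "\<dots> \<le> monomial_bound n" unfolding monomial_bound_def
    by (intro sum_mono2) (auto intro!: add_nonneg_nonneg mult_nonneg_nonneg abs_moment_bound_nonneg)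
  finally show ?thesis .
qed

lemma monomial:
  fixes c :: "'p \<Rightarrow> int"
  assumes P: "finite P"
  shows integrable_monomial: "integrable M (\<lambda>\<omega>. \<Prod>p\<in>P. a (c p) \<omega>)"
    and abs_expectation_monomial_le: "card P \<le> n \<Longrightarrow>
      \<bar>expectation (\<lambda>\<omega>. \<Prod>p\<in>P. a (c p) \<omega>)\<bar> \<le> monomial_bound n"
proof -
  let ?B = "\<lambda>\<omega>. 1 + (\<Sum>p\<in>P. \<bar>a (c p) \<omega>\<bar> ^ card P)"
  have intB: "integrable M ?B" using integrable_abs_power by auto
  have le: "\<bar>\<Prod>p\<in>P. a (c p) \<omega>\<bar> \<le> ?B \<omega>" for \<omega>
    using prod_le_1_plus_sum_power[OF P, of "\<lambda>p. \<bar>a (c p) \<omega>\<bar>"] by (simp add: abs_prod)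
  show int: "integrable M (\<lambda>\<omega>. \<Prod>p\<in>P. a (c p) \<omega>)"
    by (rule Bochner_Integration.integrable_bound[OF intB])
       (auto intro!: AE_I2 order.trans[OF le])
  assume n: "card P \<le> n"
  have "\<bar>expectation (\<lambda>\<omega>. \<Prod>p\<in>P. a (c p) \<omega>)\<bar> \<le> expectation (\<lambda>\<omega>. \<bar>\<Prod>p\<in>P. a (c p) \<omega>\<bar>)"
    by (rule integral_abs_bound)
  also have "\<dots> \<le> expectation ?B"
    by (rule integral_mono[OF integrable_abs[OF int] intB le])
  also have "\<dots> = 1 + (\<Sum>p\<in>P. expectation (\<lambda>\<omega>. \<bar>a (c p) \<omega>\<bar> ^ card P))"
    using integrable_abs_power by (simp add: prob_space)
  also have "\<dots> \<le> 1 + (\<Sum>p\<in>P. abs_moment_bound (card P))"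
    by (intro add_left_mono sum_mono expectation_abs_power_le)
  also have "\<dots> = (\<Sum>m\<in>{card P}. 1 + real m * abs_moment_bound m)" by simp
  also have "\<dots> \<le> monomial_bound n"
    unfolding monomial_bound_def using n
    by (intro sum_mono2) (auto intro!: add_nonneg_nonneg mult_nonneg_nonneg abs_moment_bound_nonneg)
  finally show "\<bar>expectation (\<lambda>\<omega>. \<Prod>p\<in>P. a (c p) \<omega>)\<bar> \<le> monomial_bound n" .
qed

text \<open>
Equal labels are collected to powers, and powers of different variables are independent.
\<close>
lemma expectation_monomial:
  fixes c :: "'p \<Rightarrow> int"
  assumes P: "finite P"
  shows "expectation (\<lambda>\<omega>. \<Prod>p\<in>P. a (c p) \<omega>) =
    (\<Prod>v\<in>c ` P. expectation (\<lambda>\<omega>. a v \<omega> ^ card (fibre P c v)))"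
proof -
  have "(\<Prod>p\<in>P. a (c p) \<omega>) = (\<Prod>v\<in>c ` P. a v \<omega> ^ card (fibre P c v))" for \<omega>
    by (subst prod.image_gen[OF P, of _ c]) (auto simp: fibre_def intro!: prod.cong)
  hence "expectation (\<lambda>\<omega>. \<Prod>p\<in>P. a (c p) \<omega>)
      = expectation (\<lambda>\<omega>. \<Prod>v\<in>c ` P. a v \<omega> ^ card (fibre P c v))" by simp
  also have "\<dots> = (\<Prod>v\<in>c ` P. expectation (\<lambda>\<omega>. a v \<omega> ^ card (fibre P c v)))"
  proof (rule indep_vars_lebesgue_integral)
    show "indep_vars (\<lambda>_. borel) (\<lambda>v \<omega>. a v \<omega> ^ card (fibre P c v)) (c ` P)"
      by (rule indep_vars_compose2[OF indep_vars_subset[OF indep]]) auto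
    show "integrable M (\<lambda>\<omega>. a v \<omega> ^ card (fibre P c v))" for v
      using integrable_monomial[of "{..<card (fibre P c v)}" "\<lambda>_. v"] by simp
  qed (use P in auto)
  finally show ?thesis .
qed

lemma expectation_monomial_eq_0:
  assumes P: "finite P" and "\<not> all_repeated P c"
  shows "expectation (\<lambda>\<omega>. \<Prod>p\<in>P. a (c p) \<omega>) = 0"
proof -
  from assms(2) obtain p where p: "p \<in> P" "card (fibre P c (c p)) < 2"
    by (auto simp: all_repeated_def not_le)
  have "fibre P c (c p) \<noteq> {}" using p(1) by (auto simp: fibre_def)
  hence "card (fibre P c (c p)) = 1" using p(2) P by (simp add: card_gt_0_iff[symmetric] less_2_cases_iff)
  hence "expectation (\<lambda>\<omega>. a (c p) \<omega> ^ card (fibre P c (c p))) = 0"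
    using mean by simp
  thus ?thesis unfolding expectation_monomial[OF P] using P p(1) by (subst prod_zero_iff) auto
qed

lemma expectation_monomial_pairs:
  assumes P: "finite P" and two: "\<And>v. v \<in> c ` P \<Longrightarrow> card (fibre P c v) = 2"
  shows "expectation (\<lambda>\<omega>. \<Prod>p\<in>P. a (c p) \<omega>) = 1"
  unfolding expectation_monomial[OF P]
proof (intro prod.neutral ballI)
  fix v assume "v \<in> c ` P"
  from two[OF this] variance[of v]
  show "expectation (\<lambda>\<omega>. a v \<omega> ^ card (fibre P c v)) = 1" by simp
qed

lemma expectation_monomial_Un:
  assumes fin: "finite S" "finite B" and dis: "c ` S \<inter> c ` B = {}"
  shows "expectation (\<lambda>\<omega>. \<Prod>p\<in>S \<union> B. a (c p) \<omega>) =
    expectation (\<lambda>\<omega>. \<Prod>p\<in>S. a (c p) \<omega>) * expectation (\<lambda>\<omega>. \<Prod>p\<in>B. a (c p) \<omega>)"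
proof -
  have S: "fibre (S \<union> B) c v = fibre S c v" if "v \<in> c ` S" for v
    using dis that by (auto simp: fibre_def)
  have B: "fibre (S \<union> B) c v = fibre B c v" if "v \<in> c ` B" for v
    using dis that by (auto simp: fibre_def)
  have "expectation (\<lambda>\<omega>. \<Prod>p\<in>S \<union> B. a (c p) \<omega>) =
      (\<Prod>v\<in>c ` S \<union> c ` B. expectation (\<lambda>\<omega>. a v \<omega> ^ card (fibre (S \<union> B) c v)))"
    using fin by (simp add: expectation_monomial image_Un)
  also have "\<dots> = (\<Prod>v\<in>c ` S. expectation (\<lambda>\<omega>. a v \<omega> ^ card (fibre (S \<union> B) c v))) *
      (\<Prod>v\<in>c ` B. expectation (\<lambda>\<omega>. a v \<omega> ^ card (fibre (S \<union> B) c v)))"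
    using fin dis by (intro prod.union_disjoint) auto
  also have "\<dots> = (\<Prod>v\<in>c ` S. expectation (\<lambda>\<omega>. a v \<omega> ^ card (fibre S c v))) *
      (\<Prod>v\<in>c ` B. expectation (\<lambda>\<omega>. a v \<omega> ^ card (fibre B c v)))"
    using S B by (intro arg_cong2[where f = "(*)"] prod.cong refl) simp_all
  finally show ?thesis using fin by (simp add: expectation_monomial)
qed

text \<open>
The product of the monomials of the walks in \<open>S\<close>, where walk \<open>j\<close> has the labels \<open>c (j, l)\<close> for
\<open>l < k\<close>. Keeping the labels of all walks in one function \<open>c\<close> makes coincidences between different
walks visible to \<open>fibre\<close>.
\<close>
definition block_product :: "nat \<Rightarrow> (nat \<times> nat \<Rightarrow> int) \<Rightarrow> nat set \<Rightarrow> 'w \<Rightarrow> real" where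
  "block_product k c S \<omega> = (\<Prod>p\<in>S \<times> {..<k}. a (c p) \<omega>)"

definition joint_central_moment :: "nat \<Rightarrow> (nat \<times> nat \<Rightarrow> int) \<Rightarrow> real" where
  "joint_central_moment k c = expectation (\<lambda>\<omega>. \<Prod>j<4.
     block_product k c {j} \<omega> - expectation (block_product k c {j}))"

lemma integrable_block_product: "finite S \<Longrightarrow> integrable M (block_product k c S)"
  unfolding block_product_def by (rule integrable_monomial) auto

lemma block_product_Un:
  "finite S \<Longrightarrow> finite T \<Longrightarrow> S \<inter> T = {} \<Longrightarrow>
    block_product k c (S \<union> T) \<omega> = block_product k c S \<omega> * block_product k c T \<omega>"
  unfolding block_product_def Sigma_Un_distrib1 by (intro prod.union_disjoint) auto

lemma prod_block_product:
  assumes "finite S"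
  shows "(\<Prod>j\<in>S. block_product k c {j} \<omega>) = block_product k c S \<omega>"
  using assms
proof (induction S rule: finite_induct)
  case (insert j S)
  thus ?case using block_product_Un[of "{j}" S k c \<omega>] by simp
qed (simp add: block_product_def)

lemma prod_centred_blocks:
  assumes J: "finite J"
  shows "(\<Prod>j\<in>J. block_product k c {j} \<omega> - e j) =
    (\<Sum>S\<in>Pow J. block_product k c S \<omega> * (\<Prod>j\<in>J - S. - e j))"
proof -
  have "(\<Prod>j\<in>J. block_product k c {j} \<omega> - e j) = (\<Prod>j\<in>J. block_product k c {j} \<omega> + (- e j))"
    by simp
  also have "\<dots> = (\<Sum>S\<in>Pow J. (\<Prod>j\<in>S. block_product k c {j} \<omega>) * (\<Prod>j\<in>J - S. - e j))"
    by (rule prod_add[OF J])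
  also have "\<dots> = (\<Sum>S\<in>Pow J. block_product k c S \<omega> * (\<Prod>j\<in>J - S. - e j))"
    using J by (intro sum.cong refl) (simp add: prod_block_product finite_subset[OF _ J])
  finally show ?thesis .
qed

text \<open>
The product of the four centred factors expands into \<open>16\<close> terms, each of which is a product of at most
five expectations of monomials of degree at most \<open>4 k\<close>.
\<close>
lemma abs_joint_central_moment_le:
  "\<bar>joint_central_moment k c\<bar> \<le> 16 * monomial_bound (4 * k) ^ 5"
proof -
  let ?K = "monomial_bound (4 * k)"
  let ?e = "\<lambda>j. expectation (block_product k c {j})"
  have E: "\<bar>expectation (block_product k c S)\<bar> \<le> ?K" if "S \<subseteq> {..<4}" for S
  proof -
    have "finite S" using that finite_subset by blast
    moreover have "card S \<le> 4" using card_mono[OF _ that] by simp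
    ultimately show ?thesis
      unfolding block_product_def
      by (intro abs_expectation_monomial_le) (auto simp: card_cartesian_product)
  qed
  have "joint_central_moment k c = expectation (\<lambda>\<omega>. \<Sum>S\<in>Pow {..<4}.
      block_product k c S \<omega> * (\<Prod>j\<in>{..<4} - S. - ?e j))"
    unfolding joint_central_moment_def by (subst prod_centred_blocks) auto
  also have "\<dots> = (\<Sum>S\<in>Pow {..<4}. expectation (block_product k c S) * (\<Prod>j\<in>{..<4} - S. - ?e j))"
    by (subst Bochner_Integration.integral_sum)
       (auto intro!: integrable_mult_left integrable_block_product intro: finite_subset)
  also have "\<bar>\<dots>\<bar> \<le> (\<Sum>S\<in>Pow {..<4::nat}. ?K ^ 5)"
  proof (rule order.trans[OF sum_abs sum_mono])
    fix S :: "nat set" assume S: "S \<in> Pow {..<4}"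
    have "\<bar>\<Prod>j\<in>{..<4} - S. - ?e j\<bar> = (\<Prod>j\<in>{..<4} - S. \<bar>?e j\<bar>)" by (simp add: abs_prod)
    also have "\<dots> \<le> ?K ^ 4"
    proof (rule prod_le_power)
      show "card ({..<4} - S) \<le> 4" using card_mono[of "{..<4::nat}" "{..<4} - S"] by auto
    qed (use E monomial_bound_ge_1 in auto)
    finally have "\<bar>expectation (block_product k c S)\<bar> * \<bar>\<Prod>j\<in>{..<4} - S. - ?e j\<bar> \<le> ?K * ?K ^ 4"
      using E S monomial_bound_ge_1[of "4 * k"] by (intro mult_mono) auto
    thus "\<bar>expectation (block_product k c S) * (\<Prod>j\<in>{..<4} - S. - ?e j)\<bar> \<le> ?K ^ 5"
      by (simp add: abs_mult flip: power_Suc)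
  qed
  finally show ?thesis by (simp add: card_Pow)
qed

text \<open>
If walk \<open>i\<close> is uncorrelated with all products of the other walks, then its centred factor is
orthogonal to the product of the other centred factors, which is a combination of such products.
\<close>
lemma joint_central_moment_eq_0_if_uncorrelated:
  assumes i: "i < 4" and uncorrelated: "\<And>S. S \<subseteq> {..<4} - {i} \<Longrightarrow>
    expectation (block_product k c (insert i S)) =
    expectation (block_product k c {i}) * expectation (block_product k c S)"
  shows "joint_central_moment k c = 0"
proof -
  let ?e = "\<lambda>j. expectation (block_product k c {j})" and ?J = "{..<4} - {i}"
  have ins: "block_product k c {i} \<omega> * block_product k c S \<omega> = block_product k c (insert i S) \<omega>"
    if "S \<subseteq> ?J" for S \<omega>
    using block_product_Un[of "{i}" S k c \<omega>] that finite_subset[OF that] by fastforce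
  have fin: "finite S" if "S \<subseteq> ?J" for S using finite_subset[OF that] by blast
  have "joint_central_moment k c = expectation (\<lambda>\<omega>. (block_product k c {i} \<omega> - ?e i) *
      (\<Prod>j\<in>?J. block_product k c {j} \<omega> - ?e j))"
    unfolding joint_central_moment_def using i by (subst prod.remove[of _ i]) auto
  also have "\<dots> = expectation (\<lambda>\<omega>. \<Sum>S\<in>Pow ?J.
      (block_product k c (insert i S) \<omega> - ?e i * block_product k c S \<omega>) * (\<Prod>j\<in>?J - S. - ?e j))"
  proof (rule Bochner_Integration.integral_cong[OF refl])
    fix \<omega>
    have "finite ?J" by simp
    show "(block_product k c {i} \<omega> - ?e i) * (\<Prod>j\<in>?J. block_product k c {j} \<omega> - ?e j) =
        (\<Sum>S\<in>Pow ?J. (block_product k c (insert i S) \<omega> - ?e i * block_product k c S \<omega>)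
          * (\<Prod>j\<in>?J - S. - ?e j))"
      unfolding prod_centred_blocks[OF \<open>finite ?J\<close>] sum_distrib_left
    proof (rule sum.cong[OF refl])
      fix S assume "S \<in> Pow ?J"
      hence "block_product k c (insert i S) \<omega> = block_product k c {i} \<omega> * block_product k c S \<omega>"
        using ins[of S \<omega>] by simp
      thus "(block_product k c {i} \<omega> - ?e i) * (block_product k c S \<omega> * (\<Prod>j\<in>?J - S. - ?e j)) =
          (block_product k c (insert i S) \<omega> - ?e i * block_product k c S \<omega>) * (\<Prod>j\<in>?J - S. - ?e j)"
        by (simp only: left_diff_distrib mult.assoc)
    qed
  qed
  also have "\<dots> = (\<Sum>S\<in>Pow ?J. (expectation (block_product k c (insert i S))
      - ?e i * expectation (block_product k c S)) * (\<Prod>j\<in>?J - S. - ?e j))"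
  proof -
    have int: "integrable M (\<lambda>\<omega>. block_product k c (insert i S) \<omega> - ?e i * block_product k c S \<omega>)"
      "integrable M (block_product k c (insert i S))"
      "integrable M (\<lambda>\<omega>. ?e i * block_product k c S \<omega>)" if "S \<in> Pow ?J" for S
      using fin[of S] that
      by (auto intro!: Bochner_Integration.integrable_diff integrable_mult_right
          integrable_block_product)
    have "expectation (\<lambda>\<omega>. \<Sum>S\<in>Pow ?J.
        (block_product k c (insert i S) \<omega> - ?e i * block_product k c S \<omega>) * (\<Prod>j\<in>?J - S. - ?e j))
      = (\<Sum>S\<in>Pow ?J. expectation (\<lambda>\<omega>.
        (block_product k c (insert i S) \<omega> - ?e i * block_product k c S \<omega>) * (\<Prod>j\<in>?J - S. - ?e j)))"
      by (rule Bochner_Integration.integral_sum, rule integrable_mult_left, rule int(1))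
    also have "\<dots> = (\<Sum>S\<in>Pow ?J. (expectation (block_product k c (insert i S))
      - ?e i * expectation (block_product k c S)) * (\<Prod>j\<in>?J - S. - ?e j))"
    proof (rule sum.cong[OF refl])
      fix S assume S: "S \<in> Pow ?J"
      have "expectation (\<lambda>\<omega>. block_product k c (insert i S) \<omega> - ?e i * block_product k c S \<omega>)
          = expectation (block_product k c (insert i S)) - ?e i * expectation (block_product k c S)"
        using int(2,3)[OF S] by simp
      thus "expectation (\<lambda>\<omega>. (block_product k c (insert i S) \<omega> - ?e i * block_product k c S \<omega>)
            * (\<Prod>j\<in>?J - S. - ?e j))
          = (expectation (block_product k c (insert i S)) - ?e i * expectation (block_product k c S))
            * (\<Prod>j\<in>?J - S. - ?e j)"
        by simp
    qed
    finally show ?thesis .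
  qed
  also have "\<dots> = 0"
  proof (rule sum.neutral, rule ballI)
    fix S assume "S \<in> Pow ?J"
    hence "S \<subseteq> ?J" by simp
    from uncorrelated[OF this]
    show "(expectation (block_product k c (insert i S)) - ?e i * expectation (block_product k c S))
        * (\<Prod>j\<in>?J - S. - ?e j) = 0" by simp
  qed
  finally show ?thesis .
qed

text \<open>
If a label occurs only once, say in walk \<open>i\<close>, the monomials of walk \<open>i\<close> alone and together with
any other walks have expectation zero. If walk \<open>i\<close> shares no label with the other walks, its monomial is
independent of theirs. In both cases it is uncorrelated with their products.
\<close>
lemma joint_central_moment_eq_0:
  assumes "\<not> (all_repeated ({..<4} \<times> {..<k}) c \<and> (\<forall>j<4. block_shared k c j))"
  shows "joint_central_moment k c = 0"
proof (cases "all_repeated ({..<4} \<times> {..<k}) c")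
  case False
  then obtain i l where il: "i < 4" "l < k" "card (fibre ({..<4} \<times> {..<k}) c (c (i, l))) < 2"
    by (auto simp: all_repeated_def not_le)
  have "expectation (block_product k c S) = 0" if S: "S \<subseteq> {..<4}" "i \<in> S" for S
  proof -
    have "finite S" using finite_subset[OF S(1)] by blast
    moreover have "card (fibre (S \<times> {..<k}) c (c (i, l))) \<le> card (fibre ({..<4} \<times> {..<k}) c (c (i, l)))"
      using S(1) by (intro card_mono) (auto simp: fibre_def)
    hence "\<not> all_repeated (S \<times> {..<k}) c"
      using il S(2) by (force simp: all_repeated_def not_le)
    ultimately show ?thesis
      unfolding block_product_def by (intro expectation_monomial_eq_0) auto
  qed
  note zero = this
  show ?thesis
  proof (rule joint_central_moment_eq_0_if_uncorrelated[OF il(1)])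
    fix S :: "nat set" assume "S \<subseteq> {..<4} - {i}"
    hence "insert i S \<subseteq> {..<4}" using il(1) by auto
    thus "expectation (block_product k c (insert i S)) =
        expectation (block_product k c {i}) * expectation (block_product k c S)"
      using zero[of "insert i S"] zero[of "{i}"] il(1) by simp
  qed
next
  case True
  then obtain i where i: "i < 4" "\<not> block_shared k c i" using assms by auto
  show ?thesis
  proof (rule joint_central_moment_eq_0_if_uncorrelated[OF i(1)])
    fix S :: "nat set" assume S: "S \<subseteq> {..<4} - {i}"
    have "c ` ({i} \<times> {..<k}) \<inter> c ` (S \<times> {..<k}) = {}"
      using i(2) S by (fastforce simp: block_shared_def)
    moreover have "finite S" using finite_subset[OF S] by blast
    ultimately have "expectation (\<lambda>\<omega>. \<Prod>p\<in>{i} \<times> {..<k} \<union> S \<times> {..<k}. a (c p) \<omega>) =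
        expectation (block_product k c {i}) * expectation (block_product k c S)"
      unfolding block_product_def by (intro expectation_monomial_Un) auto
    moreover have "{i} \<times> {..<k} \<union> S \<times> {..<k} = insert i S \<times> {..<k}" by auto
    ultimately show "expectation (block_product k c (insert i S)) =
        expectation (block_product k c {i}) * expectation (block_product k c S)"
      unfolding block_product_def by simp
  qed
qed

end

section \<open>Fourth moments of the empirical moments\<close>

lemma fourth_power_sum:
  fixes f :: "'c \<Rightarrow> real"
  assumes "finite L"
  shows "(\<Sum>c\<in>L. f c) ^ 4 = (\<Sum>C\<in>{..<4::nat} \<rightarrow>\<^sub>E L. \<Prod>j<4. f (C j))"
proof -
  have "(\<Sum>c\<in>L. f c) ^ 4 = (\<Prod>j<4::nat. \<Sum>c\<in>L. f c)" by simp
  also have "\<dots> = (\<Sum>C\<in>{..<4::nat} \<rightarrow>\<^sub>E L. \<Prod>j<4. f (C j))"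
    by (rule prod_sum_PiE) (use assms in auto)
  finally show ?thesis .
qed

text \<open>
Four label tuples as one function on the positions of four walks.
\<close>
definition glue :: "nat \<Rightarrow> (nat \<Rightarrow> nat \<Rightarrow> int) \<Rightarrow> nat \<times> nat \<Rightarrow> int" where
  "glue k C = (\<lambda>(j, l)\<in>{..<4} \<times> {..<k}. C j l)"

lemma glue_in: "C \<in> {..<4} \<rightarrow>\<^sub>E labels k b \<Longrightarrow> glue k C \<in> {..<4} \<times> {..<k} \<rightarrow>\<^sub>E {- int b..int b}"
  by (auto simp: glue_def labels_def PiE_iff)

lemma inj_on_glue: "inj_on (glue k) ({..<4} \<rightarrow>\<^sub>E labels k b)"
proof (rule inj_onI)
  fix C D assume C: "C \<in> {..<4} \<rightarrow>\<^sub>E labels k b" and D: "D \<in> {..<4} \<rightarrow>\<^sub>E labels k b"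
    and eq: "glue k C = glue k D"
  show "C = D"
  proof (rule PiE_ext[OF C D])
    fix j :: nat assume j: "j \<in> {..<4}"
    have "C j \<in> {..<k} \<rightarrow>\<^sub>E {- int b..int b}" "D j \<in> {..<k} \<rightarrow>\<^sub>E {- int b..int b}"
      using PiE_mem[OF C j] PiE_mem[OF D j] by (simp_all add: labels_def)
    thus "C j = D j"
    proof (rule PiE_ext)
      fix l assume "l \<in> {..<k}"
      thus "C j l = D j l" using fun_cong[OF eq, of "(j, l)"] j by (simp add: glue_def)
    qed
  qed
qed

text \<open>
Only the number of non-zero terms matters, and \<open>glue\<close> counts them without repetition.
\<close>
lemma sum_le_card_glue:
  fixes f :: "(nat \<Rightarrow> nat \<Rightarrow> int) \<Rightarrow> real" and K :: real
  assumes bound: "\<And>C. C \<in> {..<4} \<rightarrow>\<^sub>E labels k b \<Longrightarrow> \<bar>f C\<bar> \<le> K"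
    and supp: "\<And>C. C \<in> {..<4} \<rightarrow>\<^sub>E labels k b \<Longrightarrow> f C \<noteq> 0 \<Longrightarrow> glue k C \<in> A"
    and A: "finite A" and K: "K \<ge> 0"
  shows "(\<Sum>C\<in>{..<4::nat} \<rightarrow>\<^sub>E labels k b. f C) \<le> card A * K"
proof -
  let ?L = "{..<4::nat} \<rightarrow>\<^sub>E labels k b"
  let ?G = "{C \<in> ?L. glue k C \<in> A}"
  have fin: "finite ?L" by (intro finite_PiE) auto
  have "(\<Sum>C\<in>?L. f C) = (\<Sum>C\<in>?G. f C)"
    by (rule sum.mono_neutral_right[OF fin]) (use supp in auto)
  also have "\<dots> \<le> (\<Sum>C\<in>?G. K)"
    using bound by (intro sum_mono) (auto simp: abs_le_iff)
  also have "\<dots> = card ?G * K" by simp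
  also have "\<dots> \<le> card A * K"
  proof -
    have "inj_on (glue k) ?G" by (rule inj_on_subset[OF inj_on_glue]) auto
    hence "card ?G \<le> card A" by (rule card_inj_on_le) (use A in auto)
    thus ?thesis using K by (intro mult_right_mono) auto
  qed
  finally show ?thesis .
qed

lemma band_power_bound:
  assumes "b \<ge> 1"
  shows "real ((2 * b + 1) ^ n) \<le> 2 ^ n * (2 * real b) ^ n"
proof -
  have "real (2 * b + 1) ^ n \<le> (2 * (2 * real b)) ^ n"
    using assms by (intro power_mono) auto
  thus ?thesis by (simp only: of_nat_power power_mult_distrib[of 2 "2 * real b"])
qed

lemma scaling_fourth_power:
  "((1 / sqrt (2 * real b)) ^ k) ^ 4 = 1 / (2 * real b) ^ (2 * k)"
proof -
  have "(sqrt (2 * real b) ^ 2) ^ 2 = (2 * real b) ^ 2" by simp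
  hence "sqrt (2 * real b) ^ 4 = (2 * real b) ^ 2"
    unfolding power_mult[symmetric] by simp
  hence "(sqrt (2 * real b) ^ k) ^ 4 = ((2 * real b) ^ 2) ^ k"
    by (metis power_mult mult.commute)
  thus ?thesis by (simp only: power_one_over power_mult)
qed

text \<open>
At most half of the \<open>4 k\<close> positions carry distinct labels.
\<close>
lemma card_all_repeated_le:
  "card {c \<in> {..<4} \<times> {..<k} \<rightarrow>\<^sub>E {- int b..int b}. all_repeated ({..<4::nat} \<times> {..<k}) c}
    \<le> 2 ^ (4 * k * (4 * k)) * (2 * b + 1) ^ (2 * k)"
proof -
  let ?P = "{..<4::nat} \<times> {..<k}"
  have "card {c \<in> ?P \<rightarrow>\<^sub>E {- int b..int b}. all_repeated ?P c}
    \<le> 2 ^ (card ?P * card ?P) * card {- int b..int b} ^ (2 * k)"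
  proof (rule card_constrained_le[where F = "{}"])
    fix c assume "c \<in> {c \<in> ?P \<rightarrow>\<^sub>E {- int b..int b}. all_repeated ?P c}"
    hence rep: "all_repeated ?P c" by simp
    have "card (c ` ?P) \<le> 2 * k"
      using card_image_le_half[OF _ rep] by (simp add: card_cartesian_product)
    thus "card (c ` ?P) \<le> 2 * k \<or>
       card (c ` ?P) \<le> 2 * k + 1 \<and> (\<exists>s\<in>{}. \<exists>v\<in>c ` ?P. sum s (fibre ?P c v) \<noteq> 0) \<or>
       card (c ` ?P) \<le> 2 * k + 2 \<and> (\<exists>s\<in>{}. \<exists>s'\<in>{}. \<exists>v\<in>c ` ?P. \<exists>v'\<in>c ` ?P. v \<noteq> v' \<and>
         sum s (fibre ?P c v) \<noteq> 0 \<and> sum s' (fibre ?P c v') \<noteq> 0 \<and> (\<forall>p\<in>fibre ?P c v. s' p = 0))"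
      by (rule disjI1)
  qed auto
  thus ?thesis by (simp only: card_band card_cartesian_product card_lessThan)
qed

context independent_noise
begin

definition label_product :: "nat \<Rightarrow> (nat \<Rightarrow> int) \<Rightarrow> 'w \<Rightarrow> real" where
  "label_product k c \<omega> = (\<Prod>l<k. a (c l) \<omega>)"

text \<open>
By \<open>hankel_moment\<close> this is the moment of order \<open>k\<close> of the spectral law.
\<close>
definition empirical_moment :: "nat \<Rightarrow> nat \<Rightarrow> nat \<Rightarrow> 'w \<Rightarrow> real" where
  "empirical_moment N b k \<omega> =
     (1 / sqrt (2 * real b)) ^ k * (\<Sum>c\<in>labels k b. walk_weight N k c * label_product k c \<omega>)"

lemma integrable_label_product: "integrable M (label_product k c)"
  unfolding label_product_def by (rule integrable_monomial) auto

lemma expectation_empirical_moment: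
  "expectation (empirical_moment N b k) = (1 / sqrt (2 * real b)) ^ k *
     (\<Sum>c\<in>labels k b. walk_weight N k c * expectation (label_product k c))"
proof -
  have "expectation (empirical_moment N b k) = (1 / sqrt (2 * real b)) ^ k *
      expectation (\<lambda>\<omega>. \<Sum>c\<in>labels k b. walk_weight N k c * label_product k c \<omega>)"
    unfolding empirical_moment_def by (rule integral_mult_right_zero)
  also have "expectation (\<lambda>\<omega>. \<Sum>c\<in>labels k b. walk_weight N k c * label_product k c \<omega>) =
      (\<Sum>c\<in>labels k b. expectation (\<lambda>\<omega>. walk_weight N k c * label_product k c \<omega>))"
    by (rule Bochner_Integration.integral_sum) (rule integrable_mult_right[OF integrable_label_product])
  finally show ?thesis by simp
qed

lemma block_product_glue:
  assumes "j < 4"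
  shows "block_product k (glue k C) {j} = label_product k (C j)"
proof
  fix \<omega>
  have "block_product k (glue k C) {j} \<omega> = (\<Prod>p\<in>Pair j ` {..<k}. a (glue k C p) \<omega>)"
    unfolding block_product_def by (intro prod.cong) auto
  also have "\<dots> = label_product k (C j) \<omega>"
    using assms by (subst prod.reindex) (auto simp: inj_on_def glue_def label_product_def)
  finally show "block_product k (glue k C) {j} \<omega> = label_product k (C j) \<omega>" .
qed

text \<open>
The centring \<open>e\<close> is left open, since even moments are centred at their means and odd moments at
zero.
\<close>
lemma fourth_moment_expansion:
  fixes e :: "(nat \<Rightarrow> int) \<Rightarrow> real" and k :: nat
  defines "X \<equiv> \<lambda>C \<omega>. \<Prod>j<4::nat. label_product k (C j) \<omega> - e (C j)"
  shows "integrable M (\<lambda>\<omega>. (\<Sum>c\<in>labels k b. walk_weight N k c * (label_product k c \<omega> - e c)) ^ 4)"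
    and "expectation (\<lambda>\<omega>. (\<Sum>c\<in>labels k b. walk_weight N k c * (label_product k c \<omega> - e c)) ^ 4) =
      (\<Sum>C\<in>{..<4::nat} \<rightarrow>\<^sub>E labels k b. (\<Prod>j<4. walk_weight N k (C j)) * expectation (X C))"
proof -
  let ?L = "{..<4::nat} \<rightarrow>\<^sub>E labels k b"
  have eq: "(\<Sum>c\<in>labels k b. walk_weight N k c * (label_product k c \<omega> - e c)) ^ 4 =
      (\<Sum>C\<in>?L. (\<Prod>j<4. walk_weight N k (C j)) * X C \<omega>)" for \<omega>
    by (simp add: fourth_power_sum X_def prod.distrib)
  have int: "integrable M (X C)" for C
  proof -
    have "X C \<omega> = (\<Sum>S\<in>Pow {..<4}. block_product k (glue k C) S \<omega> * (\<Prod>j\<in>{..<4} - S. - e (C j)))" for \<omega>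
    proof -
      have "X C \<omega> = (\<Prod>j<4. block_product k (glue k C) {j} \<omega> - e (C j))"
        unfolding X_def by (intro prod.cong refl) (simp add: block_product_glue)
      thus ?thesis by (simp add: prod_centred_blocks)
    qed
    hence "X C = (\<lambda>\<omega>. \<Sum>S\<in>Pow {..<4}. block_product k (glue k C) S \<omega> * (\<Prod>j\<in>{..<4} - S. - e (C j)))"
      by blast
    moreover have "integrable M \<dots>"
      by (intro Bochner_Integration.integrable_sum integrable_mult_left integrable_block_product)
         (auto intro: finite_subset)
    ultimately show ?thesis by simp
  qed
  show "integrable M (\<lambda>\<omega>. (\<Sum>c\<in>labels k b. walk_weight N k c * (label_product k c \<omega> - e c)) ^ 4)"
    unfolding eq by (intro Bochner_Integration.integrable_sum integrable_mult_right int)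
  show "expectation (\<lambda>\<omega>. (\<Sum>c\<in>labels k b. walk_weight N k c * (label_product k c \<omega> - e c)) ^ 4) =
      (\<Sum>C\<in>?L. (\<Prod>j<4. walk_weight N k (C j)) * expectation (X C))"
    unfolding eq using int by (subst Bochner_Integration.integral_sum) auto
qed

lemma weights_prod_bounds:
  "0 \<le> (\<Prod>j<4::nat. walk_weight N k (C j))" "(\<Prod>j<4::nat. walk_weight N k (C j)) \<le> 1"
  by (auto intro!: prod_nonneg prod_le_1 walk_weight_nonneg walk_weight_le_1)

text \<open>
Non-zero terms of the expansion are clustered, by \<open>joint_central_moment_eq_0\<close> and because a non-zero weight
forces the alternating sum of each walk to be zero. So there are \<open>O(b ^ (2 k - 2))\<close> of them, while the
normalisation contributes \<open>(2 b) ^ (- 2 k)\<close>.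
\<close>
lemma central_fourth_moment_le:
  assumes k: "even k" "k > 0"
  shows "\<exists>C. \<forall>N b. b \<ge> 1 \<longrightarrow>
    integrable M (\<lambda>\<omega>. (empirical_moment N b k \<omega> - expectation (empirical_moment N b k)) ^ 4) \<and>
    expectation (\<lambda>\<omega>. (empirical_moment N b k \<omega> - expectation (empirical_moment N b k)) ^ 4)
      \<le> C / (real b)\<^sup>2"
proof -
  define K where "K = 16 * monomial_bound (4 * k) ^ 5"
  have K: "K \<ge> 0" using monomial_bound_ge_1[of "4 * k"] by (simp add: K_def)
  define D where "D = (2 :: real) ^ (4 * k * (4 * k)) * 2 ^ (2 * k - 2) * K / 4"
  show ?thesis
  proof (rule exI[of _ D], intro allI impI)
    fix N b :: nat assume b: "b \<ge> 1"
    define \<beta> where "\<beta> = (1 / sqrt (2 * real b)) ^ k"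
    define e where "e c = expectation (label_product k c)" for c
    define Z where "Z \<omega> = (\<Sum>c\<in>labels k b. walk_weight N k c * (label_product k c \<omega> - e c))" for \<omega>
    have cent: "empirical_moment N b k \<omega> - expectation (empirical_moment N b k) = \<beta> * Z \<omega>" for \<omega>
      unfolding expectation_empirical_moment unfolding empirical_moment_def \<beta>_def Z_def e_def
      by (simp add: right_diff_distrib sum_subtractf)
    have int: "integrable M (\<lambda>\<omega>. Z \<omega> ^ 4)" unfolding Z_def by (rule fourth_moment_expansion)
    have "expectation (\<lambda>\<omega>. Z \<omega> ^ 4) = (\<Sum>C\<in>{..<4::nat} \<rightarrow>\<^sub>E labels k b.
        (\<Prod>j<4. walk_weight N k (C j)) * expectation (\<lambda>\<omega>. \<Prod>j<4. label_product k (C j) \<omega> - e (C j)))"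
      unfolding Z_def by (rule fourth_moment_expansion)
    also have "\<dots> = (\<Sum>C\<in>{..<4::nat} \<rightarrow>\<^sub>E labels k b.
        (\<Prod>j<4. walk_weight N k (C j)) * joint_central_moment k (glue k C))"
    proof -
      have "(\<Prod>j<4. label_product k (C j) \<omega> - e (C j)) = (\<Prod>j<4. block_product k (glue k C) {j} \<omega>
          - expectation (block_product k (glue k C) {j}))" for C \<omega>
        by (intro prod.cong refl) (simp add: block_product_glue e_def)
      thus ?thesis by (simp add: joint_central_moment_def)
    qed
    also have "\<dots> \<le> card (clustered k b) * K"
    proof (rule sum_le_card_glue)
      show "\<bar>(\<Prod>j<4. walk_weight N k (C j)) * joint_central_moment k (glue k C)\<bar> \<le> K" for C
      proof -
        have "\<bar>(\<Prod>j<4. walk_weight N k (C j)) * joint_central_moment k (glue k C)\<bar>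
            = (\<Prod>j<4. walk_weight N k (C j)) * \<bar>joint_central_moment k (glue k C)\<bar>"
          using weights_prod_bounds(1)[of N k C] by (simp add: abs_mult)
        also have "\<dots> \<le> 1 * K"
          using abs_joint_central_moment_le[of k "glue k C"] weights_prod_bounds[of N k C]
          unfolding K_def by (intro mult_mono) auto
        finally show ?thesis by simp
      qed
    next
      fix C assume C: "C \<in> {..<4} \<rightarrow>\<^sub>E labels k b"
        and nz: "(\<Prod>j<4. walk_weight N k (C j)) * joint_central_moment k (glue k C) \<noteq> 0"
      have "all_repeated ({..<4} \<times> {..<k}) (glue k C) \<and> (\<forall>j<4. block_shared k (glue k C) j)"
        using joint_central_moment_eq_0[of k "glue k C"] nz by auto
      moreover have "(\<Sum>l<k. (-1) ^ l * glue k C (j, l)) = 0" if j: "j < 4" for j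
      proof -
        have "walk_weight N k (C j) \<noteq> 0" using nz j by auto
        from alt_sum_eq_0_if_walk_weight[OF k(1) this]
        show ?thesis using j by (simp add: alt_sum_def glue_def)
      qed
      ultimately show "glue k C \<in> clustered k b"
        using glue_in[OF C] unfolding clustered_def by blast
    next
      show "finite (clustered k b)" unfolding clustered_def
        by (rule finite_subset[of _ "{..<4} \<times> {..<k} \<rightarrow>\<^sub>E {- int b..int b}"]) (auto intro: finite_PiE)
    qed (rule K)
    also have "\<dots> \<le> (2 ^ (4 * k * (4 * k)) * (2 ^ (2 * k - 2) * (2 * real b) ^ (2 * k - 2))) * K"
    proof (rule mult_right_mono[OF _ K])
      have "real (card (clustered k b)) \<le> real (2 ^ (4 * k * (4 * k)) * (2 * b + 1) ^ (2 * k - 2))"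
        using card_clustered_le by (rule of_nat_mono)
      also have "\<dots> = 2 ^ (4 * k * (4 * k)) * real ((2 * b + 1) ^ (2 * k - 2))" by simp
      also have "\<dots> \<le> 2 ^ (4 * k * (4 * k)) * (2 ^ (2 * k - 2) * (2 * real b) ^ (2 * k - 2))"
        by (intro mult_left_mono band_power_bound[OF b]) simp
      finally show "real (card (clustered k b)) \<le> \<dots>" .
    qed
    finally have Z: "expectation (\<lambda>\<omega>. Z \<omega> ^ 4)
      \<le> 2 ^ (4 * k * (4 * k)) * 2 ^ (2 * k - 2) * K * (2 * real b) ^ (2 * k - 2)"
      by (simp add: mult_ac)
    have \<beta>: "\<beta> ^ 4 = 1 / ((2 * real b) ^ (2 * k - 2) * (4 * (real b)\<^sup>2))"
    proof -
      have "(2 * real b) ^ (2 * k) = (2 * real b) ^ (2 * k - 2) * (2 * real b) ^ 2"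
      proof -
        have "2 * k = (2 * k - 2) + 2" using k(2) by simp
        thus ?thesis by (metis power_add)
      qed
      thus ?thesis unfolding \<beta>_def scaling_fourth_power by (simp add: power_mult_distrib)
    qed
    have "expectation (\<lambda>\<omega>. (\<beta> * Z \<omega>) ^ 4) = \<beta> ^ 4 * expectation (\<lambda>\<omega>. Z \<omega> ^ 4)"
      by (simp add: power_mult_distrib)
    also have "\<dots> \<le> \<beta> ^ 4 * (2 ^ (4 * k * (4 * k)) * 2 ^ (2 * k - 2) * K * (2 * real b) ^ (2 * k - 2))"
      by (intro mult_left_mono Z) simp
    also have "\<dots> = D / (real b)\<^sup>2"
      unfolding \<beta> D_def using b by (simp add: field_simps)
    finally show "integrable M (\<lambda>\<omega>. (empirical_moment N b k \<omega> - expectation (empirical_moment N b k)) ^ 4) \<and>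
      expectation (\<lambda>\<omega>. (empirical_moment N b k \<omega> - expectation (empirical_moment N b k)) ^ 4)
        \<le> D / (real b)\<^sup>2"
      unfolding cent using int by (simp add: power_mult_distrib)
  qed
qed

text \<open>
Here the \<open>O(b ^ (2 k))\<close> tuples with repeated labels are compensated by the normalisation alone, and
each of the four weights gives a further factor \<open>1 / N\<close>.
\<close>
lemma odd_fourth_moment_le:
  assumes k: "odd k"
  shows "\<exists>C. \<forall>N b. b \<ge> 1 \<and> b < N \<longrightarrow>
    integrable M (\<lambda>\<omega>. empirical_moment N b k \<omega> ^ 4) \<and>
    expectation (\<lambda>\<omega>. empirical_moment N b k \<omega> ^ 4) \<le> C / (real b)\<^sup>2"
proof -
  define K where "K = monomial_bound (4 * k)"
  have K: "K \<ge> 0" using monomial_bound_ge_1[of "4 * k"] by (simp add: K_def)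
  define D where "D = (2 :: real) ^ (4 * k * (4 * k)) * 2 ^ (2 * k) * K"
  have "D \<ge> 0" using K by (simp add: D_def)
  show ?thesis
  proof (rule exI[of _ D], intro allI impI)
    fix N b :: nat assume Nb: "b \<ge> 1 \<and> b < N"
    hence b: "b \<ge> 1" and N: "N \<ge> 1" by auto
    define \<beta> where "\<beta> = (1 / sqrt (2 * real b)) ^ k"
    define Z where "Z \<omega> = (\<Sum>c\<in>labels k b. walk_weight N k c * (label_product k c \<omega> - 0))" for \<omega>
    let ?A = "{c \<in> {..<4} \<times> {..<k} \<rightarrow>\<^sub>E {- int b..int b}. all_repeated ({..<4::nat} \<times> {..<k}) c}"
    have emp: "empirical_moment N b k \<omega> = \<beta> * Z \<omega>" for \<omega>
      by (simp add: empirical_moment_def \<beta>_def Z_def)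
    have int: "integrable M (\<lambda>\<omega>. Z \<omega> ^ 4)" unfolding Z_def by (rule fourth_moment_expansion)
    have "expectation (\<lambda>\<omega>. Z \<omega> ^ 4) = (\<Sum>C\<in>{..<4::nat} \<rightarrow>\<^sub>E labels k b.
        (\<Prod>j<4. walk_weight N k (C j)) * expectation (\<lambda>\<omega>. \<Prod>j<4. label_product k (C j) \<omega> - 0))"
      unfolding Z_def by (rule fourth_moment_expansion)
    also have "\<dots> = (\<Sum>C\<in>{..<4::nat} \<rightarrow>\<^sub>E labels k b.
        (\<Prod>j<4. walk_weight N k (C j)) * expectation (block_product k (glue k C) {..<4}))"
    proof -
      have "(\<Prod>j<4. label_product k (C j) \<omega> - 0) = block_product k (glue k C) {..<4} \<omega>" for C \<omega>
        unfolding prod_block_product[OF finite_lessThan, symmetric]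
        by (intro prod.cong refl) (simp add: block_product_glue)
      thus ?thesis by simp
    qed
    also have "\<dots> \<le> card ?A * ((1 / N) ^ 4 * K)"
    proof (rule sum_le_card_glue)
      fix C
      have le: "(\<Prod>j<4::nat. walk_weight N k (C j)) \<le> (1 / N) ^ 4"
      proof -
        have "(\<Prod>j<4::nat. walk_weight N k (C j)) \<le> (\<Prod>j<4::nat. 1 / real N)"
          using k by (intro prod_mono conjI walk_weight_nonneg walk_weight_odd)
        thus ?thesis by simp
      qed
      have "\<bar>(\<Prod>j<4. walk_weight N k (C j)) * expectation (block_product k (glue k C) {..<4})\<bar>
          = (\<Prod>j<4. walk_weight N k (C j)) * \<bar>expectation (block_product k (glue k C) {..<4})\<bar>"
        using weights_prod_bounds(1)[of N k C] by (simp add: abs_mult)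
      also have "\<dots> \<le> (1 / N) ^ 4 * K"
        unfolding K_def block_product_def
        by (intro mult_mono le abs_expectation_monomial_le) (auto simp: card_cartesian_product)
      finally show "\<bar>(\<Prod>j<4. walk_weight N k (C j)) * expectation (block_product k (glue k C) {..<4})\<bar>
          \<le> (1 / N) ^ 4 * K" .
    next
      fix C assume C: "C \<in> {..<4} \<rightarrow>\<^sub>E labels k b"
        and nz: "(\<Prod>j<4. walk_weight N k (C j)) * expectation (block_product k (glue k C) {..<4}) \<noteq> 0"
      have "all_repeated ({..<4} \<times> {..<k}) (glue k C)"
        using expectation_monomial_eq_0[of "{..<4} \<times> {..<k}" "glue k C"] nz
        by (auto simp: block_product_def[abs_def])
      thus "glue k C \<in> ?A" using glue_in[OF C] by blast
    next
      show "finite ?A"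
        by (rule finite_subset[of _ "{..<4} \<times> {..<k} \<rightarrow>\<^sub>E {- int b..int b}"]) (auto intro: finite_PiE)
    qed (use K in simp)
    also have "\<dots> \<le> (2 ^ (4 * k * (4 * k)) * (2 ^ (2 * k) * (2 * real b) ^ (2 * k))) * ((1 / N) ^ 4 * K)"
    proof (rule mult_right_mono)
      have "real (card ?A) \<le> real (2 ^ (4 * k * (4 * k)) * (2 * b + 1) ^ (2 * k))"
        using card_all_repeated_le by (rule of_nat_mono)
      also have "\<dots> = 2 ^ (4 * k * (4 * k)) * real ((2 * b + 1) ^ (2 * k))" by simp
      also have "\<dots> \<le> 2 ^ (4 * k * (4 * k)) * (2 ^ (2 * k) * (2 * real b) ^ (2 * k))"
        by (intro mult_left_mono band_power_bound[OF b]) simp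
      finally show "real (card ?A) \<le> \<dots>" .
    qed (use K in simp)
    finally have Z: "expectation (\<lambda>\<omega>. Z \<omega> ^ 4) \<le> (2 * real b) ^ (2 * k) * (D * (1 / N) ^ 4)"
      by (simp only: D_def mult_ac)
    have "expectation (\<lambda>\<omega>. (\<beta> * Z \<omega>) ^ 4) = \<beta> ^ 4 * expectation (\<lambda>\<omega>. Z \<omega> ^ 4)"
      by (simp add: power_mult_distrib)
    also have "\<dots> \<le> \<beta> ^ 4 * ((2 * real b) ^ (2 * k) * (D * (1 / N) ^ 4))"
      by (intro mult_left_mono Z) simp
    also have "\<dots> = D * (1 / N) ^ 4"
      unfolding \<beta>_def scaling_fourth_power using b by simp
    also have "\<dots> \<le> D * (1 / b) ^ 2"
    proof (rule mult_left_mono[OF _ \<open>D \<ge> 0\<close>])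
      have "(1 / real N) ^ 4 \<le> (1 / real N) ^ 2"
        using N by (intro power_decreasing) auto
      also have "\<dots> \<le> (1 / real b) ^ 2"
        using Nb by (intro power_mono divide_left_mono) auto
      finally show "(1 / real N) ^ 4 \<le> (1 / real b) ^ 2" .
    qed
    finally show "integrable M (\<lambda>\<omega>. empirical_moment N b k \<omega> ^ 4) \<and>
        expectation (\<lambda>\<omega>. empirical_moment N b k \<omega> ^ 4) \<le> D / (real b)\<^sup>2"
      unfolding emp using int by (simp add: power_mult_distrib power_divide)
  qed
qed

end

section \<open>Convergence of the empirical moments\<close>

lemma card_matched_asymp:
  "(\<lambda>b. real (card {c \<in> labels (2 * p) b. matched p c}) / (2 * real b) ^ p) \<longlonglongrightarrow> fact p"
proof -
  have "(\<lambda>b. real ((2 * b + 1) - i) / (2 * real b)) \<longlonglongrightarrow> 1" for i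
  proof (rule Lim_transform_eventually)
    show "(\<lambda>b. (2 * real b + 1 - real i) / (2 * real b)) \<longlonglongrightarrow> 1" by real_asymp
    show "\<forall>\<^sub>F b in sequentially.
        (2 * real b + 1 - real i) / (2 * real b) = real ((2 * b + 1) - i) / (2 * real b)"
      using eventually_ge_at_top[of i] by eventually_elim (simp add: of_nat_diff)
  qed
  hence "(\<lambda>b. fact p * (\<Prod>i<p. real ((2 * b + 1) - i) / (2 * real b))) \<longlonglongrightarrow> fact p * (\<Prod>i<p. 1)"
    by (intro tendsto_intros)
  thus ?thesis by (simp add: card_matched prod_dividef)
qed

text \<open>
The sum of the functions has finite expectation, hence is almost surely finite.
\<close>
lemma (in prob_space) AE_tendsto_0_if_summable:
  fixes f :: "nat \<Rightarrow> 'a \<Rightarrow> real"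
  assumes int: "\<And>n. integrable M (f n)" and nonneg: "\<And>n \<omega>. f n \<omega> \<ge> 0"
    and sum: "summable (\<lambda>n. expectation (f n))"
  shows "AE \<omega> in M. (\<lambda>n. f n \<omega>) \<longlonglongrightarrow> 0"
proof -
  have [measurable]: "f n \<in> borel_measurable M" for n using int by auto
  have E: "expectation (f n) \<ge> 0" for n using nonneg by simp
  have "(\<integral>\<^sup>+\<omega>. (\<Sum>n. ennreal (f n \<omega>)) \<partial>M) = (\<Sum>n. \<integral>\<^sup>+\<omega>. ennreal (f n \<omega>) \<partial>M)"
    by (rule nn_integral_suminf) simp
  also have "\<dots> = (\<Sum>n. ennreal (expectation (f n)))"
    using int nonneg by (simp add: nn_integral_eq_integral)
  also have "\<dots> = ennreal (\<Sum>n. expectation (f n))"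
    using sum E by (intro suminf_ennreal2) auto
  finally have "(\<integral>\<^sup>+\<omega>. (\<Sum>n. ennreal (f n \<omega>)) \<partial>M) \<noteq> \<infinity>" by simp
  hence "AE \<omega> in M. (\<Sum>n. ennreal (f n \<omega>)) \<noteq> \<infinity>"
    by (intro nn_integral_noteq_infinite) auto
  thus ?thesis
  proof eventually_elim
    case (elim \<omega>)
    hence "summable (\<lambda>n. f n \<omega>)" using nonneg by (intro summable_suminf_not_top) auto
    thus ?case by (rule summable_LIMSEQ_zero)
  qed
qed

lemma (in prob_space) AE_tendsto_0_if_fourth_moment_le:
  fixes f :: "nat \<Rightarrow> 'a \<Rightarrow> real" and B :: "nat \<Rightarrow> nat"
  assumes int: "\<And>n. integrable M (\<lambda>\<omega>. f n \<omega> ^ 4)"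
    and le: "\<And>n. expectation (\<lambda>\<omega>. f n \<omega> ^ 4) \<le> C / (real (B n))\<^sup>2"
    and sum: "summable (\<lambda>n. 1 / (real (B n))\<^sup>2)"
  shows "AE \<omega> in M. (\<lambda>n. f n \<omega>) \<longlonglongrightarrow> 0"
proof -
  have "AE \<omega> in M. (\<lambda>n. f n \<omega> ^ 4) \<longlonglongrightarrow> 0"
  proof (rule AE_tendsto_0_if_summable[OF int])
    show "summable (\<lambda>n. expectation (\<lambda>\<omega>. f n \<omega> ^ 4))"
    proof (rule summable_comparison_test')
      show "summable (\<lambda>n. C * (1 / (real (B n))\<^sup>2))" by (rule summable_mult[OF sum])
      show "norm (expectation (\<lambda>\<omega>. f n \<omega> ^ 4)) \<le> C * (1 / (real (B n))\<^sup>2)" for n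
        using le[of n] by simp
    qed
  qed simp
  thus ?thesis
  proof eventually_elim
    case (elim \<omega>)
    hence "(\<lambda>n. root 4 (f n \<omega> ^ 4)) \<longlonglongrightarrow> root 4 0" by (rule tendsto_real_root)
    moreover have "root 4 (f n \<omega> ^ 4) = \<bar>f n \<omega>\<bar>" for n
      using real_root_power_cancel[of 4 "\<bar>f n \<omega>\<bar>"] by (simp add: power_even_abs)
    ultimately have "(\<lambda>n. \<bar>f n \<omega>\<bar>) \<longlonglongrightarrow> 0" by simp
    thus ?case by (simp add: tendsto_rabs_zero_iff)
  qed
qed

context independent_noise
begin

lemma expectation_label_product_matched:
  assumes "matched p c"
  shows "expectation (label_product (2 * p) c) = 1"
  unfolding label_product_def
  by (rule expectation_monomial_pairs) (use card_fibre_matched[OF assms] in auto)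

text \<open>
Only two kinds of label tuples have non-zero weight and non-zero expectation. Matched tuples have
expectation \<open>1\<close> and weight between \<open>1 - 4 p b / N\<close> and \<open>1\<close>; their normalised number is \<open>A\<close>. All others
are counted by \<open>card_unmatched_le\<close>, and their contribution \<open>\<delta>\<close> is of order \<open>1 / b\<close>.
\<close>
lemma expectation_even_moment_bounds:
  assumes p: "p > 0" and b: "b \<ge> 1" and N: "N > 0"
  defines "A \<equiv> real (card {c \<in> labels (2 * p) b. matched p c}) / (2 * real b) ^ p"
    and "\<delta> \<equiv> 2 ^ (2 * p * (2 * p)) * 2 ^ (p - 1) * monomial_bound (2 * p) / (2 * real b)"
  shows "(1 - 4 * real p * (real b / real N)) * A - \<delta> \<le> expectation (empirical_moment N b (2 * p))"
    and "expectation (empirical_moment N b (2 * p)) \<le> A + \<delta>"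
proof -
  let ?w = "walk_weight N (2 * p)" and ?e = "\<lambda>c. expectation (label_product (2 * p) c)"
  define L where "L = labels (2 * p) b"
  define Mt where "Mt = {c \<in> L. matched p c}"
  define Bad where
    "Bad = {c \<in> L. alt_sum c (2 * p) = 0 \<and> all_repeated {..<2 * p} c \<and> \<not> matched p c}"
  define K where "K = monomial_bound (2 * p)"
  have K: "K \<ge> 0" using monomial_bound_ge_1[of "2 * p"] by (simp add: K_def)
  have fin: "finite L" "finite Mt" "finite Bad" by (auto simp: L_def Mt_def Bad_def)
  have "(\<Sum>c\<in>L. ?w c * ?e c) = (\<Sum>c\<in>Mt \<union> Bad. ?w c * ?e c)"
  proof (rule sum.mono_neutral_right[OF fin(1)], goal_cases)
    case 2
    show ?case
    proof (intro ballI)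
      fix c assume c: "c \<in> L - (Mt \<union> Bad)"
      hence "alt_sum c (2 * p) \<noteq> 0 \<or> \<not> all_repeated {..<2 * p} c" by (auto simp: Mt_def Bad_def)
      thus "?w c * ?e c = 0"
      proof
        assume "alt_sum c (2 * p) \<noteq> 0"
        hence "?w c = 0" using alt_sum_eq_0_if_walk_weight[of "2 * p" N c] by auto
        thus ?thesis by simp
      next
        assume "\<not> all_repeated {..<2 * p} c"
        hence "?e c = 0" unfolding label_product_def by (intro expectation_monomial_eq_0) auto
        thus ?thesis by simp
      qed
    qed
  qed (auto simp: Mt_def Bad_def)
  also have "\<dots> = (\<Sum>c\<in>Mt. ?w c * ?e c) + (\<Sum>c\<in>Bad. ?w c * ?e c)"
    by (rule sum.union_disjoint[OF fin(2,3)]) (auto simp: Mt_def Bad_def)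
  also have "(\<Sum>c\<in>Mt. ?w c * ?e c) = (\<Sum>c\<in>Mt. ?w c)"
    by (intro sum.cong) (auto simp: Mt_def expectation_label_product_matched)
  finally have split: "(\<Sum>c\<in>L. ?w c * ?e c) = (\<Sum>c\<in>Mt. ?w c) + (\<Sum>c\<in>Bad. ?w c * ?e c)" .
  have bad: "\<bar>\<Sum>c\<in>Bad. ?w c * ?e c\<bar> \<le> \<delta> * (2 * real b) ^ p"
  proof -
    have "\<bar>\<Sum>c\<in>Bad. ?w c * ?e c\<bar> \<le> (\<Sum>c\<in>Bad. 1 * K)"
    proof (rule order.trans[OF sum_abs sum_mono])
      fix c
      show "\<bar>?w c * ?e c\<bar> \<le> 1 * K"
        unfolding abs_mult K_def label_product_def
        by (intro mult_mono abs_expectation_monomial_le)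
           (auto simp: walk_weight_nonneg walk_weight_le_1)
    qed
    also have "\<dots> = real (card Bad) * K" by simp
    also have "\<dots> \<le> (2 ^ (2 * p * (2 * p)) * (2 ^ (p - 1) * (2 * real b) ^ (p - 1))) * K"
    proof (rule mult_right_mono[OF _ K])
      have "real (card Bad) \<le> real (2 ^ (2 * p * (2 * p)) * (2 * b + 1) ^ (p - 1))"
        unfolding Bad_def L_def using card_unmatched_le by (rule of_nat_mono)
      also have "\<dots> = 2 ^ (2 * p * (2 * p)) * real ((2 * b + 1) ^ (p - 1))" by simp
      also have "\<dots> \<le> 2 ^ (2 * p * (2 * p)) * (2 ^ (p - 1) * (2 * real b) ^ (p - 1))"
        by (intro mult_left_mono band_power_bound[OF b]) simp
      finally show "real (card Bad) \<le> \<dots>" .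
    qed
    also have "\<dots> = \<delta> * (2 * real b) ^ p"
    proof -
      have "(2 * real b) ^ p = (2 * real b) ^ (p - 1) * (2 * real b)"
        using p by (metis Suc_diff_1 power_Suc2)
      thus ?thesis using b by (simp add: \<delta>_def K_def)
    qed
    finally show ?thesis .
  qed
  have cardMt: "real (card Mt) = A * (2 * real b) ^ p"
    using b by (simp add: A_def Mt_def L_def)
  have upper: "(\<Sum>c\<in>Mt. ?w c) \<le> A * (2 * real b) ^ p"
    unfolding cardMt[symmetric] using sum_mono[of Mt ?w "\<lambda>_. 1"] walk_weight_le_1 by simp
  have lower: "(1 - 4 * real p * (real b / real N)) * (A * (2 * real b) ^ p) \<le> (\<Sum>c\<in>Mt. ?w c)"
  proof -
    have "(\<Sum>c\<in>Mt. 1 - 4 * real p * (real b / real N)) \<le> (\<Sum>c\<in>Mt. ?w c)"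
    proof (rule sum_mono)
      fix c assume "c \<in> Mt"
      thus "1 - 4 * real p * (real b / real N) \<le> ?w c"
        using walk_weight_ge[of "2 * p" c b N] N matched_alt_sum[of p c] by (simp add: Mt_def L_def)
    qed
    thus ?thesis by (simp add: cardMt mult.commute)
  qed
  have pos: "(2 * real b) ^ p > 0" using b by simp
  have "(1 / sqrt (2 * real b)) ^ (2 * p) = 1 / (2 * real b) ^ p"
    by (simp add: power_mult power_divide)
  hence eq: "expectation (empirical_moment N b (2 * p))
      = ((\<Sum>c\<in>Mt. ?w c) + (\<Sum>c\<in>Bad. ?w c * ?e c)) / (2 * real b) ^ p"
    unfolding expectation_empirical_moment L_def[symmetric] split by simp
  show "(1 - 4 * real p * (real b / real N)) * A - \<delta> \<le> expectation (empirical_moment N b (2 * p))"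
    unfolding eq pos_le_divide_eq[OF pos] using lower bad by (simp add: algebra_simps abs_le_iff)
  show "expectation (empirical_moment N b (2 * p)) \<le> A + \<delta>"
    unfolding eq pos_divide_le_eq[OF pos] using upper bad by (simp add: algebra_simps abs_le_iff)
qed

lemma expectation_even_moment_tendsto:
  fixes N B :: "nat \<Rightarrow> nat"
  assumes p: "p > 0" and B: "\<And>n. B n \<ge> 1" "\<And>n. B n < N n"
    and B_lim: "filterlim B at_top sequentially"
    and ratio: "(\<lambda>n. real (B n) / real (N n)) \<longlonglongrightarrow> 0"
  shows "(\<lambda>n. expectation (empirical_moment (N n) (B n) (2 * p))) \<longlonglongrightarrow> fact p"
proof -
  define A where "A b = real (card {c \<in> labels (2 * p) b. matched p c}) / (2 * real b) ^ p" for b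
  define K where "K = 2 ^ (2 * p * (2 * p)) * 2 ^ (p - 1) * monomial_bound (2 * p)"
  have A: "(\<lambda>n. A (B n)) \<longlonglongrightarrow> fact p"
    using filterlim_compose[OF card_matched_asymp[of p] B_lim] by (simp add: A_def)
  have "(\<lambda>b. K / (2 * real b)) \<longlonglongrightarrow> 0" by real_asymp
  from filterlim_compose[OF this B_lim] have \<delta>: "(\<lambda>n. K / (2 * real (B n))) \<longlonglongrightarrow> 0" .
  show ?thesis
  proof (rule tendsto_sandwich[OF always_eventually always_eventually])
    show "\<forall>n. (1 - 4 * real p * (real (B n) / real (N n))) * A (B n) - K / (2 * real (B n))
        \<le> expectation (empirical_moment (N n) (B n) (2 * p))"
      "\<forall>n. expectation (empirical_moment (N n) (B n) (2 * p)) \<le> A (B n) + K / (2 * real (B n))"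
      using expectation_even_moment_bounds[OF p B(1)] le_less_trans[OF _ B(2)]
      by (simp_all add: A_def K_def)
    have "(\<lambda>n. (1 - 4 * real p * (real (B n) / real (N n))) * A (B n) - K / (2 * real (B n)))
        \<longlonglongrightarrow> (1 - 4 * real p * 0) * (fact p :: real) - 0"
      by (intro tendsto_intros ratio A \<delta>)
    thus "(\<lambda>n. (1 - 4 * real p * (real (B n) / real (N n))) * A (B n) - K / (2 * real (B n)))
        \<longlonglongrightarrow> fact p" by simp
    show "(\<lambda>n. A (B n) + K / (2 * real (B n))) \<longlonglongrightarrow> fact p"
      using tendsto_add[OF A \<delta>] by simp
  qed
qed

lemma AE_empirical_moment_tendsto:
  fixes N B :: "nat \<Rightarrow> nat"
  assumes B: "\<And>n. B n \<ge> 1" "\<And>n. B n < N n"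
    and B_lim: "filterlim B at_top sequentially"
    and ratio: "(\<lambda>n. real (B n) / real (N n)) \<longlonglongrightarrow> 0"
    and sum: "summable (\<lambda>n. 1 / (real (B n))\<^sup>2)"
  shows "AE \<omega> in M. (\<lambda>n. empirical_moment (N n) (B n) k \<omega>) \<longlonglongrightarrow> limit_moment k"
proof -
  consider "k = 0" | "odd k" | "even k" "k > 0" by blast
  thus ?thesis
  proof cases
    case 1
    have "walk_weight (N n) 0 c = 1" if "c \<in> labels 0 (B n)" for n c
      using walk_weight_ge[of 0 c "B n" "N n"] walk_weight_le_1[of "N n" 0 c] that B(2)[of n]
      by (simp add: alt_sum_def)
    hence "empirical_moment (N n) (B n) 0 \<omega> = 1" for n \<omega>
      by (simp add: empirical_moment_def label_product_def) (simp add: labels_def)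
    thus ?thesis using 1 by (simp add: limit_moment_def)
  next
    case 2
    then obtain C where C: "\<And>N b. b \<ge> 1 \<and> b < N \<Longrightarrow>
        integrable M (\<lambda>\<omega>. empirical_moment N b k \<omega> ^ 4) \<and>
        expectation (\<lambda>\<omega>. empirical_moment N b k \<omega> ^ 4) \<le> C / (real b)\<^sup>2"
      using odd_fourth_moment_le by blast
    have "AE \<omega> in M. (\<lambda>n. empirical_moment (N n) (B n) k \<omega>) \<longlonglongrightarrow> 0"
      by (rule AE_tendsto_0_if_fourth_moment_le[OF _ _ sum]) (use C B in auto)
    thus ?thesis using 2 by (simp add: limit_moment_def)
  next
    case 3
    let ?m = "\<lambda>n \<omega>. empirical_moment (N n) (B n) k \<omega>"
    obtain C where C: "\<And>N b. b \<ge> 1 \<Longrightarrow>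
        integrable M (\<lambda>\<omega>. (empirical_moment N b k \<omega> - expectation (empirical_moment N b k)) ^ 4) \<and>
        expectation (\<lambda>\<omega>. (empirical_moment N b k \<omega> - expectation (empirical_moment N b k)) ^ 4)
          \<le> C / (real b)\<^sup>2"
      using central_fourth_moment_le[OF 3] by blast
    obtain p where p: "k = 2 * p" "p > 0" using 3 by (auto elim!: evenE)
    have mean_lim: "(\<lambda>n. expectation (?m n)) \<longlonglongrightarrow> limit_moment k"
      using expectation_even_moment_tendsto[OF p(2) B B_lim ratio] by (simp add: p limit_moment_def)
    have "AE \<omega> in M. (\<lambda>n. ?m n \<omega> - expectation (?m n)) \<longlonglongrightarrow> 0"
      by (rule AE_tendsto_0_if_fourth_moment_le[OF _ _ sum]) (use C B in auto)
    thus ?thesis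
    proof eventually_elim
      case (elim \<omega>)
      from tendsto_add[OF elim mean_lim]
      show ?case by simp
    qed
  qed
qed

end

section \<open>Convergence of the spectral laws\<close>

context independent_noise
begin

abbreviation spectral_law :: "nat \<Rightarrow> nat \<Rightarrow> 'w \<Rightarrow> real measure" where
  "spectral_law N b \<omega> \<equiv> eigenvalue_distribution (scaled_hankel_band N b (\<lambda>j. a j \<omega>))"

lemma spectral_law_moment:
  "N > 0 \<Longrightarrow> (\<integral>x. x ^ k \<partial>spectral_law N b \<omega>) = empirical_moment N b k \<omega>"
  by (simp add: hankel_moment empirical_moment_def label_product_def)

lemma spectral_law_facts:
  assumes "N > 0"
  shows real_distribution_spectral_law: "real_distribution (spectral_law N b \<omega>)"
    and integrable_spectral_law:
      "g \<in> borel_measurable borel \<Longrightarrow> integrable (spectral_law N b \<omega>) (g :: real \<Rightarrow> real)"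
    and integral_spectral_law:
      "g \<in> borel_measurable borel \<Longrightarrow> (\<integral>x. g x \<partial>spectral_law N b \<omega>) =
        (\<Sum>x\<in>#eigenvalue_mset (scaled_hankel_band N b (\<lambda>j. a j \<omega>)). g x) / N"
proof -
  note sym = scaled_hankel_band_carrier[of N b "\<lambda>j. a j \<omega>"] assms
    scaled_hankel_band_symmetric[of _ N _ b "\<lambda>j. a j \<omega>"]
  show "real_distribution (spectral_law N b \<omega>)"
    by (rule real_distribution_eigenvalue_distribution[OF sym])
  assume g: "g \<in> borel_measurable borel"
  show "integrable (spectral_law N b \<omega>) g"
    by (rule integrable_eigenvalue_distribution[OF sym g])
  show "(\<integral>x. g x \<partial>spectral_law N b \<omega>) =
      (\<Sum>x\<in>#eigenvalue_mset (scaled_hankel_band N b (\<lambda>j. a j \<omega>)). g x) / N"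
    by (rule integral_eigenvalue_distribution[OF sym g])
qed

lemma AE_spectral_law_tendsto:
  fixes N B :: "nat \<Rightarrow> nat"
  assumes B: "\<And>n. B n \<ge> 1" "\<And>n. B n < N n"
    and B_lim: "filterlim B at_top sequentially"
    and ratio: "(\<lambda>n. real (B n) / real (N n)) \<longlonglongrightarrow> 0"
    and sum: "summable (\<lambda>n. 1 / (real (B n))\<^sup>2)"
  shows "AE \<omega> in M. \<forall>g :: real \<Rightarrow> real. continuous_on UNIV g \<and> bounded (range g) \<longrightarrow>
    (\<lambda>n. \<integral>x. g x \<partial>spectral_law (N n) (B n) \<omega>) \<longlonglongrightarrow> (\<integral>x. g x \<partial>limit_law)"
proof -
  have N: "N n > 0" for n using B(2)[of n] by simp
  have "AE \<omega> in M. \<forall>k. (\<lambda>n. empirical_moment (N n) (B n) k \<omega>) \<longlonglongrightarrow> limit_moment k"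
    unfolding AE_all_countable using AE_empirical_moment_tendsto[OF assms] by blast
  thus ?thesis
  proof eventually_elim
    case (elim \<omega>)
    show ?case
    proof (intro allI impI)
      fix g :: "real \<Rightarrow> real" assume g: "continuous_on UNIV g \<and> bounded (range g)"
      show "(\<lambda>n. \<integral>x. g x \<partial>spectral_law (N n) (B n) \<omega>) \<longlonglongrightarrow> (\<integral>x. g x \<partial>limit_law)"
      proof (rule moment_method)
        show "(\<lambda>n. \<integral>x. x ^ k \<partial>spectral_law (N n) (B n) \<omega>) \<longlonglongrightarrow> (\<integral>x. x ^ k \<partial>limit_law)" for k
          using elim by (simp add: spectral_law_moment[OF N] integral_limit_law_power)
        show "(\<lambda>p. t ^ (2 * p) / fact (2 * p) * (\<integral>x. x ^ (2 * p) \<partial>limit_law)) \<longlonglongrightarrow> 0" for t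
          using limit_moment_growth[of t] by (simp add: integral_limit_law_power)
        show "integrable (spectral_law (N n) (B n) \<omega>) (\<lambda>x. x ^ k)" for n k
          by (rule integrable_spectral_law[OF N]) simp
      qed (use g real_distribution_spectral_law[OF N] real_distribution_limit_law
            integrable_limit_law in auto)
    qed
  qed
qed

text \<open>
By Weierstrass approximation on growing intervals the integral is a pointwise limit of integrals of
polynomials. These are combinations of empirical moments, which are polynomials in the noise.
\<close>
lemma measurable_integral_spectral_law:
  fixes g :: "real \<Rightarrow> real"
  assumes N: "N > 0" and g: "continuous_on UNIV g"
  shows "(\<lambda>\<omega>. \<integral>x. g x \<partial>spectral_law N b \<omega>) \<in> borel_measurable M"
proof -
  have "\<exists>q. real_polynomial_function q \<and> (\<forall>x\<in>{- real n..real n}. \<bar>g x - q x\<bar> < 1 / real (Suc n))" for n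
    using Stone_Weierstrass_real_polynomial_function[of "{- real n..real n}" g "1 / real (Suc n)"]
      continuous_on_subset[OF g] 
    by (metis compact_Icc of_nat_0_less_iff subset_UNIV zero_less_Suc zero_less_divide_1_iff)
  then obtain q where q: "\<And>n. real_polynomial_function (q n)"
    "\<And>n x. x \<in> {- real n..real n} \<Longrightarrow> \<bar>g x - q n x\<bar> < 1 / real (Suc n)"
    by metis
  have conv: "(\<lambda>n. q n x) \<longlonglongrightarrow> g x" for x
  proof (rule LIM_zero_cancel, rule Lim_null_comparison)
    show "\<forall>\<^sub>F n in sequentially. norm (q n x - g x) \<le> 1 / real (Suc n)"
    proof -
      obtain m where m: "\<bar>x\<bar> \<le> real m" using real_arch_simple by blast
      show ?thesis
        using eventually_ge_at_top[of m]
      proof eventually_elim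
        case (elim n)
        hence "x \<in> {- real n..real n}" using m by (auto simp: abs_le_iff)
        from q(2)[OF this] show ?case
          by (simp only: real_norm_def abs_minus_commute[of "q n x"] less_imp_le)
      qed
    qed
  qed (rule LIMSEQ_Suc[OF lim_1_over_n])
  have g_meas: "g \<in> borel_measurable borel" using g by (rule borel_measurable_continuous_onI)
  have q_eq: "\<exists>c d. q n = (\<lambda>x. \<Sum>i\<le>d. c i * x ^ i)" for n
    using q(1)[of n] by (simp add: real_polynomial_function_iff_sum)
  have q_meas: "q n \<in> borel_measurable borel" for n
    using q_eq[of n] by auto
  have meas: "(\<lambda>\<omega>. \<integral>x. q n x \<partial>spectral_law N b \<omega>) \<in> borel_measurable M" for n
  proof -
    obtain c d where cd: "q n = (\<lambda>x. \<Sum>i\<le>d. c i * x ^ i)" using q_eq by blast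
    have "(\<integral>x. q n x \<partial>spectral_law N b \<omega>) = (\<Sum>i\<le>d. c i * empirical_moment N b i \<omega>)" for \<omega>
    proof -
      have "integrable (spectral_law N b \<omega>) (\<lambda>x. x ^ i)" for i
        by (rule integrable_spectral_law[OF N]) simp
      thus ?thesis by (simp add: cd spectral_law_moment[OF N])
    qed
    thus ?thesis unfolding empirical_moment_def label_product_def by simp
  qed
  have lim: "(\<lambda>n. \<integral>x. q n x \<partial>spectral_law N b \<omega>) \<longlonglongrightarrow> (\<integral>x. g x \<partial>spectral_law N b \<omega>)" for \<omega>
    unfolding integral_spectral_law[OF N q_meas] integral_spectral_law[OF N g_meas]
      sum_mset_eq_sum_count using N
    by (intro tendsto_intros conv) simp
  show ?thesis
    by (rule borel_measurable_LIMSEQ_real[OF lim meas])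
qed

text \<open>
Almost sure convergence and dominated convergence, as all integrals are bounded by the bound of \<open>g\<close>.
\<close>
lemma expectation_spectral_law_tendsto_fast:
  fixes N B :: "nat \<Rightarrow> nat" and g :: "real \<Rightarrow> real"
  assumes B: "\<And>n. B n \<ge> 1" "\<And>n. B n < N n"
    and B_lim: "filterlim B at_top sequentially"
    and ratio: "(\<lambda>n. real (B n) / real (N n)) \<longlonglongrightarrow> 0"
    and sum: "summable (\<lambda>n. 1 / (real (B n))\<^sup>2)"
    and g: "continuous_on UNIV g" "bounded (range g)"
  shows "(\<lambda>n. expectation (\<lambda>\<omega>. \<integral>x. g x \<partial>spectral_law (N n) (B n) \<omega>))
    \<longlonglongrightarrow> (\<integral>x. g x \<partial>limit_law)"
proof -
  have N: "N n > 0" for n using B(2)[of n] by simp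
  obtain K where K: "\<And>x. \<bar>g x\<bar> \<le> K" using g(2) by (auto simp: bounded_iff)
  have g_meas: "g \<in> borel_measurable borel" using g(1) by (rule borel_measurable_continuous_onI)
  have "(\<lambda>n. expectation (\<lambda>\<omega>. \<integral>x. g x \<partial>spectral_law (N n) (B n) \<omega>))
    \<longlonglongrightarrow> expectation (\<lambda>\<omega>. \<integral>x. g x \<partial>limit_law)"
  proof (rule integral_dominated_convergence[where w = "\<lambda>_. K"])
    show "AE \<omega> in M. (\<lambda>n. \<integral>x. g x \<partial>spectral_law (N n) (B n) \<omega>) \<longlonglongrightarrow> (\<integral>x. g x \<partial>limit_law)"
      using AE_spectral_law_tendsto[OF B B_lim ratio sum] by eventually_elim (use g in blast)
    show "AE \<omega> in M. norm (\<integral>x. g x \<partial>spectral_law (N n) (B n) \<omega>) \<le> K" for n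
    proof (rule AE_I2)
      fix \<omega>
      interpret S: real_distribution "spectral_law (N n) (B n) \<omega>"
        by (rule real_distribution_spectral_law[OF N])
      have "norm (\<integral>x. g x \<partial>spectral_law (N n) (B n) \<omega>) \<le> (\<integral>x. \<bar>g x\<bar> \<partial>spectral_law (N n) (B n) \<omega>)"
        unfolding real_norm_def by (rule integral_abs_bound)
      also have "\<dots> \<le> (\<integral>x. K \<partial>spectral_law (N n) (B n) \<omega>)"
        using g_meas K by (intro integral_mono integrable_spectral_law[OF N]) auto
      also have "\<dots> = K" using S.prob_space by simp
      finally show "norm (\<integral>x. g x \<partial>spectral_law (N n) (B n) \<omega>) \<le> K" .
    qed
  qed (use measurable_integral_spectral_law[OF N g(1)] in auto)
  thus ?thesis by (simp add: prob_space)
qed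

end

text \<open>
A sequence that does not converge to \<open>l\<close> stays away from \<open>l\<close> along a subsequence, which can be
chosen as sparse as desired.
\<close>
lemma sequence_tendsto_if_fast_subsequences:
  fixes f :: "nat \<Rightarrow> real" and b :: "nat \<Rightarrow> nat"
  assumes lim: "filterlim b at_top sequentially"
    and sub: "\<And>r :: nat \<Rightarrow> nat. (\<And>n. r n > n) \<Longrightarrow> (\<And>n. b (r n) > n) \<Longrightarrow> (\<lambda>n. f (r n)) \<longlonglongrightarrow> l"
  shows "f \<longlonglongrightarrow> l"
proof (rule ccontr)
  assume "\<not> f \<longlonglongrightarrow> l"
  then obtain e where e: "e > 0" "\<And>m. \<exists>n\<ge>m. dist (f n) l \<ge> e"
    by (auto simp: lim_sequentially not_less)
  have "\<exists>m. m > n \<and> b m > n \<and> dist (f m) l \<ge> e" for n :: nat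
  proof -
    have "\<forall>\<^sub>F m in sequentially. Suc n \<le> b m"
      using lim by (auto simp only: filterlim_at_top)
    hence "\<forall>\<^sub>F m in sequentially. b m > n" by (simp add: Suc_le_eq)
    then obtain m0 where m0: "\<And>m. m \<ge> m0 \<Longrightarrow> b m > n" by (auto simp: eventually_sequentially)
    from e(2)[of "max m0 (Suc n)"] obtain m where "m \<ge> max m0 (Suc n)" "dist (f m) l \<ge> e" by blast
    thus ?thesis using m0[of m] by (intro exI[of _ m]) auto
  qed
  then obtain r where r: "\<And>n. r n > n" "\<And>n. b (r n) > n" "\<And>n. dist (f (r n)) l \<ge> e" by metis
  from tendstoD[OF sub[OF r(1,2)] e(1)] have "\<forall>\<^sub>F n in sequentially. dist (f (r n)) l < e" .
  thus False using r(3) by (auto simp: eventually_sequentially not_less[symmetric])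
qed

lemma summable_inverse_squares_if_growth:
  fixes b :: "nat \<Rightarrow> nat"
  assumes "\<epsilon> > 0" "C > 0" and growth: "\<And>n. n \<ge> m \<Longrightarrow> real (b n) \<ge> C * real n powr (1 / 2 + \<epsilon>)"
  shows "summable (\<lambda>n. 1 / (real (b (n + m)))\<^sup>2)"
proof -
  have "summable (\<lambda>n. 1 / C\<^sup>2 * real n powr (- (1 + 2 * \<epsilon>)))"
    using assms(1) by (intro summable_mult) (simp add: summable_real_powr_iff)
  moreover have "norm (1 / (real (b n))\<^sup>2) \<le> 1 / C\<^sup>2 * real n powr (- (1 + 2 * \<epsilon>))" if n: "n \<ge> m + 1" for n
  proof -
    have pos: "C * real n powr (1 / 2 + \<epsilon>) > 0" using n assms(2) by simp
    have eq: "C\<^sup>2 * real n powr (1 + 2 * \<epsilon>) = (C * real n powr (1 / 2 + \<epsilon>))\<^sup>2"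
      by (simp add: power_mult_distrib power2_eq_square[of "_ powr _"] powr_add[symmetric] algebra_simps)
    have "C\<^sup>2 * real n powr (1 + 2 * \<epsilon>) \<le> (real (b n))\<^sup>2"
      unfolding eq using growth[of n] pos n by (intro power_mono) auto
    moreover have "real (b n) > 0" using growth[of n] pos n by linarith
    ultimately have "1 / (real (b n))\<^sup>2 \<le> 1 / (C\<^sup>2 * real n powr (1 + 2 * \<epsilon>))"
      using pos n assms(2) by (intro divide_left_mono mult_pos_pos) auto
    also have "\<dots> = 1 / C\<^sup>2 * real n powr (- (1 + 2 * \<epsilon>))"
      by (simp only: powr_minus inverse_eq_divide times_divide_times_eq mult_1)
    finally show ?thesis by simp
  qed
  ultimately have "summable (\<lambda>n. 1 / (real (b n))\<^sup>2)"
    by (rule summable_comparison_test'[where N = "m + 1"])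
  thus ?thesis by (subst summable_iff_shift)
qed

theorem theorem3p2:
  fixes M :: "'w measure" and a :: "int \<Rightarrow> 'w \<Rightarrow> real" and b :: "nat \<Rightarrow> nat"
  assumes prob: "prob_space M"
    and b_less: "\<And>N. N \<ge> 1 \<Longrightarrow> b N < N"
    and b_infty: "filterlim b at_top sequentially"
    and b_slow: "(\<lambda>N. real (b N) / real N) \<longlonglongrightarrow> 0"
    and indep: "prob_space.indep_vars M (\<lambda>_. borel) a UNIV"
    and mean: "\<And>j. prob_space.expectation M (a j) = 0"
    and variance: "\<And>j. prob_space.expectation M (\<lambda>\<omega>. \<bar>a j \<omega>\<bar> ^ 2) = 1"
    and moments: "\<And>k :: nat. (SUP j. \<integral>\<^sup>+ \<omega>. ennreal (\<bar>a j \<omega>\<bar> ^ k) \<partial>M) < \<infinity>"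
  defines "\<mu> \<equiv> \<lambda>N \<omega>. eigenvalue_distribution (scaled_hankel_band N (b N) (\<lambda>j. a j \<omega>))"
  shows
    "(\<forall>g :: real \<Rightarrow> real. continuous_on UNIV g \<and> bounded (range g) \<longrightarrow>
        (\<lambda>N. prob_space.expectation M (\<lambda>\<omega>. \<integral>x. g x \<partial>\<mu> N \<omega>))
          \<longlonglongrightarrow> (\<integral>x. g x * (\<bar>x\<bar> * exp (- (x ^ 2))) \<partial>lborel))
     \<and>
     ((\<exists>\<epsilon>\<^sub>0 > 0. \<exists>C > 0. \<forall>\<^sub>F N in sequentially. real (b N) \<ge> C * real N powr (1 / 2 + \<epsilon>\<^sub>0))
       \<longrightarrow> (AE \<omega> in M. \<forall>g :: real \<Rightarrow> real. continuous_on UNIV g \<and> bounded (range g) \<longrightarrow>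
              (\<lambda>N. \<integral>x. g x \<partial>\<mu> N \<omega>)
                \<longlonglongrightarrow> (\<integral>x. g x \<partial>density lborel (\<lambda>x. ennreal (\<bar>x\<bar> * exp (- (x ^ 2)))))))"
proof -
  interpret independent_noise M a
    using prob indep mean variance moments
    by (intro independent_noise.intro independent_noise_axioms.intro) auto
  show ?thesis
  proof (intro conjI allI impI)
    fix g :: "real \<Rightarrow> real" assume "continuous_on UNIV g \<and> bounded (range g)"
    hence g: "continuous_on UNIV g" "bounded (range g)" by auto
    have "(\<lambda>N. expectation (\<lambda>\<omega>. \<integral>x. g x \<partial>\<mu> N \<omega>)) \<longlonglongrightarrow> (\<integral>x. g x \<partial>limit_law)"
    proof (rule sequence_tendsto_if_fast_subsequences[OF b_infty])
      fix r :: "nat \<Rightarrow> nat" assume r: "\<And>n. r n > n" "\<And>n. b (r n) > n"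
      have r_lim: "filterlim r at_top sequentially"
        using r(1) by (intro filterlim_at_top_mono[OF filterlim_ident always_eventually] allI)
          (simp add: less_imp_le)
      show "(\<lambda>n. expectation (\<lambda>\<omega>. \<integral>x. g x \<partial>\<mu> (r n) \<omega>)) \<longlonglongrightarrow> (\<integral>x. g x \<partial>limit_law)"
        unfolding \<mu>_def
      proof (rule expectation_spectral_law_tendsto_fast[OF _ _ _ _ _ g])
        show "b (r n) \<ge> 1" for n using r(2)[of n] by simp
        show "b (r n) < r n" for n using b_less[of "r n"] r(1)[of n] by simp
        show "filterlim (\<lambda>n. b (r n)) at_top sequentially"
          by (rule filterlim_compose[OF b_infty r_lim])
        show "(\<lambda>n. real (b (r n)) / real (r n)) \<longlonglongrightarrow> 0"
          by (rule filterlim_compose[OF b_slow r_lim])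
        show "summable (\<lambda>n. 1 / (real (b (r n)))\<^sup>2)"
        proof (rule summable_comparison_test')
          show "summable (\<lambda>n. inverse ((real (Suc n))\<^sup>2))"
            using inverse_power_summable[of 2, where ?'a = real]
            by (subst summable_Suc_iff) simp_all
          show "norm (1 / (real (b (r n)))\<^sup>2) \<le> inverse ((real (Suc n))\<^sup>2)" for n
            using r(2)[of n] by (simp add: inverse_eq_divide) (intro divide_left_mono power_mono; simp)
        qed
      qed
    qed
    also have "(\<integral>x. g x \<partial>limit_law) = (\<integral>x. g x * (\<bar>x\<bar> * exp (- (x ^ 2))) \<partial>lborel)"
      using g(1) by (intro integral_limit_law borel_measurable_continuous_onI)
    finally show "(\<lambda>N. expectation (\<lambda>\<omega>. \<integral>x. g x \<partial>\<mu> N \<omega>))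
        \<longlonglongrightarrow> (\<integral>x. g x * (\<bar>x\<bar> * exp (- (x ^ 2))) \<partial>lborel)" .
  next
    assume "\<exists>\<epsilon>\<^sub>0 > 0. \<exists>C > 0. \<forall>\<^sub>F N in sequentially. real (b N) \<ge> C * real N powr (1 / 2 + \<epsilon>\<^sub>0)"
    then obtain \<epsilon> C where \<epsilon>C: "\<epsilon> > 0" "C > 0"
      and ev: "\<forall>\<^sub>F N in sequentially. real (b N) \<ge> C * real N powr (1 / 2 + \<epsilon>)" by blast
    have "\<forall>\<^sub>F N in sequentially. b N \<ge> 1"
      using b_infty by (simp add: filterlim_at_top)
    with ev have "\<forall>\<^sub>F N in sequentially. real (b N) \<ge> C * real N powr (1 / 2 + \<epsilon>) \<and> b N \<ge> 1"
      by eventually_elim simp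
    then obtain m where m: "\<And>N. N \<ge> m \<Longrightarrow> real (b N) \<ge> C * real N powr (1 / 2 + \<epsilon>)"
      "\<And>N. N \<ge> m \<Longrightarrow> b N \<ge> 1" by (auto simp: eventually_sequentially)
    (* The growth bound and b N > 0 hold for N >= m only, and the matrix must not be empty. *)
    have "AE \<omega> in M. \<forall>g :: real \<Rightarrow> real. continuous_on UNIV g \<and> bounded (range g) \<longrightarrow>
      (\<lambda>n. \<integral>x. g x \<partial>spectral_law (n + m + 1) (b (n + m + 1)) \<omega>) \<longlonglongrightarrow> (\<integral>x. g x \<partial>limit_law)"
    proof (rule AE_spectral_law_tendsto)
      have shift: "filterlim (\<lambda>n. n + m + 1) at_top sequentially"
        by (intro filterlim_at_top_mono[OF filterlim_ident always_eventually]) simp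
      show "filterlim (\<lambda>n. b (n + m + 1)) at_top sequentially"
        by (rule filterlim_compose[OF b_infty shift])
      show "(\<lambda>n. real (b (n + m + 1)) / real (n + m + 1)) \<longlonglongrightarrow> 0"
        by (rule filterlim_compose[OF b_slow shift])
      show "summable (\<lambda>n. 1 / (real (b (n + m + 1)))\<^sup>2)"
        using summable_inverse_squares_if_growth[OF \<epsilon>C, of "m + 1" b] m(1) by (simp add: add.assoc)
    qed (use m b_less in auto)
    thus "AE \<omega> in M. \<forall>g :: real \<Rightarrow> real. continuous_on UNIV g \<and> bounded (range g) \<longrightarrow>
        (\<lambda>N. \<integral>x. g x \<partial>\<mu> N \<omega>)
          \<longlonglongrightarrow> (\<integral>x. g x \<partial>density lborel (\<lambda>x. ennreal (\<bar>x\<bar> * exp (- (x ^ 2)))))"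
    proof eventually_elim
      case (elim \<omega>)
      show ?case
      proof (intro allI impI)
        fix g :: "real \<Rightarrow> real" assume "continuous_on UNIV g \<and> bounded (range g)"
        with elim have "(\<lambda>n. \<integral>x. g x \<partial>\<mu> (n + (m + 1)) \<omega>) \<longlonglongrightarrow> (\<integral>x. g x \<partial>limit_law)"
          by (simp add: \<mu>_def add.assoc)
        thus "(\<lambda>N. \<integral>x. g x \<partial>\<mu> N \<omega>)
            \<longlonglongrightarrow> (\<integral>x. g x \<partial>density lborel (\<lambda>x. ennreal (\<bar>x\<bar> * exp (- (x ^ 2)))))"
          unfolding limit_law_def by (rule LIMSEQ_offset)
      qed
    qed
  qed
qed

end
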